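(* Let $K\ge2$, $d=d_1+\cdots+d_K$, and let $\mathbf{X}_1,\ldots,\mathbf{X}_n$ be i.i.d. from a distribution $\mu$ on $\mathbb{R}^d$, written $\mathbf{X}_i=(\mathbf{X}_i^1,\ldots,\mathbf{X}_i^K)$ with $\mathbf{X}_i^j\in\mathbb{R}^{d_j}$, $\mathbf{X}_1^j\sim\mu_j$. For each $n$ and $j$ let $\mathcal{H}_n^{d_j}\subset[0,1]^{d_j}$ be a fixed set of $n$ points. Consider testing $\mathrm{H}_0:\mu=\mu_1\otimes\cdots\otimes\mu_K$ against $\mathrm{H}_1$: not $\mathrm{H}_0$. If the marginals $\mu_j$, $1\le j\le K$, are Lebesgue absolutely continuous, then, under $\mathrm{H}_0$, $\mathrm{RdCov}_n^2$ is a distribution-free statistic (its law does not depend on $\mu_1,\ldots,\mu_K$). If, additionally, the empirical distributions on $\mathcal{H}_n^{d_j}$ converge weakly to $\mathcal{U}^{d_j}$ for $j=1,\ldots,K$, then the test which rejects $\mathrm{H}_0$ when $n\,\mathrm{RdCov}_n^2\ge c_n$ is consistent: for every fixed $\mu$ (with absolutely continuous marginals) satisfying $\mathrm{H}_1$, $\mathbb{P}(n\,\mathrm{RdCov}_n^2\ge c_n)\to1$ as $n\to\infty$.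
   Context: $\mathcal{U}^d$: uniform distribution on $[0,1]^d$. $S_n$: permutations of $\{1,\ldots,n\}$. Empirical rank maps: for $1\le j\le K$ and $\mathcal{H}_n^{d_j}=\{\mathbf{h}_1,\ldots,\mathbf{h}_n\}$, let $\hat\sigma_j\in\arg\min_{\sigma\in S_n}\sum_{i=1}^n\|\mathbf{X}_i^j-\mathbf{h}_{\sigma(i)}\|^2$ (almost surely unique) and $\hat R_n^j(\mathbf{X}_i^j):=\mathbf{h}_{\hat\sigma_j(i)}$. For $1\le j\le K-1$ set $\mathbf{X}_i^{j+}=(\mathbf{X}_i^{j+1},\ldots,\mathbf{X}_i^K)$ and $\hat R_n^{j+}(\mathbf{X}_i^{j+}):=(\hat R_n^{j+1}(\mathbf{X}_i^{j+1}),\ldots,\hat R_n^K(\mathbf{X}_i^K))$. With $a_{kl}^j=\|\hat R_n^j(\mathbf{X}_k^j)-\hat R_n^j(\mathbf{X}_l^j)\|$ and $b_{kl}^j=\|\hat R_n^{j+}(\mathbf{X}_k^{j+})-\hat R_n^{j+}(\mathbf{X}_l^{j+})\|$, define $$\mathrm{RdCov}_{n,j}^2=\Big(\frac1{n^2}\sum_{k,l}a_{kl}^j\Big)\Big(\frac1{n^2}\sum_{k,l}b_{kl}^j\Big)+\frac1{n^2}\sum_{k,l}a_{kl}^jb_{kl}^j-\frac2{n^3}\sum_{k,l,i}a_{kl}^jb_{ki}^j,\qquad\mathrm{RdCov}_n^2=\sum_{j=1}^{K-1}\mathrm{RdCov}_{n,j}^2.$$ Critical value: for a prespecified level $\alpha\in(0,1)$,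 $c_n:=\inf\{c:\mathbb{P}_{\mathrm{H}_0}(n\,\mathrm{RdCov}_n^2\ge c)\le\alpha\}$, with $\mathbb{P}_{\mathrm{H}_0}$ the law under $\mathrm{H}_0$ (absolutely continuous marginals). *)

theory Defs
  imports "HOL-Probability.Probability"
begin

text \<open>
  The dimensions \<open>d 1, \<dots>, d K\<close> differ from block to block, so a point of $R^m$ is a function
  in \<open>{..<m} \<rightarrow>\<^sub>E UNIV\<close>, and a point of $R^{d_1} \times \cdots \times R^{d_K}$ is a
  function on \<open>{1..K}\<close> whose value at \<open>j\<close> is a point of $R^{d_j}$.
\<close>

type_synonym rvec = "nat \<Rightarrow> real"
type_synonym blocks = "nat \<Rightarrow> rvec"

definition lborel_Rn :: "nat \<Rightarrow> rvec measure" where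
  "lborel_Rn m = (\<Pi>\<^sub>M c\<in>{..<m}. lborel)"

definition dist_Rn :: "nat \<Rightarrow> rvec \<Rightarrow> rvec \<Rightarrow> real" where
  "dist_Rn m u v = L2_set (\<lambda>c. u c - v c) {..<m}"

definition unit_cube :: "nat \<Rightarrow> rvec set" where
  "unit_cube m = {..<m} \<rightarrow>\<^sub>E {0..1}"

definition unif_cube :: "nat \<Rightarrow> rvec measure" where
  "unif_cube m = uniform_measure (lborel_Rn m) (unit_cube m)"

definition empirical_distr :: "nat \<Rightarrow> nat \<Rightarrow> (nat \<Rightarrow> rvec) \<Rightarrow> rvec measure" where
  "empirical_distr m n g = distr (uniform_count_measure {1..n}) (lborel_Rn m) g"

definition weak_conv_Rn :: "nat \<Rightarrow> (nat \<Rightarrow> rvec measure) \<Rightarrow> rvec measure \<Rightarrow> bool" where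
  "weak_conv_Rn m P Q \<longleftrightarrow>
     (\<forall>f. continuous_map (product_topology (\<lambda>_. euclideanreal) {..<m}) euclideanreal f \<and>
          bounded (f ` ({..<m} \<rightarrow>\<^sub>E UNIV)) \<longrightarrow>
          (\<lambda>n. \<integral>x. f x \<partial>P n) \<longlonglongrightarrow> (\<integral>x. f x \<partial>Q))"

text \<open>Only the measurable structure of the following product is used.\<close>

definition block_space :: "nat \<Rightarrow> (nat \<Rightarrow> nat) \<Rightarrow> blocks measure" where
  "block_space K d = (\<Pi>\<^sub>M j\<in>{1..K}. lborel_Rn (d j))"

definition marginal :: "(nat \<Rightarrow> nat) \<Rightarrow> blocks measure \<Rightarrow> nat \<Rightarrow> rvec measure" where
  "marginal d \<mu> j = distr \<mu> (lborel_Rn (d j)) (\<lambda>x. x j)"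

definition ac_marginals :: "nat \<Rightarrow> (nat \<Rightarrow> nat) \<Rightarrow> blocks measure \<Rightarrow> bool" where
  "ac_marginals K d \<mu> \<longleftrightarrow>
     (\<forall>j\<in>{1..K}. absolutely_continuous (lborel_Rn (d j)) (marginal d \<mu> j))"

definition H0 :: "nat \<Rightarrow> (nat \<Rightarrow> nat) \<Rightarrow> blocks measure \<Rightarrow> bool" where
  "H0 K d \<mu> \<longleftrightarrow> \<mu> = (\<Pi>\<^sub>M j\<in>{1..K}. marginal d \<mu> j)"

definition iid_from ::
  "nat \<Rightarrow> (nat \<Rightarrow> nat) \<Rightarrow> 'a measure \<Rightarrow> nat set \<Rightarrow> (nat \<Rightarrow> 'a \<Rightarrow> blocks) \<Rightarrow> blocks measure \<Rightarrow> bool"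
where
  "iid_from K d M I X \<mu> \<longleftrightarrow>
     prob_space M \<and>
     prob_space.indep_vars M (\<lambda>_. block_space K d) X I \<and>
     (\<forall>i\<in>I. distr M (block_space K d) (X i) = \<mu>)"

text \<open>
  If the minimiser is not unique (a null event for absolutely continuous data), the choice made by
  \<^const>\<open>arg_min_on\<close> depends only on the set of minimisers, hence the selection is still
  a measurable function of the data \<open>z\<close>.
\<close>

definition opt_perm :: "nat \<Rightarrow> nat \<Rightarrow> (nat \<Rightarrow> rvec) \<Rightarrow> (nat \<Rightarrow> rvec) \<Rightarrow> nat \<Rightarrow> nat" where
  "opt_perm m n g z =
     arg_min_on (\<lambda>\<sigma>. \<Sum>i=1..n. (dist_Rn m (z i) (g (\<sigma> i)))\<^sup>2) {\<sigma>. \<sigma> permutes {1..n}}"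

text \<open>
  Below, \<open>h n j 1, \<dots>, h n j n\<close> enumerate the \<open>n\<close> reference points in $[0,1]^{d_j}$,
  \<open>x i j\<close> is the \<open>j\<close>-th block of the \<open>i\<close>-th observation, and \<open>emp_rank d h n x j i\<close> is
  the empirical rank of \<open>x i j\<close>.
\<close>

definition emp_rank ::
  "(nat \<Rightarrow> nat) \<Rightarrow> (nat \<Rightarrow> nat \<Rightarrow> nat \<Rightarrow> rvec) \<Rightarrow> nat \<Rightarrow> (nat \<Rightarrow> blocks) \<Rightarrow> nat \<Rightarrow> nat \<Rightarrow> rvec"
where
  "emp_rank d h n x j i = h n j (opt_perm (d j) n (h n j) (\<lambda>i. x i j) i)"

definition rank_dist ::
  "(nat \<Rightarrow> nat) \<Rightarrow> (nat \<Rightarrow> nat \<Rightarrow> nat \<Rightarrow> rvec) \<Rightarrow> nat \<Rightarrow> (nat \<Rightarrow> blocks) \<Rightarrow> nat \<Rightarrow> nat \<Rightarrow> nat \<Rightarrow> real"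
where
  "rank_dist d h n x j k l = dist_Rn (d j) (emp_rank d h n x j k) (emp_rank d h n x j l)"

text \<open>Euclidean distance of the concatenated rank vectors of the blocks \<open>j + 1, \<dots>, K\<close>.\<close>

definition rank_dist_plus ::
  "nat \<Rightarrow> (nat \<Rightarrow> nat) \<Rightarrow> (nat \<Rightarrow> nat \<Rightarrow> nat \<Rightarrow> rvec) \<Rightarrow> nat \<Rightarrow> (nat \<Rightarrow> blocks) \<Rightarrow>
     nat \<Rightarrow> nat \<Rightarrow> nat \<Rightarrow> real"
where
  "rank_dist_plus K d h n x j k l =
     L2_set (\<lambda>(m, c). emp_rank d h n x m k c - emp_rank d h n x m l c)
       (SIGMA m:{j+1..K}. {..<d m})"

definition dCov2 :: "nat \<Rightarrow> (nat \<Rightarrow> nat \<Rightarrow> real) \<Rightarrow> (nat \<Rightarrow> nat \<Rightarrow> real) \<Rightarrow> real" where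
  "dCov2 n a b =
     (1 / real n ^ 2 * (\<Sum>k=1..n. \<Sum>l=1..n. a k l)) * (1 / real n ^ 2 * (\<Sum>k=1..n. \<Sum>l=1..n. b k l))
     + 1 / real n ^ 2 * (\<Sum>k=1..n. \<Sum>l=1..n. a k l * b k l)
     - 2 / real n ^ 3 * (\<Sum>k=1..n. \<Sum>l=1..n. \<Sum>i=1..n. a k l * b k i)"

definition RdCov2 ::
  "nat \<Rightarrow> (nat \<Rightarrow> nat) \<Rightarrow> (nat \<Rightarrow> nat \<Rightarrow> nat \<Rightarrow> rvec) \<Rightarrow> nat \<Rightarrow> (nat \<Rightarrow> blocks) \<Rightarrow> real"
where
  "RdCov2 K d h n x =
     (\<Sum>j=1..K-1. dCov2 n (rank_dist d h n x j) (rank_dist_plus K d h n x j))"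

definition crit_value :: "real \<Rightarrow> 'a measure \<Rightarrow> ('a \<Rightarrow> real) \<Rightarrow> real" where
  "crit_value \<alpha> N T = Inf {c. measure N {\<omega> \<in> space N. T \<omega> \<ge> c} \<le> \<alpha>}"

end

theory Submission
  imports Defs
begin

text \<open>
  Distribution-freeness: under \<open>H0\<close> all blocks of all observations are independent, so the law of
  the data is invariant under permuting the observations separately in each block. The optimal
  assignments are almost surely unique (ties lie on hyperplanes) and therefore equivariant, so the
  \<open>K\<close>-tuple of optimal permutations is uniform; averaging over it also bounds the mean of the
  statistic by a multiple of $1/(n-1)$, and the critical values are $o(n)$.

  Consistency needs no optimal transport map in the limit. Writing
  $|x| = c \int (1 - e^{-|x|^2/t^2}) dt$ and expanding the Gaussian kernel into monomials shows that a
  small sample distance covariance makes all covariances between polynomials of the ranks small,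
  uniformly in the sample. On the other hand, an optimal assignment is pairwise monotone, so only few
  cells of a fine grid contain ranks both of observations with $x_c \le b_c$ and of observations with
  $x_c \ge b_c + \delta$; hence indicators of orthants in the data are, up to a small error on average,
  functions of the ranks taken from a finite family. Dependence of the blocks, witnessed by finitely
  many orthant frequencies, thus forces the statistic to stay above a positive constant.
\<close>

section \<open>Sample averages and the distance covariance\<close>

text \<open>The assignment that links data to ranks changes with the whole sample, so every choice
  made from the sample must range over a finite set fixed before \<open>n\<close> grows; here it is
  a set of grid cells. Monotonicity bounds the straddling cells in one column by a number
  \<open>W\<close> that depends on the data range, the margin \<delta> and the dimension
  \<open>m\<close>, but not on the mesh 1/k. So O(k^(m-1)) cells straddle. The ranks permute the
  reference points, hence each cell holds a share of order k^(-m) of them, and the total share is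
  O(1/k). Weak convergence enters only through these shares. The distance is not a positive definite
  kernel, but its covariance ignores additive constants. So 1 - exp may be replaced by the Gaussian
  on both sides, whose expansion has non-negative coefficients: the distance covariance becomes a
  mixture of squared covariances, and no cancellation can hide a large one. The \<open>K - 1\<close>
  summands compare each block with all later ones, which telescopes to joint independence.\<close>

definition avg :: "nat \<Rightarrow> (nat \<Rightarrow> real) \<Rightarrow> real" where
  "avg n f = (\<Sum>i=1..n. f i) / real n"

definition cov :: "nat \<Rightarrow> (nat \<Rightarrow> real) \<Rightarrow> (nat \<Rightarrow> real) \<Rightarrow> real" where
  "cov n f g = avg n (\<lambda>i. f i * g i) - avg n f * avg n g"

lemma avg_add: "avg n (\<lambda>i. f i + g i) = avg n f + avg n g"
  by (simp add: avg_def sum.distrib add_divide_distrib)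

lemma avg_diff: "avg n (\<lambda>i. f i - g i) = avg n f - avg n g"
  by (simp add: avg_def sum_subtractf diff_divide_distrib)

lemma avg_cmult: "avg n (\<lambda>i. c * f i) = c * avg n f"
  by (simp add: avg_def sum_distrib_left)

lemma avg_sum: "avg n (\<lambda>i. \<Sum>s\<in>S. f s i) = (\<Sum>s\<in>S. avg n (f s))"
proof -
  have "(\<Sum>i=1..n. \<Sum>s\<in>S. f s i) = (\<Sum>s\<in>S. \<Sum>i=1..n. f s i)"
    by (rule sum.swap)
  then show ?thesis by (simp add: avg_def sum_divide_distrib)
qed

lemma avg_const: "n \<ge> 1 \<Longrightarrow> avg n (\<lambda>i. c) = c"
  by (simp add: avg_def)

lemma avg_mono: "(\<And>i. i \<in> {1..n} \<Longrightarrow> f i \<le> g i) \<Longrightarrow> avg n f \<le> avg n g"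
  unfolding avg_def by (intro divide_right_mono sum_mono) auto

lemma avg_cong: "(\<And>i. i \<in> {1..n} \<Longrightarrow> f i = g i) \<Longrightarrow> avg n f = avg n g"
  unfolding avg_def by (metis (no_types, lifting) sum.cong)

lemma avg_nonneg: "(\<And>i. i \<in> {1..n} \<Longrightarrow> 0 \<le> f i) \<Longrightarrow> 0 \<le> avg n f"
  unfolding avg_def by (intro divide_nonneg_nonneg sum_nonneg) auto

lemma avg_abs_le: "\<bar>avg n f\<bar> \<le> avg n (\<lambda>i. \<bar>f i\<bar>)"
  unfolding avg_def by (simp add: divide_right_mono)

lemma abs_avg_bound:
  assumes "\<And>i. i \<in> {1..n} \<Longrightarrow> \<bar>f i\<bar> \<le> B" and "0 \<le> B"
  shows "\<bar>avg n f\<bar> \<le> B"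
proof (cases "n = 0")
  case False
  have "\<bar>avg n f\<bar> \<le> avg n (\<lambda>i. \<bar>f i\<bar>)" by (rule avg_abs_le)
  also have "\<dots> \<le> avg n (\<lambda>i. B)" by (intro avg_mono assms)
  also have "\<dots> = B" using False by (intro avg_const) auto
  finally show ?thesis .
qed (use assms in \<open>simp add: avg_def\<close>)

lemma cov_cmult_left: "cov n (\<lambda>i. c * f i) g = c * cov n f g"
  by (simp add: cov_def avg_cmult algebra_simps)

lemma cov_sum_left: "cov n (\<lambda>i. \<Sum>s\<in>S. f s i) g = (\<Sum>s\<in>S. cov n (f s) g)"
  by (simp add: cov_def avg_sum sum_distrib_right sum_subtractf)

lemma cov_commute: "cov n f g = cov n g f"
  by (simp add: cov_def mult.commute)

lemma cov_perturb_left: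
  assumes "\<And>i. i \<in> {1..n} \<Longrightarrow> \<bar>f i - f' i\<bar> \<le> \<eta>" and "\<And>i. i \<in> {1..n} \<Longrightarrow> \<bar>g i\<bar> \<le> 1" and "0 \<le> \<eta>"
  shows "\<bar>cov n f g - cov n f' g\<bar> \<le> 2 * \<eta>"
proof -
  have "cov n f g - cov n f' g = avg n (\<lambda>i. (f i - f' i) * g i) - avg n (\<lambda>i. f i - f' i) * avg n g"
    by (simp add: cov_def avg_diff algebra_simps)
  moreover have "\<bar>avg n (\<lambda>i. (f i - f' i) * g i)\<bar> \<le> \<eta>"
  proof (rule abs_avg_bound)
    fix i assume "i \<in> {1..n}"
    then have "\<bar>f i - f' i\<bar> * \<bar>g i\<bar> \<le> \<eta> * 1" using assms by (intro mult_mono) auto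
    then show "\<bar>(f i - f' i) * g i\<bar> \<le> \<eta>" by (simp add: abs_mult)
  qed fact
  moreover have "\<bar>avg n (\<lambda>i. f i - f' i) * avg n g\<bar> \<le> \<eta> * 1"
    unfolding abs_mult using assms by (intro mult_mono abs_avg_bound) auto
  ultimately show ?thesis by linarith
qed

text \<open>For fixed \<open>k\<close> the sum over \<open>l\<close> and \<open>i\<close> in the
  last term factors, so only row averages and one joint average remain.\<close>

lemma dCov2_eq_avg:
  "dCov2 n a b = avg n (\<lambda>k. avg n (a k)) * avg n (\<lambda>k. avg n (b k))
     + avg n (\<lambda>k. avg n (\<lambda>l. a k l * b k l)) - 2 * avg n (\<lambda>k. avg n (a k) * avg n (b k))"
proof -
  have "(\<Sum>k=1..n. \<Sum>l=1..n. \<Sum>i=1..n. a k l * b k i) = (\<Sum>k=1..n. (\<Sum>l=1..n. a k l) * (\<Sum>i=1..n. b k i))"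
    by (simp add: sum_product)
  then show ?thesis
    by (simp add: dCov2_def avg_def power2_eq_square power3_eq_cube sum_divide_distrib[symmetric])
qed

lemma dCov2_commute: "dCov2 n a b = dCov2 n b a"
  by (simp add: dCov2_eq_avg mult.commute)

text \<open>With F, G, H the averages of \<open>f\<close>, \<open>g\<close> and their product, the
  three terms are F^2 G^2, H^2 and -2 F G H, a perfect square.\<close>

lemma dCov2_rank_one: "dCov2 n (\<lambda>k l. f k * f l) (\<lambda>k l. g k * g l) = (cov n f g)\<^sup>2"
proof -
  have *: "avg n (\<lambda>k. c k * e) = avg n c * e" for c :: "nat \<Rightarrow> real" and e
    using avg_cmult[of n e c] by (simp add: mult.commute)
  have "(\<lambda>k. avg n (\<lambda>l. f k * f l * (g k * g l))) = (\<lambda>k. f k * g k * avg n (\<lambda>l. f l * g l))"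
    by (rule ext, subst avg_cmult[symmetric]) (simp add: mult_ac)
  moreover have "(\<lambda>k. f k * avg n f * (g k * avg n g)) = (\<lambda>k. f k * g k * (avg n f * avg n g))"
    by (simp add: mult_ac)
  ultimately show ?thesis
    unfolding dCov2_eq_avg avg_cmult
    by (simp only: * cov_def) (simp add: power2_eq_square algebra_simps)
qed

text \<open>All row averages of the first kernel equal \<open>c\<close>, so the three terms are 1, 1
  and -2 times \<open>c\<close> times the mean of \<open>b\<close>.\<close>

lemma dCov2_const_left: "n \<ge> 1 \<Longrightarrow> dCov2 n (\<lambda>_ _. c) b = 0"
  by (simp add: dCov2_eq_avg avg_const avg_cmult)

lemma dCov2_add_left: "dCov2 n (\<lambda>k l. a k l + a' k l) b = dCov2 n a b + dCov2 n a' b"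
  by (simp add: dCov2_eq_avg avg_add distrib_left distrib_right)

lemma dCov2_cmult_left: "dCov2 n (\<lambda>k l. c * a k l) b = c * dCov2 n a b"
proof -
  have "(\<lambda>k. avg n (\<lambda>l. c * a k l * b k l)) = (\<lambda>k. c * avg n (\<lambda>l. a k l * b k l))"
    by (simp add: avg_cmult[symmetric] mult.assoc)
  moreover have "(\<lambda>k. c * avg n (a k) * avg n (b k)) = (\<lambda>k. c * (avg n (a k) * avg n (b k)))"
    by (simp add: mult.assoc)
  ultimately show ?thesis
    by (simp add: dCov2_eq_avg avg_cmult algebra_simps)
qed

lemma dCov2_zero_left: "dCov2 n (\<lambda>_ _. 0) b = 0"
  using dCov2_cmult_left[of n 0 "\<lambda>_ _. 0" b] by simp

lemma dCov2_sum_left: "dCov2 n (\<lambda>k l. \<Sum>s\<in>S. a s k l) b = (\<Sum>s\<in>S. dCov2 n (a s) b)"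
proof (cases "finite S")
  case True
  then show ?thesis by induction (simp_all add: dCov2_zero_left dCov2_add_left)
qed (simp add: dCov2_zero_left)

lemma dCov2_sum_right: "dCov2 n a (\<lambda>k l. \<Sum>s\<in>S. b s k l) = (\<Sum>s\<in>S. dCov2 n a (b s))"
  using dCov2_sum_left[where a = b and b = a] by (simp add: dCov2_commute)

lemma dCov2_cmult_right: "dCov2 n a (\<lambda>k l. c * b k l) = c * dCov2 n a b"
  using dCov2_cmult_left[of n c b a] by (simp add: dCov2_commute)

lemma dCov2_one_minus:
  assumes "n \<ge> 1"
  shows "dCov2 n (\<lambda>k l. 1 - a k l) b = - dCov2 n a b"
  using dCov2_add_left[of n "\<lambda>k l. 1" "\<lambda>k l. (-1) * a k l" b] dCov2_const_left[OF assms, of 1 b]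
  by (simp only: dCov2_cmult_left) simp

text \<open>The sign changes from the two sides cancel. This turns the integrand
  \<open>1 - exp\<close> of the distance representation into the positive definite Gaussian
  kernel.\<close>

lemma dCov2_one_minus_both:
  assumes "n \<ge> 1"
  shows "dCov2 n (\<lambda>k l. 1 - a k l) (\<lambda>k l. 1 - b k l) = dCov2 n a b"
  by (simp add: dCov2_one_minus[OF assms] dCov2_commute[of n a "\<lambda>k l. 1 - b k l"])
     (simp add: dCov2_commute)

lemma dCov2_cong:
  assumes "\<And>k l. k \<in> {1..n} \<Longrightarrow> l \<in> {1..n} \<Longrightarrow> a k l = a' k l"
    and "\<And>k l. k \<in> {1..n} \<Longrightarrow> l \<in> {1..n} \<Longrightarrow> b k l = b' k l"
  shows "dCov2 n a b = dCov2 n a' b'"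
proof -
  have "(\<Sum>k=1..n. \<Sum>l=1..n. a k l) = (\<Sum>k=1..n. \<Sum>l=1..n. a' k l)"
    and "(\<Sum>k=1..n. \<Sum>l=1..n. b k l) = (\<Sum>k=1..n. \<Sum>l=1..n. b' k l)"
    and "(\<Sum>k=1..n. \<Sum>l=1..n. a k l * b k l) = (\<Sum>k=1..n. \<Sum>l=1..n. a' k l * b' k l)"
    and "(\<Sum>k=1..n. \<Sum>l=1..n. \<Sum>i=1..n. a k l * b k i) = (\<Sum>k=1..n. \<Sum>l=1..n. \<Sum>i=1..n. a' k l * b' k i)"
    by (intro sum.cong refl arg_cong2[of _ _ _ _ times] assms; assumption)+
  then show ?thesis unfolding dCov2_def by simp
qed

text \<open>For non-negative \<open>\<alpha>\<close> and \<open>\<beta>\<close> no term is negative,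
  so any single squared covariance bounds the distance covariance from below.\<close>

lemma dCov2_features:
  "dCov2 n (\<lambda>k l. \<Sum>s\<in>S. \<alpha> s * (f s k * f s l)) (\<lambda>k l. \<Sum>t\<in>T. \<beta> t * (g t k * g t l))
     = (\<Sum>s\<in>S. \<Sum>t\<in>T. \<alpha> s * \<beta> t * (cov n (f s) (g t))\<^sup>2)"
  by (simp add: dCov2_sum_left dCov2_sum_right dCov2_cmult_left dCov2_cmult_right dCov2_rank_one
      sum_distrib_left mult.assoc)

lemma dCov2_tendsto:
  assumes "\<And>k l. ((\<lambda>N. a N k l) \<longlongrightarrow> a' k l) F" and "\<And>k l. ((\<lambda>N. b N k l) \<longlongrightarrow> b' k l) F"
  shows "((\<lambda>N. dCov2 n (a N) (b N)) \<longlongrightarrow> dCov2 n a' b') F"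
  unfolding dCov2_def by (intro tendsto_intros assms)

text \<open>\<open>dCov2\<close> is a finite linear combination of the entries of its first kernel,
  hence commutes with the integral.\<close>

lemma dCov2_integral_left:
  assumes "\<And>k l. integrable M (\<lambda>t. a t k l)"
  shows "integrable M (\<lambda>t. dCov2 n (a t) b)"
    and "dCov2 n (\<lambda>k l. \<integral>t. a t k l \<partial>M) b = (\<integral>t. dCov2 n (a t) b \<partial>M)"
proof -
  show "integrable M (\<lambda>t. dCov2 n (a t) b)"
    unfolding dCov2_def using assms by auto
  show "dCov2 n (\<lambda>k l. \<integral>t. a t k l \<partial>M) b = (\<integral>t. dCov2 n (a t) b \<partial>M)"
    unfolding dCov2_def using assms by (simp add: Bochner_Integration.integral_sum)
qed

section \<open>Distance covariance as a mixture of Gaussian-kernel covariances\<close>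

definition gauss_const :: real where
  "gauss_const = (\<integral>t. 1 - exp (- ((1 / t)\<^sup>2)) \<partial>lborel)"

text \<open>The integrand is at most 1, which serves where t^2 is at most 1, and at most s^2/t^2
  elsewhere; one multiple of 1/(1 + t^2) dominates both. At \<open>t = 0\<close> division by zero
  makes the integrand 0.\<close>

lemma integrable_one_minus_gauss:
  "integrable lborel (\<lambda>t::real. 1 - exp (- ((s / t)\<^sup>2)))"
proof -
  have i: "integrable lborel (\<lambda>t::real. 2 * (1 + s\<^sup>2) * inverse (1 + t\<^sup>2))"
    using integrable_inverse_1_plus_square by (auto simp: set_integrable_def)
  show ?thesis
  proof (rule Bochner_Integration.integrable_bound[OF i])
    show "AE t in lborel. norm (1 - exp (- ((s / t)\<^sup>2))) \<le> norm (2 * (1 + s\<^sup>2) * inverse (1 + t\<^sup>2))"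
    proof (rule AE_I2)
      fix t :: real
      have pos: "1 + t\<^sup>2 > 0" by (simp add: add_pos_nonneg)
      have "1 - exp (- ((s / t)\<^sup>2)) \<le> 2 * (1 + s\<^sup>2) / (1 + t\<^sup>2)"
      proof (cases "t\<^sup>2 \<le> 1")
        case True
        have "1 + t\<^sup>2 \<le> 2 * (1 + s\<^sup>2)" by (rule order_trans[OF add_left_mono[OF True]]) simp
        then have "1 \<le> 2 * (1 + s\<^sup>2) / (1 + t\<^sup>2)" using pos by simp
        moreover have "1 - exp (- ((s / t)\<^sup>2)) \<le> 1" by simp
        ultimately show ?thesis by linarith
      next
        case False
        have "1 - exp (- ((s / t)\<^sup>2)) \<le> (s / t)\<^sup>2"
          using exp_ge_add_one_self[of "- ((s / t)\<^sup>2)"] by linarith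
        also have "\<dots> = s\<^sup>2 / t\<^sup>2" by (simp add: power_divide)
        also have "\<dots> \<le> (2 * (1 + s\<^sup>2)) / (1 + t\<^sup>2)"
        proof -
          have "s\<^sup>2 * (1 + t\<^sup>2) \<le> s\<^sup>2 * (2 * t\<^sup>2)" using False by (intro mult_left_mono) auto
          also have "\<dots> \<le> 2 * (1 + s\<^sup>2) * t\<^sup>2" by (simp add: algebra_simps)
          finally have *: "s\<^sup>2 * (1 + t\<^sup>2) \<le> 2 * (1 + s\<^sup>2) * t\<^sup>2" .
          have tp: "t\<^sup>2 > 0" using False by (intro zero_less_power2[THEN iffD2]) auto
          show ?thesis
            by (subst pos_divide_le_eq[OF tp], subst times_divide_eq_left, subst pos_le_divide_eq[OF pos]) (rule *)
        qed
        finally show ?thesis .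
      qed
      moreover have "0 \<le> 1 - exp (- ((s / t)\<^sup>2))" by simp
      moreover have "0 \<le> 2 * (1 + s\<^sup>2) / (1 + t\<^sup>2)" by simp
      ultimately show "norm (1 - exp (- ((s / t)\<^sup>2))) \<le> norm (2 * (1 + s\<^sup>2) * inverse (1 + t\<^sup>2))"
        by (simp add: divide_inverse)
    qed
  qed measurable
qed

text \<open>The substitution \<open>t = s t'\<close>; the value of the constant is irrelevant.\<close>

lemma integral_one_minus_gauss:
  assumes "0 \<le> s"
  shows "(\<integral>t. 1 - exp (- ((s / t)\<^sup>2)) \<partial>lborel) = gauss_const * s"
proof (cases "s = 0")
  case False
  then show ?thesis using assms
    lborel_integral_real_affine[of s "\<lambda>t. 1 - exp (- ((s / t)\<^sup>2))" 0]
    by (simp add: gauss_const_def)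
qed simp

text \<open>The interval has length one, so a constant lower bound on it passes to the integral
  without a factor.\<close>

lemma integral_ge_on_unit_interval:
  fixes f :: "real \<Rightarrow> real"
  assumes "integrable lborel f" and "\<And>t. 0 \<le> f t" and "\<And>t. t \<in> {T..T+1} \<Longrightarrow> c \<le> f t"
  shows "c \<le> (\<integral>t. f t \<partial>lborel)"
proof -
  have "c = (\<integral>t. c * indicator {T..T+1} t \<partial>lborel)" by simp
  also have "\<dots> \<le> (\<integral>t. f t \<partial>lborel)"
    using assms by (intro integral_mono) (auto split: split_indicator)
  finally show ?thesis .
qed

lemma gauss_const_pos: "0 < gauss_const"
proof -
  have "1 - exp (- 1/4) \<le> gauss_const"
    unfolding gauss_const_def
  proof (rule integral_ge_on_unit_interval[OF integrable_one_minus_gauss, of _ 1])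
    fix t :: real assume "t \<in> {1..1+1}"
    then have "t\<^sup>2 \<le> 2\<^sup>2" "t > 0" using power_mono[of t 2 2] by auto
    then have "1 / 4 \<le> (1 / t)\<^sup>2" by (simp add: field_simps power_divide)
    then show "1 - exp (- 1/4) \<le> 1 - exp (- ((1 / t)\<^sup>2))" by simp
  qed simp
  moreover have "exp (- 1/4 :: real) < 1" by simp
  ultimately show ?thesis by linarith
qed

text \<open>Features of the Gaussian kernel: in each coordinate exp(-(x-y)^2/t^2) is exp(-x^2/t^2)
  exp(-y^2/t^2) exp(2xy/t^2), and the last factor is expanded into its power series, whose
  coefficients form \<open>gauss_weight\<close>.\<close>

definition gauss_monomial :: "'i set \<Rightarrow> real \<Rightarrow> ('i \<Rightarrow> nat) \<Rightarrow> ('i \<Rightarrow> real) \<Rightarrow> real" where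
  "gauss_monomial I t w x = (\<Prod>c\<in>I. exp (- ((x c / t)\<^sup>2)) * x c ^ w c)"

definition gauss_weight :: "'i set \<Rightarrow> real \<Rightarrow> ('i \<Rightarrow> nat) \<Rightarrow> real" where
  "gauss_weight I t w = (\<Prod>c\<in>I. (2 / t\<^sup>2) ^ w c / fact (w c))"

text \<open>Truncation at \<open>N\<close> in each coordinate separately, rather than by total
  degree, keeps this a product of one-dimensional sums.\<close>

definition gauss_partial :: "'i set \<Rightarrow> real \<Rightarrow> nat \<Rightarrow> ('i \<Rightarrow> real) \<Rightarrow> ('i \<Rightarrow> real) \<Rightarrow> real" where
  "gauss_partial I t N x y =
     (\<Sum>w\<in>I \<rightarrow>\<^sub>E {..N}. gauss_weight I t w * (gauss_monomial I t w x * gauss_monomial I t w y))"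

lemma gauss_partial_tendsto:
  assumes "finite I"
  shows "(\<lambda>N. gauss_partial I t N x y) \<longlonglongrightarrow> exp (- ((L2_set (\<lambda>c. x c - y c) I / t)\<^sup>2))"
proof -
  let ?e = "\<lambda>c. exp (- ((x c / t)\<^sup>2)) * exp (- ((y c / t)\<^sup>2))"
  let ?z = "\<lambda>c. 2 / t\<^sup>2 * (x c * y c)"
  have "gauss_partial I t N x y = (\<Prod>c\<in>I. \<Sum>e\<le>N. ?e c * (?z c ^ e /\<^sub>R fact e))" for N
  proof -
    have "(\<Prod>c\<in>I. \<Sum>e\<le>N. ?e c * (?z c ^ e /\<^sub>R fact e))
      = (\<Sum>w\<in>I \<rightarrow>\<^sub>E {..N}. \<Prod>c\<in>I. ?e c * (?z c ^ w c /\<^sub>R fact (w c)))"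
      by (rule prod_sum_PiE) (use assms in auto)
    also have "\<dots> = gauss_partial I t N x y"
      unfolding gauss_partial_def gauss_weight_def gauss_monomial_def prod.distrib[symmetric]
      by (intro sum.cong prod.cong refl) (simp add: power_mult_distrib divide_inverse mult_ac)
    finally show ?thesis by simp
  qed
  moreover have "(\<lambda>N. \<Prod>c\<in>I. \<Sum>e\<le>N. ?e c * (?z c ^ e /\<^sub>R fact e)) \<longlonglongrightarrow> (\<Prod>c\<in>I. ?e c * exp (?z c))"
  proof (intro tendsto_prod)
    fix c
    have "(\<lambda>N. \<Sum>e\<le>N. ?z c ^ e /\<^sub>R fact e) \<longlonglongrightarrow> exp (?z c)"
      using exp_converges[of "?z c"] by (simp only: sums_def_le)
    then have "(\<lambda>N. ?e c * (\<Sum>e\<le>N. ?z c ^ e /\<^sub>R fact e)) \<longlonglongrightarrow> ?e c * exp (?z c)"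
      by (rule tendsto_mult_left)
    then show "(\<lambda>N. \<Sum>e\<le>N. ?e c * (?z c ^ e /\<^sub>R fact e)) \<longlonglongrightarrow> ?e c * exp (?z c)"
      by (simp only: sum_distrib_left)
  qed
  moreover have "(\<Prod>c\<in>I. ?e c * exp (?z c)) = exp (- ((L2_set (\<lambda>c. x c - y c) I / t)\<^sup>2))"
  proof -
    have "(\<Prod>c\<in>I. ?e c * exp (?z c)) = (\<Prod>c\<in>I. exp (- ((x c - y c)\<^sup>2 / t\<^sup>2)))"
      by (intro prod.cong refl)
         (simp add: exp_add[symmetric] power_divide diff_divide_distrib add_divide_distrib power2_diff)
    also have "\<dots> = exp (\<Sum>c\<in>I. - ((x c - y c)\<^sup>2 / t\<^sup>2))"
      by (rule exp_sum[symmetric, OF assms])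
    also have "(\<Sum>c\<in>I. - ((x c - y c)\<^sup>2 / t\<^sup>2)) = - ((L2_set (\<lambda>c. x c - y c) I / t)\<^sup>2)"
      by (simp add: power_divide L2_set_def real_sqrt_pow2 sum_nonneg sum_negf sum_divide_distrib)
    finally show ?thesis .
  qed
  ultimately show ?thesis by simp
qed

lemma gauss_weight_nonneg: "0 \<le> gauss_weight I t w"
  unfolding gauss_weight_def by (intro prod_nonneg) auto

abbreviation point_dist :: "'i set \<Rightarrow> (nat \<Rightarrow> 'i \<Rightarrow> real) \<Rightarrow> nat \<Rightarrow> nat \<Rightarrow> real" where
  "point_dist I u \<equiv> \<lambda>k l. L2_set (\<lambda>c. u k c - u l c) I"

abbreviation gauss_kernel :: "'i set \<Rightarrow> (nat \<Rightarrow> 'i \<Rightarrow> real) \<Rightarrow> real \<Rightarrow> nat \<Rightarrow> nat \<Rightarrow> real" where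
  "gauss_kernel I u t \<equiv> \<lambda>k l. exp (- ((L2_set (\<lambda>c. u k c - u l c) I / t)\<^sup>2))"

abbreviation in_unit_cube :: "nat \<Rightarrow> 'i set \<Rightarrow> (nat \<Rightarrow> 'i \<Rightarrow> real) \<Rightarrow> bool" where
  "in_unit_cube n I u \<equiv> \<forall>k\<in>{1..n}. \<forall>c\<in>I. u k c \<in> {0..1}"

text \<open>By \<open>dCov2_features\<close> the truncated kernels give a sum of squares with
  non-negative weights. One term is kept, and the bound survives the limit in the truncation
  degree.\<close>

lemma gauss_kernel_dCov2_ge:
  assumes I: "finite I" and J: "finite J" and w: "w \<in> I \<rightarrow>\<^sub>E UNIV" and w': "w' \<in> J \<rightarrow>\<^sub>E UNIV"
  shows "gauss_weight I t w * gauss_weight J t' w'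
      * (cov n (\<lambda>k. gauss_monomial I t w (u k)) (\<lambda>k. gauss_monomial J t' w' (v k)))\<^sup>2
    \<le> dCov2 n (gauss_kernel I u t)
              (gauss_kernel J v t')"
    (is "?L \<le> dCov2 n ?a ?b")
proof (rule tendsto_le[OF sequentially_bot])
  let ?D = "\<lambda>N. dCov2 n (\<lambda>k l. gauss_partial I t N (u k) (u l)) (\<lambda>k l. gauss_partial J t' N (v k) (v l))"
  show "?D \<longlonglongrightarrow> dCov2 n ?a ?b"
    by (intro dCov2_tendsto gauss_partial_tendsto I J)
  show "(\<lambda>N. ?L) \<longlonglongrightarrow> ?L" by simp
  \<comment> \<open>From this degree on both exponent functions occur in the truncated sums; the 0
    keeps the set non-empty when \<open>I\<close> and \<open>J\<close> are empty.\<close>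
  let ?N = "Max (w ` I \<union> w' ` J \<union> {0})"
  have "?L \<le> ?D N" if N: "N \<ge> ?N" for N
  proof -
    let ?F = "\<lambda>w w'. gauss_weight I t w * gauss_weight J t' w'
      * (cov n (\<lambda>k. gauss_monomial I t w (u k)) (\<lambda>k. gauss_monomial J t' w' (v k)))\<^sup>2"
    have nn: "0 \<le> ?F w w'" for w w' by (simp add: gauss_weight_nonneg)
    have D: "?D N = (\<Sum>w\<in>I \<rightarrow>\<^sub>E {..N}. \<Sum>w'\<in>J \<rightarrow>\<^sub>E {..N}. ?F w w')"
      unfolding gauss_partial_def by (rule dCov2_features)
    have le: "w c \<le> N" if "c \<in> I" for c
      using that I J N by (intro order_trans[OF Max_ge N]) auto
    have le': "w' c \<le> N" if "c \<in> J" for c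
      using that I J N by (intro order_trans[OF Max_ge N]) auto
    have m: "w \<in> I \<rightarrow>\<^sub>E {..N}" "w' \<in> J \<rightarrow>\<^sub>E {..N}"
      using w w' le le' by (auto simp: PiE_iff)
    have "?F w w' \<le> (\<Sum>w'\<in>J \<rightarrow>\<^sub>E {..N}. ?F w w')"
      using m J by (intro member_le_sum nn) (auto intro: finite_PiE)
    also have "\<dots> \<le> (\<Sum>w\<in>I \<rightarrow>\<^sub>E {..N}. \<Sum>w'\<in>J \<rightarrow>\<^sub>E {..N}. ?F w w')"
      using m I by (intro member_le_sum[where f="\<lambda>w. \<Sum>w'\<in>J \<rightarrow>\<^sub>E {..N}. ?F w w'"] sum_nonneg nn)
        (auto intro: finite_PiE)
    finally show ?thesis using D by simp
  qed
  then show "\<forall>\<^sub>F N in sequentially. ?L \<le> ?D N"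
    by (auto simp: eventually_sequentially)
qed

lemma gauss_kernel_dCov2_nonneg:
  assumes "finite I" "finite J"
  shows "0 \<le> dCov2 n (gauss_kernel I u t)
              (gauss_kernel J v t')"
  by (rule order_trans[OF _ gauss_kernel_dCov2_ge[OF assms, of "restrict (\<lambda>_. 0) I" "restrict (\<lambda>_. 0) J"]])
     (auto simp: gauss_weight_nonneg)

text \<open>Each distance in turn is replaced by the integral of \<open>1 - exp\<close> over a
  bandwidth, at the price of a factor \<open>gauss_const\<close>. The integrand is non-negative
  everywhere and at least \<kappa> on a square of area one.\<close>

lemma dCov2_dist_ge:
  fixes u :: "nat \<Rightarrow> 'i \<Rightarrow> real" and v :: "nat \<Rightarrow> 'k \<Rightarrow> real"
  assumes n: "n \<ge> 1" and fin: "finite I" "finite J"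
    and \<kappa>: "\<And>t t'. t \<in> {T..T+1} \<Longrightarrow> t' \<in> {T..T+1} \<Longrightarrow>
      \<kappa> \<le> dCov2 n (gauss_kernel I u t)
                (gauss_kernel J v t')"
  shows "\<kappa> / gauss_const\<^sup>2
    \<le> dCov2 n (point_dist I u) (point_dist J v)"
proof -
  let ?a = "\<lambda>k l. L2_set (\<lambda>c. u k c - u l c) I" and ?b = "\<lambda>k l. L2_set (\<lambda>c. v k c - v l c) J"
  let ?A = "\<lambda>t k l. 1 - exp (- ((?a k l / t)\<^sup>2))" and ?B = "\<lambda>t k l. 1 - exp (- ((?b k l / t)\<^sup>2))"
  have AB: "dCov2 n (?A t) (?B t') = dCov2 n (\<lambda>k l. exp (- ((?a k l / t)\<^sup>2))) (\<lambda>k l. exp (- ((?b k l / t')\<^sup>2)))"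
    for t t' by (rule dCov2_one_minus_both[OF n])
  have nn: "0 \<le> dCov2 n (?A t) (?B t')" for t t'
    unfolding AB by (rule gauss_kernel_dCov2_nonneg[OF fin])
  have ib: "integrable lborel (\<lambda>t'. dCov2 n (?A t) (?B t'))" for t
    using dCov2_integral_left(1)[of lborel ?B n "?A t"] integrable_one_minus_gauss
    by (simp add: dCov2_commute)
  have ia: "integrable lborel (\<lambda>t. dCov2 n (?A t) ?b)"
    using dCov2_integral_left(1)[of lborel ?A n ?b] integrable_one_minus_gauss by simp
  have eb: "gauss_const * dCov2 n (?A t) ?b = (\<integral>t'. dCov2 n (?A t) (?B t') \<partial>lborel)" for t
  proof -
    have "gauss_const * dCov2 n (?A t) ?b = dCov2 n (\<lambda>k l. \<integral>t'. ?B t' k l \<partial>lborel) (?A t)"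
      by (simp add: integral_one_minus_gauss L2_set_nonneg dCov2_cmult_left dCov2_commute[of n _ "?A t"])
    also have "\<dots> = (\<integral>t'. dCov2 n (?B t') (?A t) \<partial>lborel)"
      by (rule dCov2_integral_left(2)) (rule integrable_one_minus_gauss)
    finally show ?thesis by (simp add: dCov2_commute)
  qed
  have ea: "gauss_const * dCov2 n ?a ?b = (\<integral>t. dCov2 n (?A t) ?b \<partial>lborel)"
  proof -
    have "gauss_const * dCov2 n ?a ?b = dCov2 n (\<lambda>k l. \<integral>t. ?A t k l \<partial>lborel) ?b"
      by (simp add: integral_one_minus_gauss L2_set_nonneg dCov2_cmult_left)
    also have "\<dots> = (\<integral>t. dCov2 n (?A t) ?b \<partial>lborel)"
      by (rule dCov2_integral_left(2)) (rule integrable_one_minus_gauss)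
    finally show ?thesis .
  qed
  note C = gauss_const_pos
  have nb: "0 \<le> dCov2 n (?A t) ?b" for t
  proof -
    have "0 \<le> gauss_const * dCov2 n (?A t) ?b"
      unfolding eb by (intro Bochner_Integration.integral_nonneg nn)
    then show ?thesis using C by (simp add: zero_le_mult_iff)
  qed
  have "\<kappa> / gauss_const \<le> gauss_const * dCov2 n ?a ?b"
    unfolding ea
  proof (rule integral_ge_on_unit_interval[OF ia nb])
    fix t assume t: "t \<in> {T..T+1}"
    have "\<kappa> \<le> gauss_const * dCov2 n (?A t) ?b"
      unfolding eb by (rule integral_ge_on_unit_interval[OF ib nn]) (unfold AB, rule \<kappa>[OF t])
    then show "\<kappa> / gauss_const \<le> dCov2 n (?A t) ?b" using C by (simp add: field_simps)
  qed
  then show ?thesis using C by (simp add: field_simps power2_eq_square)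
qed

lemma dCov2_dist_nonneg:
  assumes "n \<ge> 1" "finite I" "finite J"
  shows "0 \<le> dCov2 n (point_dist I u) (point_dist J v)"
  using dCov2_dist_ge[OF assms, of 0 0 u v] gauss_kernel_dCov2_nonneg[OF assms(2,3)] by simp

section \<open>From Gaussian monomials to products of continuous functions\<close>

text \<open>A wide Gaussian is nearly constant on the unit cube: each factor differs from 1 by at
  most (x/t)^2, hence by at most 1/t.\<close>

lemma gauss_monomial_approx:
  assumes "finite I" and x: "\<And>c. c \<in> I \<Longrightarrow> x c \<in> {0..1}" and t: "t \<ge> 1"
  shows "\<bar>gauss_monomial I t w x - (\<Prod>c\<in>I. x c ^ w c)\<bar> \<le> real (card I) / t"
proof -
  have "\<bar>(\<Prod>c\<in>I. exp (- ((x c / t)\<^sup>2)) * x c ^ w c) - (\<Prod>c\<in>I. x c ^ w c)\<bar>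
     \<le> (\<Sum>c\<in>I. \<bar>exp (- ((x c / t)\<^sup>2)) * x c ^ w c - x c ^ w c\<bar>)"
    unfolding real_norm_def[symmetric]
    by (rule norm_prod_diff) (use x in \<open>auto simp: norm_mult norm_power intro!: power_le_one mult_le_one\<close>)
  also have "\<dots> \<le> (\<Sum>c\<in>I. 1 / t)"
  proof (rule sum_mono)
    fix c assume c: "c \<in> I"
    have "\<bar>exp (- ((x c / t)\<^sup>2)) * x c ^ w c - x c ^ w c\<bar> = (1 - exp (- ((x c / t)\<^sup>2))) * x c ^ w c"
      using x[OF c] by (subst abs_of_nonpos) (auto simp: algebra_simps mult_right_le_one_le)
    also have "\<dots> \<le> 1 - exp (- ((x c / t)\<^sup>2))"
      using x[OF c] by (intro mult_right_le_one_le) (auto intro: power_le_one)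
    also have "\<dots> \<le> (x c / t)\<^sup>2" using exp_ge_add_one_self[of "- ((x c / t)\<^sup>2)"] by linarith
    also have "\<dots> \<le> 1 / t"
    proof -
      have "(x c)\<^sup>2 \<le> 1" using x[OF c] by (intro power_le_one) auto
      then have "(x c / t)\<^sup>2 \<le> 1 / t\<^sup>2" by (simp add: power_divide divide_right_mono)
      also have "\<dots> \<le> 1 / t" using t by (simp add: field_simps power2_eq_square)
      finally show ?thesis .
    qed
    finally show "\<bar>exp (- ((x c / t)\<^sup>2)) * x c ^ w c - x c ^ w c\<bar> \<le> 1 / t" .
  qed
  finally show ?thesis by (simp add: gauss_monomial_def)
qed

lemma prod_unit_interval:
  fixes x :: "'i \<Rightarrow> real"
  assumes "\<And>c. c \<in> I \<Longrightarrow> \<bar>x c\<bar> \<le> 1"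
  shows "\<bar>\<Prod>c\<in>I. x c\<bar> \<le> 1"
  unfolding abs_prod using assms by (intro prod_le_1) auto

lemma gauss_monomial_le_one:
  assumes "\<And>c. c \<in> I \<Longrightarrow> x c \<in> {0..1}"
  shows "\<bar>gauss_monomial I t w x\<bar> \<le> 1"
  unfolding gauss_monomial_def
  by (rule prod_unit_interval) (use assms in \<open>auto simp: abs_mult intro!: mult_le_one power_le_one\<close>)

text \<open>For bandwidths in \<open>{T..T+1}\<close> with \<open>T\<close> large, the monomials are
  close to Gaussian monomials, and a large covariance of the latter forces the distance covariance
  up.\<close>

lemma cov_monomials_small:
  fixes I :: "'i set" and J :: "'k set"
  assumes fin: "finite I" "finite J" and \<kappa>: "\<kappa> > 0"
  shows "\<exists>\<epsilon>>0. \<forall>n\<ge>1. \<forall>u v.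
     in_unit_cube n I u \<and> in_unit_cube n J v \<and>
     dCov2 n (point_dist I u) (point_dist J v) < \<epsilon> \<longrightarrow>
     \<bar>cov n (\<lambda>k. \<Prod>c\<in>I. u k c ^ w c) (\<lambda>k. \<Prod>c\<in>J. v k c ^ w' c)\<bar> < \<kappa>"
proof -
  \<comment> \<open>Replacing both monomials changes the covariance by at most 2 (card I + card J) /
    T, which this choice keeps below \<kappa>/2.\<close>
  define T where "T = 1 + 4 * (real (card I) + real (card J)) / \<kappa>"
  have T: "T \<ge> 1" using \<kappa> by (simp add: T_def)
  \<comment> \<open>The weights decrease in the bandwidth, so their values at \<open>T + 1\<close>
    are lower bounds on the whole interval.\<close>
  define \<gamma> where "\<gamma> = gauss_weight I (T+1) w * gauss_weight J (T+1) w'"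
  have gpos: "0 < gauss_weight I' (T+1) w''" for I' and w'' :: "'b \<Rightarrow> nat"
    unfolding gauss_weight_def using T by (intro prod_pos) auto
  have \<gamma>: "\<gamma> > 0" unfolding \<gamma>_def by (intro mult_pos_pos gpos)
  have wmono: "gauss_weight I' (T+1) w'' \<le> gauss_weight I' t w''" if "t \<in> {T..T+1}" for I' t and w'' :: "'b \<Rightarrow> nat"
    unfolding gauss_weight_def using that T
    by (intro prod_mono) (auto intro!: divide_right_mono power_mono divide_left_mono mult_pos_pos)
  let ?\<epsilon> = "\<gamma> * (\<kappa> / 2)\<^sup>2 / gauss_const\<^sup>2"
  show ?thesis
  proof (intro exI[of _ ?\<epsilon>] conjI allI impI; (elim conjE)?)
    show "?\<epsilon> > 0" using \<gamma> \<kappa> gauss_const_pos by simp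
    fix n :: nat and u :: "nat \<Rightarrow> 'i \<Rightarrow> real" and v :: "nat \<Rightarrow> 'k \<Rightarrow> real"
    assume n: "n \<ge> 1" and u: "in_unit_cube n I u" and v: "in_unit_cube n J v"
      and D: "dCov2 n (point_dist I u) (point_dist J v) < ?\<epsilon>"
    show "\<bar>cov n (\<lambda>k. \<Prod>c\<in>I. u k c ^ w c) (\<lambda>k. \<Prod>c\<in>J. v k c ^ w' c)\<bar> < \<kappa>" (is "\<bar>cov n ?U ?V\<bar> < _")
    proof (rule ccontr)
      assume big: "\<not> \<bar>cov n ?U ?V\<bar> < \<kappa>"
      \<comment> \<open>\<open>gauss_kernel_dCov2_ge\<close> wants extensional exponent functions;
        the restriction changes neither the monomials nor the weights.\<close>
      let ?w = "restrict w I" and ?w' = "restrict w' J"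
      have "\<gamma> * (\<kappa> / 2)\<^sup>2 \<le> dCov2 n (gauss_kernel I u t)
                (gauss_kernel J v t')"
        if t: "t \<in> {T..T+1}" and t': "t' \<in> {T..T+1}" for t t'
      proof -
        let ?G = "\<lambda>k. gauss_monomial I t w (u k)" and ?H = "\<lambda>k. gauss_monomial J t' w' (v k)"
        have tp: "t \<ge> 1" "t' \<ge> 1" using t t' T by auto
        have U1: "\<bar>?U k\<bar> \<le> 1" if "k \<in> {1..n}" for k
          using u that by (intro prod_unit_interval) (auto intro!: power_le_one)
        have c1: "\<bar>cov n ?U ?V - cov n ?U ?H\<bar> \<le> 2 * (card J / t')"
          unfolding cov_commute[of n ?U]
        proof (rule cov_perturb_left)
          fix i assume i: "i \<in> {1..n}"
          show "\<bar>?V i - ?H i\<bar> \<le> card J / t'"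
            using v i tp by (subst abs_minus_commute, intro gauss_monomial_approx fin) auto
        qed (use tp U1 in auto)
        have c2: "\<bar>cov n ?U ?H - cov n ?G ?H\<bar> \<le> 2 * (card I / t)"
        proof (rule cov_perturb_left)
          fix i assume i: "i \<in> {1..n}"
          show "\<bar>?U i - ?G i\<bar> \<le> card I / t"
            using u i tp by (subst abs_minus_commute, intro gauss_monomial_approx fin) auto
          show "\<bar>?H i\<bar> \<le> 1" using v i by (intro gauss_monomial_le_one) auto
        qed (use tp in auto)
        have "2 * (card J / t') + 2 * (card I / t) \<le> 2 * (card J / T) + 2 * (card I / T)"
          using t t' T by (intro add_mono mult_left_mono divide_left_mono mult_pos_pos) auto
        also have "\<dots> \<le> \<kappa> / 2"
        proof -
          have "T * \<kappa> = \<kappa> + 4 * (real (card I) + real (card J))" using \<kappa> by (simp add: T_def field_simps)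
          then show ?thesis using T \<kappa> by (simp add: field_simps)
        qed
        finally have "\<kappa> / 2 \<le> \<bar>cov n ?G ?H\<bar>" using c1 c2 big by linarith
        then have sq: "(\<kappa> / 2)\<^sup>2 \<le> (cov n ?G ?H)\<^sup>2"
          using \<kappa> by (metis abs_of_nonneg abs_le_square_iff less_imp_le half_gt_zero)
        have rw: "gauss_weight I t ?w = gauss_weight I t w" "gauss_weight J t' ?w' = gauss_weight J t' w'"
           "gauss_monomial I t ?w x = gauss_monomial I t w x" "gauss_monomial J t' ?w' y = gauss_monomial J t' w' y" for x y
          by (simp_all add: gauss_weight_def gauss_monomial_def)
        have "\<gamma> * (\<kappa> / 2)\<^sup>2 \<le> gauss_weight I t w * gauss_weight J t' w' * (cov n ?G ?H)\<^sup>2"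
          unfolding \<gamma>_def using sq
          by (intro mult_mono wmono t t' mult_nonneg_nonneg gauss_weight_nonneg) auto
        also have "\<dots> \<le> dCov2 n (gauss_kernel I u t)
                (gauss_kernel J v t')"
          using gauss_kernel_dCov2_ge[OF fin, of ?w ?w' t t' n u v] by (simp add: rw)
        finally show ?thesis .
      qed
      from dCov2_dist_ge[OF n fin this] D show False by simp
    qed
  qed
qed

lemma weierstrass_unit_interval:
  fixes f :: "real \<Rightarrow> real"
  assumes "continuous_on {0..1} f" and "e > 0"
  obtains a :: "nat \<Rightarrow> real" and N :: nat where "\<And>x. x \<in> {0..1} \<Longrightarrow> \<bar>f x - (\<Sum>i\<le>N. a i * x ^ i)\<bar> < e"
proof -
  obtain g where g: "real_polynomial_function g" "\<And>x. x \<in> {0..1} \<Longrightarrow> \<bar>f x - g x\<bar> < e"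
    using Stone_Weierstrass_real_polynomial_function[OF _ assms] compact_Icc by blast
  then obtain a N where "g = (\<lambda>x. \<Sum>i\<le>N. a i * x ^ i)"
    using real_polynomial_function_iff_sum by blast
  with g that show ?thesis by blast
qed

text \<open>The order of quantifiers matters: one \<epsilon> serves all sample sizes and all
  configurations in the cube, so it can be applied to ranks, which depend on the data. Products of
  one-dimensional functions are the form that the bumps of the grid take later.\<close>

definition cov_controlled :: "'i set \<Rightarrow> 'k set \<Rightarrow> ('i \<Rightarrow> real \<Rightarrow> real) \<Rightarrow> ('k \<Rightarrow> real \<Rightarrow> real) \<Rightarrow> bool" where
  "cov_controlled I J f g \<longleftrightarrow> (\<forall>\<kappa>>0. \<exists>\<epsilon>>0. \<forall>n\<ge>1. \<forall>u v.
     in_unit_cube n I u \<and> in_unit_cube n J v \<and>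
     dCov2 n (point_dist I u) (point_dist J v) < \<epsilon> \<longrightarrow>
     \<bar>cov n (\<lambda>k. \<Prod>c\<in>I. f c (u k c)) (\<lambda>k. \<Prod>c\<in>J. g c (v k c))\<bar> < \<kappa>)"

lemma cov_controlled_swap:
  assumes "cov_controlled I J f g"
  shows "cov_controlled J I g f"
  unfolding cov_controlled_def
proof (intro allI impI)
  fix \<kappa> :: real assume "\<kappa> > 0"
  with assms obtain \<epsilon> where \<epsilon>: "\<epsilon> > 0" "\<forall>n\<ge>1. \<forall>u v.
     in_unit_cube n I u \<and> in_unit_cube n J v \<and>
     dCov2 n (point_dist I u) (point_dist J v) < \<epsilon> \<longrightarrow>
     \<bar>cov n (\<lambda>k. \<Prod>c\<in>I. f c (u k c)) (\<lambda>k. \<Prod>c\<in>J. g c (v k c))\<bar> < \<kappa>"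
    unfolding cov_controlled_def by auto
  show "\<exists>\<epsilon>>0. \<forall>n\<ge>1. \<forall>v u.
     (in_unit_cube n J v) \<and> (in_unit_cube n I u) \<and>
     dCov2 n (point_dist J v) (point_dist I u) < \<epsilon> \<longrightarrow>
     \<bar>cov n (\<lambda>k. \<Prod>c\<in>J. g c (v k c)) (\<lambda>k. \<Prod>c\<in>I. f c (u k c))\<bar> < \<kappa>"
  proof (intro exI[of _ \<epsilon>] conjI allI impI; (elim conjE)?)
    fix n :: nat and v u
    assume "n \<ge> 1" and u: "in_unit_cube n I u" and v: "in_unit_cube n J v"
      and "dCov2 n (point_dist J v) (point_dist I u) < \<epsilon>"
    then show "\<bar>cov n (\<lambda>k. \<Prod>c\<in>J. g c (v k c)) (\<lambda>k. \<Prod>c\<in>I. f c (u k c))\<bar> < \<kappa>"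
      using \<epsilon>(2) by (simp add: cov_commute[of n "\<lambda>k. \<Prod>c\<in>J. g c (v k c)"]
          dCov2_commute[of n "\<lambda>k l. L2_set (\<lambda>c. v k c - v l c) J"])
  qed (rule \<epsilon>(1))
qed

text \<open>Replacing a power by a continuous function in one coordinate at a time keeps Weierstrass
  approximation one-dimensional.\<close>

lemma cov_controlled_one_coordinate:
  fixes I :: "'i set" and J :: "'k set"
  assumes fin: "finite I" "finite J" and c0: "c0 \<in> I"
    and pow: "\<And>p. cov_controlled I J (f(c0 := \<lambda>x. x ^ p)) g"
    and cont: "continuous_on {0..1} (f c0)"
    and bf: "\<And>c x. c \<in> I \<Longrightarrow> x \<in> {0..1} \<Longrightarrow> \<bar>f c x\<bar> \<le> 1"
    and bg: "\<And>c x. c \<in> J \<Longrightarrow> x \<in> {0..1} \<Longrightarrow> \<bar>g c x\<bar> \<le> 1"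
  shows "cov_controlled I J f g"
  unfolding cov_controlled_def
proof (intro allI impI)
  fix \<kappa> :: real assume \<kappa>: "\<kappa> > 0"
  obtain a N where aN: "\<And>x. x \<in> {0..1} \<Longrightarrow> \<bar>f c0 x - (\<Sum>i\<le>N. a i * x ^ i)\<bar> < \<kappa> / 4"
    using weierstrass_unit_interval[OF cont, of "\<kappa> / 4"] \<kappa> by auto
  \<comment> \<open>The polynomial coefficients multiply the bound \<kappa>/(2s) by a total of
    \<open>s - 1\<close>, so the sum stays strictly below \<kappa>/2; the added 1 also keeps
    \<open>s\<close> positive.\<close>
  define s where "s = 1 + (\<Sum>i\<le>N. \<bar>a i\<bar>)"
  have s: "s \<ge> 1" by (simp add: s_def sum_nonneg)
  have "\<kappa> / (2 * s) > 0" using \<kappa> s by simp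
  then have "\<forall>p. \<exists>\<epsilon>>0. \<forall>n\<ge>1. \<forall>u v.
     in_unit_cube n I u \<and> in_unit_cube n J v \<and>
     dCov2 n (point_dist I u) (point_dist J v) < \<epsilon> \<longrightarrow>
     \<bar>cov n (\<lambda>k. \<Prod>c\<in>I. (f(c0 := \<lambda>x. x ^ p)) c (u k c)) (\<lambda>k. \<Prod>c\<in>J. g c (v k c))\<bar> < \<kappa> / (2 * s)"
    using pow unfolding cov_controlled_def by blast
  from choice[OF this] obtain E where E0: "\<forall>p. E p > 0 \<and> (\<forall>n\<ge>1. \<forall>u v.
     in_unit_cube n I u \<and> in_unit_cube n J v \<and>
     dCov2 n (point_dist I u) (point_dist J v) < E p \<longrightarrow>
     \<bar>cov n (\<lambda>k. \<Prod>c\<in>I. (f(c0 := \<lambda>x. x ^ p)) c (u k c)) (\<lambda>k. \<Prod>c\<in>J. g c (v k c))\<bar> < \<kappa> / (2 * s))" ..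
  then have E: "\<And>p. E p > 0" and E': "\<And>p n u v. n \<ge> 1 \<Longrightarrow>
     in_unit_cube n I u \<and> in_unit_cube n J v \<and>
     dCov2 n (point_dist I u) (point_dist J v) < E p \<Longrightarrow>
     \<bar>cov n (\<lambda>k. \<Prod>c\<in>I. (f(c0 := \<lambda>x. x ^ p)) c (u k c)) (\<lambda>k. \<Prod>c\<in>J. g c (v k c))\<bar> < \<kappa> / (2 * s)"
    by simp_all
  let ?\<epsilon> = "Min (E ` {..N})"
  show "\<exists>\<epsilon>>0. \<forall>n\<ge>1. \<forall>u v.
     in_unit_cube n I u \<and> in_unit_cube n J v \<and>
     dCov2 n (point_dist I u) (point_dist J v) < \<epsilon> \<longrightarrow>
     \<bar>cov n (\<lambda>k. \<Prod>c\<in>I. f c (u k c)) (\<lambda>k. \<Prod>c\<in>J. g c (v k c))\<bar> < \<kappa>"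
  proof (intro exI[of _ ?\<epsilon>] conjI allI impI; (elim conjE)?)
    show "?\<epsilon> > 0" using E by (subst Min_gr_iff) auto
    fix n :: nat and u :: "nat \<Rightarrow> 'i \<Rightarrow> real" and v :: "nat \<Rightarrow> 'k \<Rightarrow> real"
    assume n: "n \<ge> 1" and u: "in_unit_cube n I u" and v: "in_unit_cube n J v"
      and D: "dCov2 n (point_dist I u) (point_dist J v) < ?\<epsilon>"
    let ?V = "\<lambda>k. \<Prod>c\<in>J. g c (v k c)" and ?R = "\<lambda>k. \<Prod>c\<in>I - {c0}. f c (u k c)"
    let ?P = "\<lambda>p k. \<Prod>c\<in>I. (f(c0 := \<lambda>x. x ^ p)) c (u k c)"
    have P: "?P p k = u k c0 ^ p * ?R k" for p k
      using c0 fin by (subst prod.remove[OF fin(1) c0]) (auto intro!: prod.cong)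
    have F: "(\<Prod>c\<in>I. f c (u k c)) = f c0 (u k c0) * ?R k" for k
      by (rule prod.remove[OF fin(1) c0])
    have small: "\<bar>cov n (?P p) ?V\<bar> < \<kappa> / (2 * s)" if "p \<le> N" for p
    proof (rule E'[OF n], intro conjI u v)
      have "?\<epsilon> \<le> E p" using that by (intro Min_le) auto
      with D show "dCov2 n (point_dist I u) (point_dist J v) < E p"
        by linarith
    qed
    have "\<bar>cov n (\<lambda>k. \<Prod>c\<in>I. f c (u k c)) ?V - cov n (\<lambda>k. \<Sum>p\<le>N. a p * ?P p k) ?V\<bar> \<le> 2 * (\<kappa> / 4)"
    proof (rule cov_perturb_left)
      fix i assume i: "i \<in> {1..n}"
      have "(\<Prod>c\<in>I. f c (u i c)) - (\<Sum>p\<le>N. a p * ?P p i) = (f c0 (u i c0) - (\<Sum>p\<le>N. a p * u i c0 ^ p)) * ?R i"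
        unfolding F P by (simp add: left_diff_distrib sum_distrib_right mult.assoc)
      moreover have "\<bar>f c0 (u i c0) - (\<Sum>p\<le>N. a p * u i c0 ^ p)\<bar> * \<bar>?R i\<bar> \<le> \<kappa> / 4 * 1"
        using aN[of "u i c0"] u i c0 \<kappa> bf by (intro mult_mono prod_unit_interval) auto
      ultimately show "\<bar>(\<Prod>c\<in>I. f c (u i c)) - (\<Sum>p\<le>N. a p * ?P p i)\<bar> \<le> \<kappa> / 4"
        by (simp add: abs_mult)
      show "\<bar>?V i\<bar> \<le> 1" using v i bg by (intro prod_unit_interval) auto
    qed (use \<kappa> in simp)
    moreover have "\<bar>cov n (\<lambda>k. \<Sum>p\<le>N. a p * ?P p k) ?V\<bar> < \<kappa> / 2"
    proof -
      have "\<bar>cov n (\<lambda>k. \<Sum>p\<le>N. a p * ?P p k) ?V\<bar> = \<bar>\<Sum>p\<le>N. a p * cov n (?P p) ?V\<bar>"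
        by (simp only: cov_sum_left cov_cmult_left)
      also have "\<dots> \<le> (\<Sum>p\<le>N. \<bar>a p\<bar> * (\<kappa> / (2 * s)))"
        by (intro order_trans[OF sum_abs] sum_mono, unfold abs_mult, intro mult_left_mono less_imp_le[OF small]) auto
      also have "\<dots> = (\<Sum>p\<le>N. \<bar>a p\<bar>) * (\<kappa> / (2 * s))" by (rule sum_distrib_right[symmetric])
      also have "\<dots> = (s - 1) * (\<kappa> / (2 * s))" by (simp add: s_def)
      also have "\<dots> < s * (\<kappa> / (2 * s))" using s \<kappa> by (intro mult_strict_right_mono) auto
      also have "\<dots> = \<kappa> / 2" using s by simp
      finally show ?thesis .
    qed
    ultimately show "\<bar>cov n (\<lambda>k. \<Prod>c\<in>I. f c (u k c)) ?V\<bar> < \<kappa>" by linarith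
  qed
qed

text \<open>Induction over the set \<open>S\<close> of coordinates that already carry
  \<open>f\<close>. The exponents stay arbitrary in the induction hypothesis, because the step at
  \<open>c0\<close> calls it with every power in place of \<open>f c0\<close>.\<close>

lemma cov_controlled_left:
  fixes I :: "'i set" and J :: "'k set"
  assumes fin: "finite I" "finite J"
    and pow: "\<And>w. cov_controlled I J (\<lambda>c x. x ^ w c) g"
    and cont: "\<And>c. c \<in> I \<Longrightarrow> continuous_on {0..1} (f c)"
    and bf: "\<And>c x. c \<in> I \<Longrightarrow> x \<in> {0..1} \<Longrightarrow> \<bar>f c x\<bar> \<le> 1"
    and bg: "\<And>c x. c \<in> J \<Longrightarrow> x \<in> {0..1} \<Longrightarrow> \<bar>g c x\<bar> \<le> 1"
  shows "cov_controlled I J f g"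
proof -
  have "cov_controlled I J (\<lambda>c. if c \<in> S then f c else (\<lambda>x. x ^ w c)) g" if "finite S" "S \<subseteq> I" for S w
    using that
  proof (induction S arbitrary: w rule: finite_induct)
    case empty
    then show ?case using pow by simp
  next
    case (insert c0 S)
    show ?case
    proof (rule cov_controlled_one_coordinate[OF fin, of c0])
      fix p
      have "(\<lambda>c. if c \<in> insert c0 S then f c else (\<lambda>x. x ^ w c))(c0 := \<lambda>x. x ^ p)
          = (\<lambda>c. if c \<in> S then f c else (\<lambda>x. x ^ (w(c0 := p)) c))"
        using insert.hyps by (auto simp: fun_eq_iff)
      then show "cov_controlled I J ((\<lambda>c. if c \<in> insert c0 S then f c else (\<lambda>x. x ^ w c))(c0 := \<lambda>x. x ^ p)) g"
        using insert by simp
    next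
      fix c x assume "c \<in> I" "x \<in> {0..1::real}"
      then show "\<bar>(if c \<in> insert c0 S then f c else (\<lambda>x. x ^ w c)) x\<bar> \<le> 1"
        using bf by (auto intro!: power_le_one)
    qed (use insert.prems cont bg in auto)
  qed
  from this[of I "\<lambda>_. 0"] fin have "cov_controlled I J (\<lambda>c. if c \<in> I then f c else (\<lambda>x. x ^ 0)) g" by simp
  then show ?thesis unfolding cov_controlled_def by (simp cong: prod.cong)
qed

text \<open>Both covariances are symmetric, so after a swap the one-sided replacement of powers also
  treats the second family.\<close>

lemma cov_controlled_continuous:
  fixes I :: "'i set" and J :: "'k set"
  assumes fin: "finite I" "finite J"
    and cf: "\<And>c. c \<in> I \<Longrightarrow> continuous_on {0..1} (f c)" and cg: "\<And>c. c \<in> J \<Longrightarrow> continuous_on {0..1} (g c)"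
    and bf: "\<And>c x. c \<in> I \<Longrightarrow> x \<in> {0..1} \<Longrightarrow> \<bar>f c x\<bar> \<le> 1"
    and bg: "\<And>c x. c \<in> J \<Longrightarrow> x \<in> {0..1} \<Longrightarrow> \<bar>g c x\<bar> \<le> 1"
  shows "cov_controlled I J f g"
proof -
  have "cov_controlled I J (\<lambda>c x. x ^ w c) (\<lambda>c x. x ^ w' c)" for w w'
    unfolding cov_controlled_def using cov_monomials_small[OF fin] by blast
  then have "cov_controlled I J f (\<lambda>c x. x ^ w' c)" for w'
    by (rule cov_controlled_left[OF fin]) (use cf bf in \<open>auto intro!: power_le_one\<close>)
  then have "cov_controlled J I (\<lambda>c x. x ^ w' c) f" for w'
    by (rule cov_controlled_swap)
  then have "cov_controlled J I g f"
    by (rule cov_controlled_left[OF fin(2,1)]) (use cg bg bf in auto)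
  then show ?thesis by (rule cov_controlled_swap)
qed

section \<open>Asymptotic independence of the ranks\<close>

text \<open>The product of the last \<open>s\<close> factors grows by one factor in front at a time.
  Each new factor costs a covariance of at most \<kappa>, and the old error is multiplied by an
  average of modulus at most 1.\<close>

lemma avg_prod_telescope:
  fixes F :: "nat \<Rightarrow> nat \<Rightarrow> real"
  assumes n: "n \<ge> 1" and F: "\<And>j i. j \<in> {1..K} \<Longrightarrow> i \<in> {1..n} \<Longrightarrow> \<bar>F j i\<bar> \<le> 1"
    and cov: "\<And>j. j \<in> {1..K-1} \<Longrightarrow> \<bar>cov n (F j) (\<lambda>i. \<Prod>m\<in>{j+1..K}. F m i)\<bar> \<le> \<kappa>" and \<kappa>: "0 \<le> \<kappa>"
  shows "\<bar>avg n (\<lambda>i. \<Prod>j\<in>{1..K}. F j i) - (\<Prod>j\<in>{1..K}. avg n (F j))\<bar> \<le> real K * \<kappa>"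
proof -
  have "\<bar>avg n (\<lambda>i. \<Prod>j\<in>{K+1-s..K}. F j i) - (\<Prod>j\<in>{K+1-s..K}. avg n (F j))\<bar> \<le> real s * \<kappa>"
    if "s \<le> K" for s
    using that
  proof (induction s)
    case 0
    then show ?case using avg_const[OF n, of 1] by simp
  next
    case (Suc s)
    define j where "j = K - s"
    have j: "j \<in> {1..K}" and e: "{K+1-Suc s..K} = insert j {j+1..K}" "K + 1 - s = j + 1"
      using Suc.prems by (auto simp: j_def)
    let ?R = "\<lambda>i. \<Prod>m\<in>{j+1..K}. F m i" and ?p = "\<Prod>m\<in>{j+1..K}. avg n (F m)"
    have c: "\<bar>cov n (F j) ?R\<bar> \<le> \<kappa>"
    \<comment> \<open>The last factor is followed by an empty product, the constant 1, with
      covariance 0; the hypothesis speaks only of \<open>j\<close> up to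
      \<open>K - 1\<close>.\<close>
    proof (cases "j = K")
      case True
      then show ?thesis using \<kappa> avg_const[OF n, of 1] by (simp add: cov_def)
    next
      case False
      then show ?thesis using j by (intro cov) auto
    qed
    have IH: "\<bar>avg n ?R - ?p\<bar> \<le> real s * \<kappa>" using Suc.IH[unfolded e(2)] Suc.prems by simp
    have "avg n (\<lambda>i. \<Prod>j\<in>{K+1-Suc s..K}. F j i) - (\<Prod>j\<in>{K+1-Suc s..K}. avg n (F j))
        = avg n (\<lambda>i. F j i * ?R i) - avg n (F j) * ?p"
      unfolding e by (subst (1 2) prod.insert) auto
    also have "\<dots> = cov n (F j) ?R + avg n (F j) * (avg n ?R - ?p)"
      by (simp add: cov_def algebra_simps)
    also have "\<bar>\<dots>\<bar> \<le> \<kappa> + 1 * (real s * \<kappa>)"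
    proof -
      have "\<bar>avg n (F j)\<bar> * \<bar>avg n ?R - ?p\<bar> \<le> 1 * (real s * \<kappa>)"
        using IH F j by (intro mult_mono abs_avg_bound) auto
      then show ?thesis using c by (simp add: abs_mult[symmetric])
    qed
    finally show ?case by (simp add: algebra_simps)
  qed
  from this[of K] show ?thesis by simp
qed

abbreviation blocks_in_cube :: "nat \<Rightarrow> (nat \<Rightarrow> nat) \<Rightarrow> nat \<Rightarrow> (nat \<Rightarrow> blocks) \<Rightarrow> bool" where
  "blocks_in_cube K d n r \<equiv> \<forall>i\<in>{1..n}. \<forall>j\<in>{1..K}. \<forall>c<d j. r i j c \<in> {0..1}"

abbreviation block_dCov2 :: "nat \<Rightarrow> (nat \<Rightarrow> nat) \<Rightarrow> nat \<Rightarrow> (nat \<Rightarrow> blocks) \<Rightarrow> nat \<Rightarrow> real" where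
  "block_dCov2 K d n r j \<equiv> dCov2 n (\<lambda>k l. dist_Rn (d j) (r k j) (r l j))
     (\<lambda>k l. L2_set (\<lambda>(m, c). r k m c - r l m c) (SIGMA m:{j+1..K}. {..<d m}))"

text \<open>All blocks after \<open>j\<close> are read as one block indexed by pairs, for which
  \<open>L2_set\<close> is the distance of concatenated vectors. So
  \<open>cov_controlled_continuous\<close> handles block \<open>j\<close> against all later ones,
  and \<open>avg_prod_telescope\<close> combines the resulting bounds.\<close>

lemma ranks_asymptotically_independent:
  fixes d :: "nat \<Rightarrow> nat" and f :: "nat \<Rightarrow> nat \<Rightarrow> real \<Rightarrow> real"
  assumes cf: "\<And>j c. j \<in> {1..K} \<Longrightarrow> c < d j \<Longrightarrow> continuous_on {0..1} (f j c)"
    and bf: "\<And>j c x. j \<in> {1..K} \<Longrightarrow> c < d j \<Longrightarrow> x \<in> {0..1} \<Longrightarrow> \<bar>f j c x\<bar> \<le> 1"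
    and \<kappa>: "\<kappa> > 0"
  shows "\<exists>\<epsilon>>0. \<forall>n\<ge>1. \<forall>r.
     (blocks_in_cube K d n r) \<and>
     (\<forall>j\<in>{1..K-1}. block_dCov2 K d n r j < \<epsilon>) \<longrightarrow>
     \<bar>avg n (\<lambda>i. \<Prod>j\<in>{1..K}. \<Prod>c<d j. f j c (r i j c))
        - (\<Prod>j\<in>{1..K}. avg n (\<lambda>i. \<Prod>c<d j. f j c (r i j c)))\<bar> < \<kappa>"
proof -
  define \<eta> where "\<eta> = \<kappa> / (real K + 1)"
  have \<eta>: "\<eta> > 0" using \<kappa> by (simp add: \<eta>_def)
  let ?Bound = "\<lambda>j \<epsilon>. \<forall>n\<ge>1. \<forall>r. blocks_in_cube K d n r \<and> block_dCov2 K d n r j < \<epsilon> \<longrightarrow>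
     \<bar>cov n (\<lambda>i. \<Prod>c<d j. f j c (r i j c)) (\<lambda>i. \<Prod>m\<in>{j+1..K}. \<Prod>c<d m. f m c (r i m c))\<bar> < \<eta>"
  have "\<exists>\<epsilon>>0. ?Bound j \<epsilon>"
    if j: "j \<in> {1..K-1}" for j
  proof -
    let ?J = "SIGMA m:{j+1..K}. {..<d m}"
    have "cov_controlled {..<d j} ?J (f j) (\<lambda>(m, c). f m c)"
      by (rule cov_controlled_continuous) (use j cf bf in \<open>auto simp: Ball_def\<close>)
    then obtain \<epsilon> where "\<epsilon> > 0" and \<epsilon>: "\<forall>n\<ge>1. \<forall>u v.
     (\<forall>k\<in>{1..n}. \<forall>c\<in>{..<d j}. u k c \<in> {0..1}) \<and> (\<forall>k\<in>{1..n}. \<forall>c\<in>?J. v k c \<in> {0..1}) \<and>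
     dCov2 n (\<lambda>k l. L2_set (\<lambda>c. u k c - u l c) {..<d j}) (\<lambda>k l. L2_set (\<lambda>c. v k c - v l c) ?J) < \<epsilon> \<longrightarrow>
     \<bar>cov n (\<lambda>k. \<Prod>c\<in>{..<d j}. f j c (u k c)) (\<lambda>k. \<Prod>c\<in>?J. (\<lambda>(m, c). f m c) c (v k c))\<bar> < \<eta>"
      unfolding cov_controlled_def using \<eta> by blast
    show ?thesis
    proof (intro exI[of _ \<epsilon>] conjI allI impI; (elim conjE)?)
      fix n :: nat and r :: "nat \<Rightarrow> nat \<Rightarrow> nat \<Rightarrow> real"
      assume n: "n \<ge> 1" and r: "blocks_in_cube K d n r"
        and D: "dCov2 n (\<lambda>k l. dist_Rn (d j) (r k j) (r l j))
          (\<lambda>k l. L2_set (\<lambda>(m, c). r k m c - r l m c) ?J) < \<epsilon>"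
      let ?v = "\<lambda>k. \<lambda>(m, c). r k m c"
      have "(\<lambda>c. ?v k c - ?v l c) = (\<lambda>(m, c). r k m c - r l m c)" for k l by auto
      then have "dCov2 n (\<lambda>k l. L2_set (\<lambda>c. r k j c - r l j c) {..<d j}) (\<lambda>k l. L2_set (\<lambda>c. ?v k c - ?v l c) ?J) < \<epsilon>"
        using D by (simp add: dist_Rn_def)
      moreover have "(\<forall>k\<in>{1..n}. \<forall>c\<in>{..<d j}. r k j c \<in> {0..1})" "\<forall>k\<in>{1..n}. \<forall>c\<in>?J. ?v k c \<in> {0..1}"
        using r j by auto
      ultimately have "\<bar>cov n (\<lambda>k. \<Prod>c\<in>{..<d j}. f j c (r k j c)) (\<lambda>k. \<Prod>c\<in>?J. (\<lambda>(m, c). f m c) c (?v k c))\<bar> < \<eta>"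
        using \<epsilon>[THEN spec, THEN mp, OF n, THEN spec[of _ "\<lambda>k. r k j"], THEN spec[of _ ?v]] by simp
      moreover have "(\<Prod>c\<in>?J. (\<lambda>(m, c). f m c) c (?v k c)) = (\<Prod>m\<in>{j+1..K}. \<Prod>c<d m. f m c (r k m c))" for k
        by (subst prod.Sigma) (auto intro!: prod.cong)
      ultimately show "\<bar>cov n (\<lambda>i. \<Prod>c<d j. f j c (r i j c)) (\<lambda>i. \<Prod>m\<in>{j+1..K}. \<Prod>c<d m. f m c (r i m c))\<bar> < \<eta>"
        by simp
    qed (rule \<open>\<epsilon> > 0\<close>)
  qed
  then have "\<forall>j\<in>{1..K-1}. \<exists>\<epsilon>>0. ?Bound j \<epsilon>"
    by blast
  from bchoice[OF this] obtain E where E: "\<forall>j\<in>{1..K-1}. E j > 0 \<and> (?Bound j (E j))" ..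
  \<comment> \<open>The inserted 1 keeps the minimum defined when \<open>K - 1\<close> is 0.\<close>
  let ?\<epsilon> = "Min (insert 1 (E ` {1..K-1}))"
  show ?thesis
  proof (intro exI[of _ ?\<epsilon>] conjI allI impI; (elim conjE)?)
    show "?\<epsilon> > 0" using E by (subst Min_gr_iff) auto
    fix n :: nat and r :: "nat \<Rightarrow> nat \<Rightarrow> nat \<Rightarrow> real"
    assume n: "n \<ge> 1" and r: "blocks_in_cube K d n r"
      and D: "\<forall>j\<in>{1..K-1}. block_dCov2 K d n r j < ?\<epsilon>"
    have "\<bar>avg n (\<lambda>i. \<Prod>j\<in>{1..K}. \<Prod>c<d j. f j c (r i j c))
        - (\<Prod>j\<in>{1..K}. avg n (\<lambda>i. \<Prod>c<d j. f j c (r i j c)))\<bar> \<le> real K * \<eta>"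
    proof (rule avg_prod_telescope[OF n])
      fix j i assume "j \<in> {1..K}" "i \<in> {1..n}"
      then show "\<bar>\<Prod>c<d j. f j c (r i j c)\<bar> \<le> 1" using r bf by (intro prod_unit_interval) auto
    next
      fix j assume j: "j \<in> {1..K-1}"
      have "?\<epsilon> \<le> E j" using j by (intro Min_le) auto
      then have "block_dCov2 K d n r j < E j"
        using bspec[OF D j] by linarith
      then show "\<bar>cov n (\<lambda>i. \<Prod>c<d j. f j c (r i j c)) (\<lambda>i. \<Prod>m\<in>{j+1..K}. \<Prod>c<d m. f m c (r i m c))\<bar> \<le> \<eta>"
        using bspec[OF E j] n r by (intro less_imp_le) blast
    qed (use \<eta> in simp)
    also have "real K * \<eta> < \<kappa>" using \<kappa> by (simp add: \<eta>_def field_simps)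
    finally show "\<bar>avg n (\<lambda>i. \<Prod>j\<in>{1..K}. \<Prod>c<d j. f j c (r i j c))
        - (\<Prod>j\<in>{1..K}. avg n (\<lambda>i. \<Prod>c<d j. f j c (r i j c)))\<bar> < \<kappa>" .
  qed
qed

section \<open>A partition of unity on the unit cube\<close>

definition tent :: "real \<Rightarrow> real" where "tent x = max 0 (1 - \<bar>x\<bar>)"

lemma tent_range: "tent x \<in> {0..1}"
  by (auto simp: tent_def)

lemma tent_pos_iff: "0 < tent x \<longleftrightarrow> \<bar>x\<bar> < 1"
  by (auto simp: tent_def)

lemma continuous_tent [continuous_intros]:
  "continuous_on S f \<Longrightarrow> continuous_on S (\<lambda>x. tent (f x))"
  unfolding tent_def by (intro continuous_intros)

text \<open>Only the two nodes around \<open>k * x\<close> contribute, and their weights add to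
  1.\<close>

lemma sum_tent:
  assumes k: "k \<ge> 1" and x: "x \<in> {0..1}"
  shows "(\<Sum>q\<le>k. tent (real k * x - real q)) = 1"
proof -
  define y where "y = real k * x"
  have y: "0 \<le> y" "y \<le> real k" using k x by (auto simp: y_def mult_left_le)
  define q where "q = nat \<lfloor>y\<rfloor>"
  have q: "real q \<le> y" "y < real q + 1" using y by (auto simp: q_def)
  show ?thesis
  proof (cases "q = k")
    \<comment> \<open>At the right end \<open>x = 1\<close> the upper neighbour of \<open>q\<close>
      would lie outside the index set.\<close>
    case True
    then have yk: "y = real k" using q y by linarith
    have "(\<Sum>p\<le>k. tent (y - real p)) = (\<Sum>p\<in>{k}. tent (y - real p))"
      by (rule sum.mono_neutral_right) (auto simp: tent_def yk)
    then show ?thesis by (simp add: yk tent_def y_def[symmetric])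
  next
    case False
    then have qk: "q < k" using q y by linarith
    have "(\<Sum>p\<le>k. tent (y - real p)) = (\<Sum>p\<in>{q, q + 1}. tent (y - real p))"
    proof (rule sum.mono_neutral_right)
      show "\<forall>p\<in>{..k} - {q, q + 1}. tent (y - real p) = 0"
      proof
        fix p assume "p \<in> {..k} - {q, q + 1}"
        then have "p + 1 \<le> q \<or> q + 2 \<le> p" by auto
        then have "real p + 1 \<le> real q \<or> real q + 2 \<le> real p" by (metis of_nat_1 of_nat_add of_nat_le_iff of_nat_numeral)
        then show "tent (y - real p) = 0" using q by (auto simp: tent_def)
      qed
    qed (use qk in auto)
    also have "\<dots> = 1" using q by (simp add: tent_def)
    finally show ?thesis by (simp add: y_def)
  qed
qed

definition grid :: "nat \<Rightarrow> nat \<Rightarrow> (nat \<Rightarrow> nat) set" where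
  "grid m k = {..<m} \<rightarrow>\<^sub>E {..k}"

text \<open>A continuous stand-in for the indicator of a grid cell: continuity serves both the
  Weierstrass approximation and weak convergence, and the product form is what
  \<open>cov_controlled\<close> handles.\<close>

definition bump :: "nat \<Rightarrow> nat \<Rightarrow> (nat \<Rightarrow> nat) \<Rightarrow> rvec \<Rightarrow> real" where
  "bump m k q r = (\<Prod>c<m. tent (real k * r c - real (q c)))"

lemma finite_grid: "finite (grid m k)"
  by (simp add: grid_def finite_PiE)

lemma bump_range: "bump m k q r \<in> {0..1}"
  unfolding bump_def using tent_range by (auto intro!: prod_nonneg prod_le_1)

lemma sum_bump:
  assumes "k \<ge> 1" and "\<And>c. c < m \<Longrightarrow> r c \<in> {0..1}"
  shows "(\<Sum>q\<in>grid m k. bump m k q r) = 1"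
proof -
  have "(\<Sum>q\<in>grid m k. bump m k q r) = (\<Prod>c<m. \<Sum>q\<le>k. tent (real k * r c - real q))"
    unfolding grid_def bump_def by (rule prod_sum_PiE[symmetric]) auto
  then show ?thesis using assms by (simp add: sum_tent)
qed

lemma sum_bump_range:
  assumes "k \<ge> 1" and "\<And>c. c < m \<Longrightarrow> r c \<in> {0..1}" and "S \<subseteq> grid m k"
  shows "(\<Sum>q\<in>S. bump m k q r) \<in> {0..1}"
proof -
  have "(\<Sum>q\<in>S. bump m k q r) \<le> (\<Sum>q\<in>grid m k. bump m k q r)"
    using assms bump_range by (intro sum_mono2 finite_grid) auto
  then show ?thesis using sum_bump[OF assms(1,2)] bump_range by (auto intro!: sum_nonneg)
qed

lemma bump_pos: "bump m k q r \<noteq> 0 \<Longrightarrow> c < m \<Longrightarrow> \<bar>real k * r c - real (q c)\<bar> < 1"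
  unfolding bump_def using tent_range[of "real k * r c - real (q c)"]
  by (subst tent_pos_iff[symmetric]) (auto simp: less_le)

text \<open>Two straddling grid points in one column: a point above the threshold must not lie far
  below a point under it, by monotonicity.\<close>

lemma straddling_column_bound:
  fixes x y r s :: "nat \<Rightarrow> real"
  assumes mono: "0 \<le> (\<Sum>c<m. (x c - y c) * (r c - s c))"
    and c0: "c0 < m" and gap: "\<delta> \<le> x c0 - y c0" and \<delta>: "\<delta> > 0"
    and x: "\<And>c. c < m \<Longrightarrow> \<bar>x c\<bar> \<le> M" and y: "\<And>c. c < m \<Longrightarrow> \<bar>y c\<bar> \<le> M"
    and k: "k \<ge> 1"
    and r: "bump m k q r \<noteq> 0" and s: "bump m k q' s \<noteq> 0"
    and qq: "\<And>c. c < m \<Longrightarrow> c \<noteq> c0 \<Longrightarrow> q c = q' c"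
  shows "real (q' c0) - real (q c0) \<le> 2 + 4 * M * real m / \<delta>"
proof (rule ccontr)
  assume "\<not> ?thesis"
  then have far: "2 + 4 * M * real m / \<delta> < real (q' c0) - real (q c0)" by simp
  have M: "M \<ge> 0" using x[OF c0] by linarith
  \<comment> \<open>Rank differences in units of the mesh. Where the two cells agree they are at
    most 2, against data differences of at most 2M, so these coordinates contribute at most 4Mm. A
    larger negative term at \<open>c0\<close> would contradict monotonicity.\<close>
  let ?v = "\<lambda>c. real k * (r c - s c)"
  have v0: "?v c0 < 2 - (real (q' c0) - real (q c0))"
    using bump_pos[OF r c0] bump_pos[OF s c0] by (simp add: algebra_simps abs_less_iff)
  have vc: "\<bar>?v c\<bar> \<le> 2" if "c < m" "c \<noteq> c0" for c
    using bump_pos[OF r that(1)] bump_pos[OF s that(1)] qq[OF that] by (simp add: algebra_simps abs_less_iff abs_le_iff)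
  have neg: "?v c0 \<le> 0" using v0 far M \<delta> by (smt (verit) divide_nonneg_pos mult_nonneg_nonneg of_nat_0_le_iff)
  have "(x c0 - y c0) * ?v c0 \<le> \<delta> * ?v c0" by (rule mult_right_mono_neg[OF gap neg])
  also have "\<dots> < \<delta> * (- (4 * M * real m / \<delta>))" using v0 far \<delta> by (intro mult_strict_left_mono) auto
  also have "\<dots> = - (4 * M * real m)" using \<delta> by simp
  finally have a: "(x c0 - y c0) * ?v c0 < - (4 * M * real m)" .
  have "(\<Sum>c\<in>{..<m} - {c0}. (x c - y c) * ?v c) \<le> (\<Sum>c\<in>{..<m} - {c0}. 2 * M * 2)"
  proof (rule sum_mono)
    fix c assume c: "c \<in> {..<m} - {c0}"
    have "\<bar>x c - y c\<bar> \<le> 2 * M" using x[of c] y[of c] c by auto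
    then have "\<bar>x c - y c\<bar> * \<bar>?v c\<bar> \<le> 2 * M * 2" using vc[of c] c M by (intro mult_mono) auto
    then show "(x c - y c) * ?v c \<le> 2 * M * 2" by (metis abs_le_iff abs_mult)
  qed
  also have "\<dots> \<le> (\<Sum>c\<in>{..<m}. 2 * M * 2)" using M by (intro sum_mono2) auto
  also have "\<dots> = 4 * M * real m" by simp
  finally have b: "(\<Sum>c\<in>{..<m} - {c0}. (x c - y c) * ?v c) \<le> 4 * M * real m" .
  have "real k * (\<Sum>c<m. (x c - y c) * (r c - s c)) = (\<Sum>c<m. (x c - y c) * ?v c)"
    by (simp add: sum_distrib_left mult_ac)
  also have "\<dots> = (x c0 - y c0) * ?v c0 + (\<Sum>c\<in>{..<m} - {c0}. (x c - y c) * ?v c)"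
    using c0 by (intro sum.remove) auto
  also have "\<dots> < 0" using a b by linarith
  finally show False using mono k by (simp add: mult_less_0_iff)
qed

lemma mod_eq_imp_eq_nat:
  fixes a b W :: nat
  assumes "a mod W = b mod W" "b < a + W" "a < b + W"
  shows "a = b"
proof (cases "a \<le> b")
  case True
  then have "W dvd b - a" using assms(1) mod_eq_dvd_iff_nat[of a b W] by metis
  then show ?thesis using assms(2) True by (cases "b - a = 0") (auto dest: dvd_imp_le)
next
  case False
  then have "W dvd a - b" using assms(1) mod_eq_dvd_iff_nat[of b a W] by simp
  then show ?thesis using assms(3) False by (cases "a - b = 0") (auto dest: dvd_imp_le)
qed

text \<open>Two cells of \<open>S\<close> in one column lie closer than \<open>W\<close>, so
  reducing the \<open>c0\<close> entry modulo \<open>W\<close> is injective on \<open>S\<close>. The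
  other \<open>m - 1\<close> entries take \<open>k + 1\<close> values each.\<close>

lemma card_bounded_columns:
  assumes "c0 < m" and W: "W \<ge> 1" and S: "S \<subseteq> grid m k"
    and near: "\<And>q q'. q \<in> S \<Longrightarrow> q' \<in> S \<Longrightarrow> (\<And>c. c < m \<Longrightarrow> c \<noteq> c0 \<Longrightarrow> q c = q' c) \<Longrightarrow> q' c0 < q c0 + W"
  shows "card S \<le> (k + 1) ^ (m - 1) * W"
proof -
  let ?T = "\<Pi>\<^sub>E c\<in>{..<m}. if c = c0 then {..<W} else {..k}"
  let ?f = "\<lambda>q. q(c0 := q c0 mod W)"
  have "card S \<le> card ?T"
  proof (rule card_inj_on_le)
    show "inj_on ?f S"
    proof (rule inj_onI)
      fix q q' assume q: "q \<in> S" "q' \<in> S" and e: "?f q = ?f q'"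
      have ne: "q c = q' c" if "c \<noteq> c0" for c
        using fun_cong[OF e, of c] that by simp
      have "q c0 mod W = q' c0 mod W" using fun_cong[OF e, of c0] by simp
      moreover have "q' c0 < q c0 + W" "q c0 < q' c0 + W"
        using near[OF q] near[OF q(2,1)] ne by auto
      ultimately have "q c0 = q' c0" by (rule mod_eq_imp_eq_nat)
      with ne show "q = q'" by (metis ext)
    qed
    show "?f ` S \<subseteq> ?T"
      using S assms(1) W by (auto simp: grid_def PiE_iff extensional_def subset_iff split: if_splits)
    show "finite ?T" by (intro finite_PiE) auto
  qed
  also have "card ?T = (\<Prod>c<m. card (if c = c0 then {..<W} else {..k}))"
    by (simp add: card_PiE)
  also have "\<dots> = W * (\<Prod>c\<in>{..<m} - {c0}. card (if c = c0 then {..<W} else {..k}))"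
    using assms(1) by (subst prod.remove[of _ c0]) auto
  also have "(\<Prod>c\<in>{..<m} - {c0}. card (if c = c0 then {..<W} else {..k})) = (\<Prod>c\<in>{..<m} - {c0}. k + 1)"
    by (intro prod.cong) auto
  also have "\<dots> = (k + 1) ^ (m - 1)" using assms(1) by simp
  finally show ?thesis by (simp add: mult.commute)
qed

text \<open>Used are the cells touched by ranks of observations inside the orthant. The error has
  three sources: observations beyond \<open>M\<close>, observations less than \<delta> past a face,
  and cells also touched by an observation farther outside. Monotonicity makes the last few, and
  each has average weight at most \<beta>.\<close>

lemma orthant_indicator_approx:
  fixes x r :: "nat \<Rightarrow> nat \<Rightarrow> real"
  assumes C: "C \<subseteq> {..<m}" and \<delta>: "\<delta> > 0" and k: "k \<ge> 1" and W: "W \<ge> 1" "2 + 4 * M * real m / \<delta> < real W"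
    and r: "\<And>i c. i \<in> {1..n} \<Longrightarrow> c < m \<Longrightarrow> r i c \<in> {0..1}"
    and mono: "\<And>i l. i \<in> {1..n} \<Longrightarrow> l \<in> {1..n} \<Longrightarrow> 0 \<le> (\<Sum>c<m. (x i c - x l c) * (r i c - r l c))"
    and \<beta>: "\<And>q. q \<in> grid m k \<Longrightarrow> avg n (\<lambda>i. bump m k q (r i)) \<le> \<beta>" "0 \<le> \<beta>"
  shows "\<exists>S\<subseteq>grid m k. avg n (\<lambda>i. \<bar>of_bool (\<forall>c\<in>C. x i c \<le> b c) - (\<Sum>q\<in>S. bump m k q (r i))\<bar>)
     \<le> avg n (\<lambda>i. of_bool (\<exists>c<m. M < \<bar>x i c\<bar>))
       + (\<Sum>c\<in>C. avg n (\<lambda>i. of_bool (b c < x i c \<and> x i c < b c + \<delta>)))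
       + real m * real ((k + 1) ^ (m - 1) * W) * \<beta>"
proof -
  let ?A = "\<lambda>i. \<forall>c\<in>C. x i c \<le> b c" and ?B = "\<lambda>i. \<exists>c<m. M < \<bar>x i c\<bar>"
  \<comment> \<open>Observations beyond \<open>M\<close> may not contribute cells, since
    \<open>straddling_column_bound\<close> needs bounded data.\<close>
  define S where "S = {q \<in> grid m k. \<exists>l\<in>{1..n}. ?A l \<and> \<not> ?B l \<and> bump m k q (r l) \<noteq> 0}"
  define Str where "Str c = {q \<in> S. \<exists>i\<in>{1..n}. b c + \<delta> \<le> x i c \<and> \<not> ?B i \<and> bump m k q (r i) \<noteq> 0}" for c
  let ?g = "\<lambda>i. \<Sum>q\<in>S. bump m k q (r i)"
  have Sg: "S \<subseteq> grid m k" by (auto simp: S_def)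
  then have finS: "finite S" by (rule finite_subset[OF _ finite_grid])
  have finStr: "finite (Str c)" for c by (rule finite_subset[OF _ finS]) (auto simp: Str_def)
  have finC: "finite C" using C by (rule finite_subset) simp
  have g01: "?g i \<in> {0..1}" if "i \<in> {1..n}" for i using r[OF that] k Sg by (intro sum_bump_range)
  have bnn: "0 \<le> bump m k q y" for q y using bump_range[of m k q y] by simp
  have pw: "\<bar>of_bool (?A i) - ?g i\<bar> \<le> of_bool (?B i)
     + (\<Sum>c\<in>C. of_bool (b c < x i c \<and> x i c < b c + \<delta>)) + (\<Sum>c\<in>C. \<Sum>q\<in>Str c. bump m k q (r i))"
    (is "?L \<le> ?b + ?s + ?t") if i: "i \<in> {1..n}" for i
  proof -
    have nn: "0 \<le> ?s" "0 \<le> ?t" by (auto intro!: sum_nonneg bnn)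
    have L1: "?L \<le> 1" using g01[OF i] by auto
    show ?thesis
    proof (cases "?B i")
      case True
      then show ?thesis using L1 nn by simp
    next
      case nB: False
      show ?thesis
      proof (cases "?A i")
        case True
        \<comment> \<open>Observation \<open>i\<close> itself witnesses that every cell with
          non-zero weight at \<open>r i\<close> belongs to \<open>S\<close>, so the whole partition
          of unity is summed.\<close>
        have "?g i = (\<Sum>q\<in>grid m k. bump m k q (r i))"
          by (rule sum.mono_neutral_left[OF finite_grid Sg]) (use True nB i in \<open>auto simp: S_def\<close>)
        also have "\<dots> = 1" by (rule sum_bump[OF k r[OF i]])
        finally show ?thesis using True nn by simp
      next
        case nA: False
        then obtain c where c: "c \<in> C" "b c < x i c" by (auto simp: not_le)
        show ?thesis
        proof (cases "x i c < b c + \<delta>")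
          case True
          have "of_bool (b c < x i c \<and> x i c < b c + \<delta>) \<le> ?s"
            by (rule member_le_sum[of c C "\<lambda>c. of_bool (b c < x i c \<and> x i c < b c + \<delta>)"]) (use c finC in auto)
          then have "1 \<le> ?s" using True c by simp
          then have "?L \<le> ?s" using L1 by linarith
          then show ?thesis using nn nB by simp
        next
          case False
          \<comment> \<open>Here \<open>i\<close> is the outer witness: every cell of
            \<open>S\<close> with non-zero weight at \<open>r i\<close> straddles the face
            \<open>c\<close>.\<close>
          have "?g i = (\<Sum>q\<in>Str c. bump m k q (r i))"
            by (rule sum.mono_neutral_right[OF finS]) (use False nB i in \<open>auto simp: Str_def not_less intro!: bexI[of _ i]\<close>)
          also have "\<dots> \<le> ?t"
            by (rule member_le_sum[of c C "\<lambda>c. \<Sum>q\<in>Str c. bump m k q (r i)"])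
               (use c finC bnn in \<open>auto intro!: sum_nonneg\<close>)
          finally have "?g i \<le> ?t" .
          moreover have "?L = ?g i" using nA g01[OF i] by auto
          ultimately show ?thesis using nn nB by simp
        qed
      qed
    qed
  qed
  have card: "card (Str c) \<le> (k + 1) ^ (m - 1) * W" if c: "c \<in> C" for c
  proof (rule card_bounded_columns)
    show "c < m" using c C by auto
    show "Str c \<subseteq> grid m k" using Sg by (auto simp: Str_def)
    fix q q' assume q: "q \<in> Str c" and q': "q' \<in> Str c" and e: "\<And>c'. c' < m \<Longrightarrow> c' \<noteq> c \<Longrightarrow> q c' = q' c'"
    obtain i where i: "i \<in> {1..n}" "b c + \<delta> \<le> x i c" "\<not> ?B i" "bump m k q (r i) \<noteq> 0"
      using q by (auto simp: Str_def)
    obtain l where l: "l \<in> {1..n}" "?A l" "\<not> ?B l" "bump m k q' (r l) \<noteq> 0"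
      using q' by (auto simp: Str_def S_def)
    have "real (q' c) - real (q c) \<le> 2 + 4 * M * real m / \<delta>"
    proof (rule straddling_column_bound[OF mono[OF i(1) l(1)] \<open>c < m\<close> _ \<delta> _ _ k i(4) l(4) e])
      show "\<delta> \<le> x i c - x l c" using i(2) l(2) c by force
      show "\<bar>x i c'\<bar> \<le> M" "\<bar>x l c'\<bar> \<le> M" if "c' < m" for c'
        using i(3) l(3) that by (meson not_less)+
    qed
    then show "q' c < q c + W" using W by linarith
  qed (use W in auto)
  have "avg n (\<lambda>i. \<bar>of_bool (?A i) - ?g i\<bar>) \<le> avg n (\<lambda>i. of_bool (?B i)
     + (\<Sum>c\<in>C. of_bool (b c < x i c \<and> x i c < b c + \<delta>)) + (\<Sum>c\<in>C. \<Sum>q\<in>Str c. bump m k q (r i)))"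
    by (rule avg_mono[OF pw])
  also have "\<dots> = avg n (\<lambda>i. of_bool (?B i)) + (\<Sum>c\<in>C. avg n (\<lambda>i. of_bool (b c < x i c \<and> x i c < b c + \<delta>)))
     + (\<Sum>c\<in>C. \<Sum>q\<in>Str c. avg n (\<lambda>i. bump m k q (r i)))"
    by (simp only: avg_add avg_sum)
  also have "(\<Sum>c\<in>C. \<Sum>q\<in>Str c. avg n (\<lambda>i. bump m k q (r i))) \<le> (\<Sum>c\<in>C. real ((k + 1) ^ (m - 1) * W) * \<beta>)"
  proof (rule sum_mono)
    fix c assume c: "c \<in> C"
    have "(\<Sum>q\<in>Str c. avg n (\<lambda>i. bump m k q (r i))) \<le> (\<Sum>q\<in>Str c. \<beta>)"
      by (intro sum_mono \<beta>) (use Sg in \<open>auto simp: Str_def\<close>)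
    also have "\<dots> = real (card (Str c)) * \<beta>" by simp
    also have "\<dots> \<le> real ((k + 1) ^ (m - 1) * W) * \<beta>"
      using card[OF c] \<beta>(2) by (intro mult_right_mono) (simp_all only: of_nat_le_iff)
    finally show "(\<Sum>q\<in>Str c. avg n (\<lambda>i. bump m k q (r i))) \<le> real ((k + 1) ^ (m - 1) * W) * \<beta>" .
  qed
  also have "\<dots> = real (card C) * (real ((k + 1) ^ (m - 1) * W) * \<beta>)" by simp
  also have "\<dots> \<le> real m * (real ((k + 1) ^ (m - 1) * W) * \<beta>)"
    using \<beta>(2) card_mono[OF _ C] by (intro mult_right_mono) auto
  finally show ?thesis using Sg by (intro exI[of _ S]) (simp add: mult.assoc)
qed

section \<open>Mass of grid cells under the uniform distribution\<close>

lemma unit_cube_sets: "unit_cube m \<in> sets (lborel_Rn m)"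
  unfolding unit_cube_def lborel_Rn_def by (intro sets_PiM_I_finite) auto

lemma emeasure_lborel_Rn_box:
  assumes "\<And>c. c < m \<Longrightarrow> A c \<in> sets borel"
  shows "emeasure (lborel_Rn m) (Pi\<^sub>E {..<m} A) = (\<Prod>c<m. emeasure lborel (A c))"
proof -
  interpret product_sigma_finite "\<lambda>_::nat. lborel :: real measure" ..
  show ?thesis unfolding lborel_Rn_def using assms by (intro emeasure_PiM) auto
qed

lemma emeasure_unit_cube: "emeasure (lborel_Rn m) (unit_cube m) = 1"
  unfolding unit_cube_def by (subst emeasure_lborel_Rn_box) auto

lemma prob_space_unif_cube: "prob_space (unif_cube m)"
  unfolding unif_cube_def by (rule prob_space_uniform_measure) (auto simp: emeasure_unit_cube)

lemma bump_measurable: "bump m k q \<in> borel_measurable (lborel_Rn m)"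
  unfolding bump_def[abs_def] lborel_Rn_def tent_def by measurable

text \<open>A bump is at most 1 and vanishes outside a box of side 2/k.\<close>

lemma integral_bump_le:
  assumes k: "k \<ge> 1"
  shows "(\<integral>r. bump m k q r \<partial>unif_cube m) \<le> (2 / real k) ^ m"
proof -
  interpret prob_space "unif_cube m" by (rule prob_space_unif_cube)
  let ?B = "Pi\<^sub>E {..<m} (\<lambda>c. {(real (q c) - 1) / real k <..< (real (q c) + 1) / real k})"
  have sB: "?B \<in> sets (lborel_Rn m)" unfolding lborel_Rn_def by (intro sets_PiM_I_finite) auto
  have s[measurable_cong]: "sets (unif_cube m) = sets (lborel_Rn m)" by (simp add: unif_cube_def)
  have sp: "space (unif_cube m) = {..<m} \<rightarrow>\<^sub>E UNIV" by (simp add: unif_cube_def lborel_Rn_def space_PiM)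
  have meas: "bump m k q \<in> borel_measurable (unif_cube m)" using bump_measurable by simp
  have "(\<integral>r. bump m k q r \<partial>unif_cube m) \<le> (\<integral>r. indicator ?B r \<partial>unif_cube m)"
  proof (rule integral_mono)
    show "integrable (unif_cube m) (bump m k q)"
      by (rule integrable_const_bound[where B=1]) (use bump_range[of m k q] meas in auto)
    show "integrable (unif_cube m) (indicator ?B :: rvec \<Rightarrow> real)"
      by (rule integrable_const_bound[where B=1]) (use sB in auto)
    fix r assume r: "r \<in> space (unif_cube m)"
    show "bump m k q r \<le> indicator ?B r"
    proof (cases "bump m k q r = 0")
      case False
      have "r c \<in> {(real (q c) - 1) / real k <..< (real (q c) + 1) / real k}" if "c < m" for c
        using bump_pos[OF False that] k by (auto simp: field_simps abs_less_iff)
      then have "r \<in> ?B" using r by (auto simp: sp PiE_iff)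
      then show ?thesis using bump_range[of m k q r] by simp
    qed simp
  qed
  also have "\<dots> = measure (unif_cube m) ?B" using sB by (simp add: s)
  also have "\<dots> \<le> (2 / real k) ^ m"
  proof -
    have "emeasure (unif_cube m) ?B \<le> emeasure (lborel_Rn m) ?B"
      unfolding unif_cube_def using sB unit_cube_sets
      by (auto simp: emeasure_uniform_measure emeasure_unit_cube divide_ennreal_def intro!: emeasure_mono)
    also have "\<dots> = (\<Prod>c<m. ennreal (2 / real k))"
      by (subst emeasure_lborel_Rn_box)
         (use k in \<open>auto intro!: prod.cong simp: diff_divide_distrib[symmetric] emeasure_lborel_Ioo divide_right_mono\<close>)
    also have "\<dots> = ennreal ((2 / real k) ^ m)" by (simp add: ennreal_power)
    finally show ?thesis by (simp add: emeasure_eq_measure)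
  qed
  finally show ?thesis .
qed

lemma continuous_map_bump:
  "continuous_map (product_topology (\<lambda>_. euclideanreal) {..<m}) euclideanreal (bump m k q)"
proof -
  have t: "continuous_map euclideanreal euclideanreal (\<lambda>y. tent (real k * y - real (q c)))" for c
    by (auto simp: intro!: continuous_intros)
  have "continuous_map (product_topology (\<lambda>_. euclideanreal) {..<m}) euclideanreal
     (\<lambda>r. \<Prod>c<m. ((\<lambda>y. tent (real k * y - real (q c))) \<circ> (\<lambda>r. r c)) r)"
  proof (intro continuous_map_prod)
    fix c assume "c \<in> {..<m}"
    then show "continuous_map (product_topology (\<lambda>_. euclideanreal) {..<m}) euclideanreal
        ((\<lambda>y. tent (real k * y - real (q c))) \<circ> (\<lambda>r. r c))"
      by (rule continuous_map_compose[OF continuous_map_product_projection[where X = "\<lambda>_. euclideanreal"] t])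
  qed auto
  then show ?thesis by (simp add: bump_def[abs_def] o_def)
qed

lemma integral_empirical_bump:
  assumes n: "n \<ge> 1" and g: "g ` {1..n} \<subseteq> unit_cube m"
  shows "(\<integral>r. bump m k q r \<partial>empirical_distr m n g) = avg n (\<lambda>i. bump m k q (g i))"
proof -
  have sp: "unit_cube m \<subseteq> space (lborel_Rn m)" using unit_cube_sets sets.sets_into_space by blast
  have "g \<in> measurable (uniform_count_measure {1..n}) (lborel_Rn m)"
    using g sp by (auto simp: measurable_def sets_uniform_count_measure space_uniform_count_measure)
  then have "(\<integral>r. bump m k q r \<partial>empirical_distr m n g) = (\<integral>i. bump m k q (g i) \<partial>uniform_count_measure {1..n})"
    unfolding empirical_distr_def by (rule integral_distr[OF _ bump_measurable])
  also have "\<dots> = avg n (\<lambda>i. bump m k q (g i))"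
    by (subst integral_uniform_count_measure) (auto simp: avg_def)
  finally show ?thesis .
qed

text \<open>The number of straddling cells has one power of \<open>k\<close> less than the
  reciprocal of a cell mass, which leaves a factor 1/k. The 4 combines
  \<open>k + 1 \<le> 2 * k\<close> with the side 2/k.\<close>

lemma grid_volume_bound:
  assumes "k \<ge> 1" "m \<ge> 1"
  shows "real ((k + 1) ^ (m - 1)) * (2 / real k) ^ m \<le> 4 ^ m / real k"
proof -
  obtain p where p: "m = Suc p" using assms by (cases m) auto
  have "(real k + 1) ^ p \<le> (2 * real k) ^ p" using assms by (intro power_mono) auto
  then have "(real k + 1) ^ p * (2 / real k) ^ m \<le> (2 * real k) ^ p * (2 / real k) ^ m"
    by (intro mult_right_mono) auto
  also have "\<dots> = 4 ^ p * 2 / real k"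
  proof -
    have "(2 * real k) ^ p * (2 / real k) ^ p = 4 ^ p"
      unfolding power_mult_distrib[symmetric] using assms by simp
    then show ?thesis by (simp add: p)
  qed
  also have "\<dots> \<le> 4 ^ m / real k" by (intro divide_right_mono) (auto simp: p)
  finally show ?thesis by (simp add: p add.commute)
qed

text \<open>Of the assignment only pairwise monotonicity is asked. The set \<open>S\<close> may
  depend on the sample; the grid that contains it may not.\<close>

abbreviation ranks_approximate_orthant ::
  "(nat \<Rightarrow> nat \<Rightarrow> rvec) \<Rightarrow> nat \<Rightarrow> nat set \<Rightarrow> (nat \<Rightarrow> real) \<Rightarrow> real \<Rightarrow> real \<Rightarrow> real \<Rightarrow> nat \<Rightarrow> nat \<Rightarrow> bool"
where
  "ranks_approximate_orthant h m C b \<delta> M \<eta> k N \<equiv> \<forall>n\<ge>N. \<forall>x r \<sigma>. \<sigma> permutes {1..n} \<and> (\<forall>i\<in>{1..n}. r i = h n (\<sigma> i)) \<and>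
     (\<forall>i\<in>{1..n}. \<forall>l\<in>{1..n}. 0 \<le> (\<Sum>c<m. (x i c - x l c) * (r i c - r l c))) \<longrightarrow>
     (\<exists>S\<subseteq>grid m k. avg n (\<lambda>i. \<bar>of_bool (\<forall>c\<in>C. x i c \<le> b c) - (\<Sum>q\<in>S. bump m k q (r i))\<bar>)
     \<le> avg n (\<lambda>i. of_bool (\<exists>c<m. M < \<bar>x i c\<bar>))
       + (\<Sum>c\<in>C. avg n (\<lambda>i. of_bool (b c < x i c \<and> x i c < b c + \<delta>))) + \<eta>)"

text \<open>\<open>W\<close> is fixed by \<open>M\<close>, \<delta> and \<open>m\<close> before the
  mesh is chosen, so a fine mesh makes the straddling cells light under the uniform law. Weak
  convergence carries the bound on cell masses over to the reference points.\<close>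

lemma orthant_approx_by_ranks:
  fixes h :: "nat \<Rightarrow> nat \<Rightarrow> rvec"
  assumes m: "m \<ge> 1" and C: "C \<subseteq> {..<m}" and \<delta>: "\<delta> > 0" and M: "M \<ge> 0" and \<eta>: "\<eta> > 0"
    and h: "\<And>n. n \<ge> 1 \<Longrightarrow> h n ` {1..n} \<subseteq> unit_cube m"
    and weak: "weak_conv_Rn m (\<lambda>n. empirical_distr m n (h n)) (unif_cube m)"
  shows "\<exists>k\<ge>1. \<exists>N\<ge>1. ranks_approximate_orthant h m C b \<delta> M \<eta> k N"
proof -
  define W where "W = nat \<lceil>3 + 4 * M * real m / \<delta>\<rceil>"
  have W: "2 + 4 * M * real m / \<delta> < real W" "W \<ge> 1"
  proof -
    have nn: "0 \<le> 4 * M * real m / \<delta>" using M \<delta> by simp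
    then show "2 + 4 * M * real m / \<delta> < real W" unfolding W_def by linarith
    then show "W \<ge> 1" using nn by linarith
  qed
  \<comment> \<open>Chosen so that the bound of \<open>grid_volume_bound\<close>, multiplied by m W,
    is at most \<eta>/2.\<close>
  define k where "k = nat \<lceil>1 + 2 * real m * real W * 4 ^ m / \<eta>\<rceil>"
  have k: "2 * real m * real W * 4 ^ m / \<eta> \<le> real k" "k \<ge> 1"
  proof -
    have nn: "0 \<le> 2 * real m * real W * 4 ^ m / \<eta>" using \<eta> by simp
    then show "2 * real m * real W * 4 ^ m / \<eta> \<le> real k" unfolding k_def by linarith
    show "k \<ge> 1" using nn unfolding k_def by linarith
  qed
  define L where "L = real m * real ((k + 1) ^ (m - 1) * W)"
  have L: "L > 0" using m W by (simp add: L_def)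
  \<comment> \<open>The second term is the slack for weak convergence, which needs a strict
    inequality; multiplied by \<open>L\<close> it uses the other half of \<eta>.\<close>
  define \<beta> where "\<beta> = (2 / real k) ^ m + \<eta> / (2 * L)"
  have L\<beta>: "L * \<beta> \<le> \<eta>"
  proof -
    have "L * (2 / real k) ^ m = real m * real W * (real ((k + 1) ^ (m - 1)) * (2 / real k) ^ m)"
      by (simp add: L_def)
    also have "\<dots> \<le> real m * real W * (4 ^ m / real k)"
      by (intro mult_left_mono grid_volume_bound k m) auto
    also have "\<dots> \<le> \<eta> / 2" using k \<eta> by (simp add: field_simps)
    finally show ?thesis using L by (simp add: \<beta>_def distrib_left)
  qed
  have "\<forall>\<^sub>F n in sequentially. avg n (\<lambda>i. bump m k q (h n i)) \<le> \<beta>" for q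
  proof -
    have "bounded (bump m k q ` ({..<m} \<rightarrow>\<^sub>E UNIV))"
      using bump_range[of m k q] by (intro boundedI[where B=1]) auto
    then have "(\<lambda>n. \<integral>r. bump m k q r \<partial>empirical_distr m n (h n)) \<longlonglongrightarrow> (\<integral>r. bump m k q r \<partial>unif_cube m)"
      using weak continuous_map_bump unfolding weak_conv_Rn_def by blast
    moreover have "(\<integral>r. bump m k q r \<partial>unif_cube m) < \<beta>"
      using integral_bump_le[OF k(2), of m q] \<eta> L by (simp add: \<beta>_def add_pos_pos le_less_trans)
    ultimately have "\<forall>\<^sub>F n in sequentially. (\<integral>r. bump m k q r \<partial>empirical_distr m n (h n)) < \<beta>"
      by (rule order_tendstoD)
    with eventually_ge_at_top[of 1] show ?thesis
      by eventually_elim (use h integral_empirical_bump in force)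
  qed
  then have "\<forall>\<^sub>F n in sequentially. \<forall>q\<in>grid m k. avg n (\<lambda>i. bump m k q (h n i)) \<le> \<beta>"
    by (intro eventually_ball_finite finite_grid) auto
  then obtain N0 where N0: "\<And>n q. n \<ge> N0 \<Longrightarrow> q \<in> grid m k \<Longrightarrow> avg n (\<lambda>i. bump m k q (h n i)) \<le> \<beta>"
    unfolding eventually_sequentially by blast
  show ?thesis
  proof (rule exI[of _ k], rule conjI[OF k(2)], intro exI[of _ "max 1 N0"] conjI allI impI; (elim conjE)?)
    fix n x r \<sigma>
    assume n: "max 1 N0 \<le> n" and \<sigma>: "\<sigma> permutes {1..n}" and r: "\<forall>i\<in>{1..n}. r i = h n (\<sigma> i)"
      and mono: "\<forall>i\<in>{1..n}. \<forall>l\<in>{1..n}. 0 \<le> (\<Sum>c<m. (x i c - x l c) * (r i c - r l c))"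
    \<comment> \<open>The ranks are a permutation of the reference points, so their cell averages do
      not depend on the sample.\<close>
    have av: "avg n (\<lambda>i. bump m k q (r i)) = avg n (\<lambda>i. bump m k q (h n i))" for q
    proof -
      have "(\<Sum>i=1..n. bump m k q (r i)) = (\<Sum>i=1..n. bump m k q (h n (\<sigma> i)))" using r by (intro sum.cong) auto
      also have "\<dots> = (\<Sum>i=1..n. bump m k q (h n i))"
        using sum.permute[OF \<sigma>, of "\<lambda>i. bump m k q (h n i)"] by (simp add: o_def)
      finally show ?thesis by (simp add: avg_def)
    qed
    have r01: "r i c \<in> {0..1}" if i: "i \<in> {1..n}" and c: "c < m" for i c
    proof -
      have "\<sigma> i \<in> {1..n}" using \<sigma> i by (rule permutes_in_image[THEN iffD2])
      then have "r i \<in> unit_cube m" using h[of n] n r i by auto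
      then show ?thesis using c unfolding unit_cube_def by (auto simp: PiE_iff)
    qed
    have b: "avg n (\<lambda>i. bump m k q (r i)) \<le> \<beta>" if "q \<in> grid m k" for q
      unfolding av using n that by (intro N0) auto
    have "\<beta> \<ge> 0" using \<eta> L by (simp add: \<beta>_def)
    from orthant_indicator_approx[OF C \<delta> k(2) W(2,1) r01 mono[rule_format] b this, of b]
    obtain S where S: "S \<subseteq> grid m k" "avg n (\<lambda>i. \<bar>of_bool (\<forall>c\<in>C. x i c \<le> b c) - (\<Sum>q\<in>S. bump m k q (r i))\<bar>)
     \<le> avg n (\<lambda>i. of_bool (\<exists>c<m. M < \<bar>x i c\<bar>))
       + (\<Sum>c\<in>C. avg n (\<lambda>i. of_bool (b c < x i c \<and> x i c < b c + \<delta>))) + L * \<beta>"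
      by (auto simp: L_def)
    then show "\<exists>S\<subseteq>grid m k. avg n (\<lambda>i. \<bar>of_bool (\<forall>c\<in>C. x i c \<le> b c) - (\<Sum>q\<in>S. bump m k q (r i))\<bar>)
     \<le> avg n (\<lambda>i. of_bool (\<exists>c<m. M < \<bar>x i c\<bar>))
       + (\<Sum>c\<in>C. avg n (\<lambda>i. of_bool (b c < x i c \<and> x i c < b c + \<delta>))) + \<eta>"
      using L\<beta> by (intro exI[of _ S] conjI) auto
  qed auto
qed

section \<open>Optimal assignments\<close>

lemma dist_Rn_square: "(dist_Rn m u v)\<^sup>2 = (\<Sum>c<m. (u c - v c)\<^sup>2)"
  by (simp add: dist_Rn_def L2_set_def real_sqrt_pow2 sum_nonneg)

lemma finite_perms: "finite {\<sigma>. \<sigma> permutes {1..n::nat}}"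
  by (simp add: finite_permutations)

lemma perms_nonempty: "{\<sigma>. \<sigma> permutes {1..n::nat}} \<noteq> {}"
  using permutes_id by blast

lemma opt_perm_permutes: "opt_perm m n g z permutes {1..n}"
  using arg_min_if_finite(1)[OF finite_perms perms_nonempty] unfolding opt_perm_def by blast

lemma opt_perm_minimal:
  assumes "\<tau> permutes {1..n}"
  shows "(\<Sum>i=1..n. (dist_Rn m (z i) (g (opt_perm m n g z i)))\<^sup>2) \<le> (\<Sum>i=1..n. (dist_Rn m (z i) (g (\<tau> i)))\<^sup>2)"
  unfolding opt_perm_def
  by (rule arg_min_least[OF finite_perms perms_nonempty, where f = "\<lambda>\<sigma>. \<Sum>i=1..n. (dist_Rn m (z i) (g (\<sigma> i)))\<^sup>2"])
     (use assms in simp)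

text \<open>Swapping two assignments does not improve an optimal one.\<close>

lemma opt_perm_monotone:
  fixes g z :: "nat \<Rightarrow> rvec" and m n :: nat
  assumes i: "i \<in> {1..n}" and l: "l \<in> {1..n}"
  defines "\<sigma> \<equiv> opt_perm m n g z"
  shows "0 \<le> (\<Sum>c<m. (z i c - z l c) * (g (\<sigma> i) c - g (\<sigma> l) c))"
proof (cases "i = l")
  case False
  define \<tau> where "\<tau> = \<sigma> \<circ> Transposition.transpose i l"
  have \<tau>: "\<tau> permutes {1..n}"
    unfolding \<tau>_def \<sigma>_def using opt_perm_permutes permutes_swap_id[OF i l] by (rule permutes_compose[rotated])
  let ?D = "\<lambda>i k. (dist_Rn m (z i) (g k))\<^sup>2"
  have split: "(\<Sum>k=1..n. F k) = F i + F l + (\<Sum>k\<in>{1..n} - {i, l}. F k)" for F :: "nat \<Rightarrow> real"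
  proof -
    have "(\<Sum>k=1..n. F k) = (\<Sum>k\<in>{i, l}. F k) + (\<Sum>k\<in>{1..n} - {i, l}. F k)"
      using i l by (subst add.commute, intro sum.subset_diff) auto
    then show ?thesis using False by simp
  qed
  have "(\<Sum>k=1..n. ?D k (\<sigma> k)) \<le> (\<Sum>k=1..n. ?D k (\<tau> k))"
    unfolding \<sigma>_def by (rule opt_perm_minimal[OF \<tau>])
  moreover have "(\<Sum>k\<in>{1..n} - {i, l}. ?D k (\<tau> k)) = (\<Sum>k\<in>{1..n} - {i, l}. ?D k (\<sigma> k))"
    by (intro sum.cong refl) (auto simp: \<tau>_def Transposition.transpose_def)
  moreover have "\<tau> i = \<sigma> l" "\<tau> l = \<sigma> i" by (auto simp: \<tau>_def)
  ultimately have "0 \<le> ?D i (\<sigma> l) + ?D l (\<sigma> i) - ?D i (\<sigma> i) - ?D l (\<sigma> l)"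
    using split[of "\<lambda>k. ?D k (\<sigma> k)"] split[of "\<lambda>k. ?D k (\<tau> k)"] by simp
  \<comment> \<open>The squared norms cancel in the swap; twice an inner product remains.\<close>
  also have "\<dots> = (\<Sum>c<m. 2 * ((z i c - z l c) * (g (\<sigma> i) c - g (\<sigma> l) c)))"
    unfolding dist_Rn_square sum.distrib[symmetric] sum_subtractf[symmetric]
    by (intro sum.cong refl) (simp add: power2_eq_square algebra_simps)
  finally show ?thesis by (simp add: sum_distrib_left[symmetric])
qed simp

lemma emp_rank_in_cube:
  assumes "h n j ` {1..n} \<subseteq> unit_cube m" and "i \<in> {1..n}" and "c < m" and "m = d j"
  shows "emp_rank d h n x j i c \<in> {0..1}"
proof -
  have "opt_perm (d j) n (h n j) (\<lambda>i. x i j) i \<in> {1..n}"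
    using permutes_in_image[OF opt_perm_permutes] assms(2) by blast
  then have "emp_rank d h n x j i \<in> unit_cube m" using assms by (auto simp: emp_rank_def)
  then show ?thesis using assms(3) by (auto simp: unit_cube_def PiE_iff)
qed

lemma rank_dCov2_nonneg:
  assumes "n \<ge> 1"
  shows "0 \<le> dCov2 n (rank_dist d h n x j) (rank_dist_plus K d h n x j)"
proof -
  have "0 \<le> dCov2 n (\<lambda>k l. L2_set (\<lambda>c. emp_rank d h n x j k c - emp_rank d h n x j l c) {..<d j})
     (\<lambda>k l. L2_set (\<lambda>p. (case p of (m, c) \<Rightarrow> emp_rank d h n x m k c) - (case p of (m, c) \<Rightarrow> emp_rank d h n x m l c))
        (SIGMA m:{j+1..K}. {..<d m}))"
    by (rule dCov2_dist_nonneg[OF assms]) auto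
  moreover have "(\<lambda>p. (case p of (m, c) \<Rightarrow> emp_rank d h n x m k c) - (case p of (m, c) \<Rightarrow> emp_rank d h n x m l c))
     = (\<lambda>(m, c). emp_rank d h n x m k c - emp_rank d h n x m l c)" for k l by auto
  ultimately show ?thesis by (simp add: rank_dist_def[abs_def] rank_dist_plus_def[abs_def] dist_Rn_def)
qed

lemma RdCov2_nonneg: "n \<ge> 1 \<Longrightarrow> 0 \<le> RdCov2 K d h n x"
  unfolding RdCov2_def by (intro sum_nonneg rank_dCov2_nonneg)

lemma rank_dCov2_le_RdCov2:
  assumes "n \<ge> 1" and "j \<in> {1..K-1}"
  shows "dCov2 n (rank_dist d h n x j) (rank_dist_plus K d h n x j) \<le> RdCov2 K d h n x"
  unfolding RdCov2_def using assms
  by (intro member_le_sum[where f = "\<lambda>j. dCov2 n (rank_dist d h n x j) (rank_dist_plus K d h n x j)"] rank_dCov2_nonneg) auto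

section \<open>A deterministic lower bound for the statistic\<close>

lemma abs_prod_diff_le:
  fixes a b :: "'i \<Rightarrow> real"
  assumes "\<And>j. j \<in> J \<Longrightarrow> a j \<in> {0..1}" "\<And>j. j \<in> J \<Longrightarrow> b j \<in> {0..1}"
  shows "\<bar>(\<Prod>j\<in>J. a j) - (\<Prod>j\<in>J. b j)\<bar> \<le> (\<Sum>j\<in>J. \<bar>a j - b j\<bar>)"
  using norm_prod_diff[of J a b] assms by auto

text \<open>If the statistic were small, the sums over cells would factor up to less than
  \<Delta>/4. Passing from orthant indicators to cell sums costs \<Delta>/8 in the joint frequency
  and \<Delta>/8 in the product of the block frequencies, so the gap would be less than
  \<Delta>/2.\<close>

lemma RdCov2_bounded_below:
  fixes K :: nat and d :: "nat \<Rightarrow> nat" and h :: "nat \<Rightarrow> nat \<Rightarrow> nat \<Rightarrow> rvec"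
  assumes K: "K \<ge> 1" and d: "\<And>j. j \<in> {1..K} \<Longrightarrow> d j \<ge> 1"
    and h: "\<And>n j. n \<ge> 1 \<Longrightarrow> j \<in> {1..K} \<Longrightarrow> h n j ` {1..n} \<subseteq> unit_cube (d j)"
    and weak: "\<And>j. j \<in> {1..K} \<Longrightarrow> weak_conv_Rn (d j) (\<lambda>n. empirical_distr (d j) n (h n j)) (unif_cube (d j))"
    and C: "\<And>j. j \<in> {1..K} \<Longrightarrow> C j \<subseteq> {..<d j}"
    and \<delta>: "\<delta> > 0" and M: "M \<ge> 0" and \<Delta>: "\<Delta> > 0"
  shows "\<exists>\<epsilon>>0. \<exists>N\<ge>1. \<forall>n\<ge>N. \<forall>x.
     (\<forall>j\<in>{1..K}. avg n (\<lambda>i. of_bool (\<exists>c<d j. M < \<bar>x i j c\<bar>))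
        + (\<Sum>c\<in>C j. avg n (\<lambda>i. of_bool (b j c < x i j c \<and> x i j c < b j c + \<delta>))) \<le> \<Delta> / (16 * real K)) \<and>
     \<Delta> / 2 \<le> \<bar>avg n (\<lambda>i. of_bool (\<forall>j\<in>{1..K}. \<forall>c\<in>C j. x i j c \<le> b j c))
        - (\<Prod>j\<in>{1..K}. avg n (\<lambda>i. of_bool (\<forall>c\<in>C j. x i j c \<le> b j c)))\<bar> \<longrightarrow>
     \<epsilon> \<le> RdCov2 K d h n x"
proof -
  \<comment> \<open>Each block is approximated up to 2\<eta>, one \<eta> from the hypothesis on the
    sample and one from the grid; \<open>K\<close> blocks make \<Delta>/8.\<close>
  define \<eta> where "\<eta> = \<Delta> / (16 * real K)"
  have \<eta>: "\<eta> > 0" using \<Delta> K by (simp add: \<eta>_def)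
  have "\<forall>j\<in>{1..K}. \<exists>k\<ge>1. \<exists>N\<ge>1. ranks_approximate_orthant (\<lambda>n. h n j) (d j) (C j) (b j) \<delta> M \<eta> k N"
  proof
    fix j assume j: "j \<in> {1..K}"
    show "\<exists>k\<ge>1. \<exists>N\<ge>1. ranks_approximate_orthant (\<lambda>n. h n j) (d j) (C j) (b j) \<delta> M \<eta> k N"
      using orthant_approx_by_ranks[OF d[OF j] C[OF j] \<delta> M \<eta> h weak[OF j], of "b j"] j by simp
  qed
  from bchoice[OF this] obtain k where k: "\<forall>j\<in>{1..K}. k j \<ge> 1 \<and> (\<exists>N\<ge>1. ranks_approximate_orthant (\<lambda>n. h n j) (d j) (C j) (b j) \<delta> M \<eta> (k j) N)" ..
  then have k1: "k j \<ge> 1" if "j \<in> {1..K}" for j using that by blast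
  from k have "\<forall>j\<in>{1..K}. \<exists>N\<ge>1. ranks_approximate_orthant (\<lambda>n. h n j) (d j) (C j) (b j) \<delta> M \<eta> (k j) N" by blast
  from bchoice[OF this] obtain N where N: "\<forall>j\<in>{1..K}. N j \<ge> 1 \<and> (ranks_approximate_orthant (\<lambda>n. h n j) (d j) (C j) (b j) \<delta> M \<eta> (k j) (N j))" ..
  define Q where "Q = (\<Pi>\<^sub>E j\<in>{1..K}. grid (d j) (k j))"
  have finQ: "finite Q" unfolding Q_def by (intro finite_PiE finite_grid) auto
  \<comment> \<open>Multiplying out the cell sums gives at most \<open>card Q\<close> products of
    bumps, each factoring up to \<kappa>; the total stays below \<Delta>/4.\<close>
  define \<kappa> where "\<kappa> = \<Delta> / (4 * (real (card Q) + 1))"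
  have \<kappa>: "\<kappa> > 0" using \<Delta> by (simp add: \<kappa>_def)
  have "\<exists>\<epsilon>>0. \<forall>n\<ge>1. \<forall>r.
     (blocks_in_cube K d n r) \<and>
     (\<forall>j\<in>{1..K-1}. block_dCov2 K d n r j < \<epsilon>) \<longrightarrow>
     \<bar>avg n (\<lambda>i. \<Prod>j\<in>{1..K}. bump (d j) (k j) (q j) (r i j))
        - (\<Prod>j\<in>{1..K}. avg n (\<lambda>i. bump (d j) (k j) (q j) (r i j)))\<bar> < \<kappa>" for q
    unfolding bump_def
    by (rule ranks_asymptotically_independent[where f = "\<lambda>j c t. tent (real (k j) * t - real (q j c))"])
       (use tent_range \<kappa> in \<open>auto intro!: continuous_intros\<close>)
  from choice[OF allI, OF this] obtain E where E: "\<forall>q. E q > 0 \<and> (\<forall>n\<ge>1. \<forall>r.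
     (blocks_in_cube K d n r) \<and>
     (\<forall>j\<in>{1..K-1}. block_dCov2 K d n r j < E q) \<longrightarrow>
     \<bar>avg n (\<lambda>i. \<Prod>j\<in>{1..K}. bump (d j) (k j) (q j) (r i j))
        - (\<Prod>j\<in>{1..K}. avg n (\<lambda>i. bump (d j) (k j) (q j) (r i j)))\<bar> < \<kappa>)" ..
  \<comment> \<open>The minimum runs over all of \<open>Q\<close>, because the cell sets
    \<open>S j\<close> are known only once the sample is.\<close>
  let ?\<epsilon> = "Min (insert 1 (E ` Q))"
  let ?N = "Max (insert 1 (N ` {1..K}))"
  have main: "?\<epsilon> \<le> RdCov2 K d h n x"
    if n: "n \<ge> ?N"
      and x: "\<forall>j\<in>{1..K}. avg n (\<lambda>i. of_bool (\<exists>c<d j. M < \<bar>x i j c\<bar>))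
        + (\<Sum>c\<in>C j. avg n (\<lambda>i. of_bool (b j c < x i j c \<and> x i j c < b j c + \<delta>))) \<le> \<eta>"
      and gap: "\<Delta> / 2 \<le> \<bar>avg n (\<lambda>i. of_bool (\<forall>j\<in>{1..K}. \<forall>c\<in>C j. x i j c \<le> b j c))
        - (\<Prod>j\<in>{1..K}. avg n (\<lambda>i. of_bool (\<forall>c\<in>C j. x i j c \<le> b j c)))\<bar>" for n x
  proof (rule ccontr)
    assume "\<not> ?\<epsilon> \<le> RdCov2 K d h n x"
    then have small: "RdCov2 K d h n x < ?\<epsilon>" by simp
    have "1 \<le> ?N" by (intro Max_ge) auto
    then have n1: "n \<ge> 1" using n by linarith
    have nN: "n \<ge> N j" if "j \<in> {1..K}" for j
    proof -
      have "N j \<le> ?N" using that by (intro Max_ge) auto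
      then show ?thesis using n by linarith
    qed
    define r where "r i j = emp_rank d h n x j i" for i j
    have r01: "r i j c \<in> {0..1}" if "i \<in> {1..n}" "j \<in> {1..K}" "c < d j" for i j c
      unfolding r_def using that h[OF n1] by (intro emp_rank_in_cube) auto
    have "\<forall>j\<in>{1..K}. \<exists>S. S \<subseteq> grid (d j) (k j) \<and>
       avg n (\<lambda>i. \<bar>of_bool (\<forall>c\<in>C j. x i j c \<le> b j c) - (\<Sum>q\<in>S. bump (d j) (k j) q (r i j))\<bar>) \<le> 2 * \<eta>"
    proof
      fix j assume j: "j \<in> {1..K}"
      have "\<exists>S\<subseteq>grid (d j) (k j). avg n (\<lambda>i. \<bar>of_bool (\<forall>c\<in>C j. x i j c \<le> b j c) - (\<Sum>q\<in>S. bump (d j) (k j) q (r i j))\<bar>)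
         \<le> avg n (\<lambda>i. of_bool (\<exists>c<d j. M < \<bar>x i j c\<bar>))
         + (\<Sum>c\<in>C j. avg n (\<lambda>i. of_bool (b j c < x i j c \<and> x i j c < b j c + \<delta>))) + \<eta>"
      proof (rule bspec[OF N j, THEN conjunct2, THEN spec, THEN mp, OF nN[OF j], THEN spec[of _ "\<lambda>i. x i j"],
          THEN spec[of _ "\<lambda>i. r i j"], THEN spec[of _ "opt_perm (d j) n (h n j) (\<lambda>i. x i j)"], THEN mp], intro conjI ballI)
        fix i l assume "i \<in> {1..n}" "l \<in> {1..n}"
        then show "0 \<le> (\<Sum>c<d j. (x i j c - x l j c) * (r i j c - r l j c))"
          unfolding r_def emp_rank_def by (rule opt_perm_monotone)
      qed (rule opt_perm_permutes, simp add: r_def emp_rank_def)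
      then obtain S where S: "S \<subseteq> grid (d j) (k j)"
        "avg n (\<lambda>i. \<bar>of_bool (\<forall>c\<in>C j. x i j c \<le> b j c) - (\<Sum>q\<in>S. bump (d j) (k j) q (r i j))\<bar>)
         \<le> avg n (\<lambda>i. of_bool (\<exists>c<d j. M < \<bar>x i j c\<bar>))
         + (\<Sum>c\<in>C j. avg n (\<lambda>i. of_bool (b j c < x i j c \<and> x i j c < b j c + \<delta>))) + \<eta>" by blast
      show "\<exists>S. S \<subseteq> grid (d j) (k j) \<and>
       avg n (\<lambda>i. \<bar>of_bool (\<forall>c\<in>C j. x i j c \<le> b j c) - (\<Sum>q\<in>S. bump (d j) (k j) q (r i j))\<bar>) \<le> 2 * \<eta>"
        using S bspec[OF x j] by (intro exI[of _ S] conjI) auto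
    qed
    from bchoice[OF this] obtain S where S: "\<And>j. j \<in> {1..K} \<Longrightarrow> S j \<subseteq> grid (d j) (k j)"
      and S': "\<And>j. j \<in> {1..K} \<Longrightarrow> avg n (\<lambda>i. \<bar>of_bool (\<forall>c\<in>C j. x i j c \<le> b j c) - (\<Sum>q\<in>S j. bump (d j) (k j) q (r i j))\<bar>) \<le> 2 * \<eta>"
      by blast
    define a where "a j i = (of_bool (\<forall>c\<in>C j. x i j c \<le> b j c) :: real)" for j i
    define g where "g j i = (\<Sum>q\<in>S j. bump (d j) (k j) q (r i j))" for j i
    have a01: "a j i \<in> {0..1}" for j i by (simp add: a_def)
    have g01: "g j i \<in> {0..1}" if "j \<in> {1..K}" "i \<in> {1..n}" for j i
      unfolding g_def using that r01 S k1 by (intro sum_bump_range) auto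
    have avg01: "avg n f \<in> {0..1}" if "\<And>i. i \<in> {1..n} \<Longrightarrow> f i \<in> {0..1}" for f
      using avg_nonneg[of n f] abs_avg_bound[of n f 1] that by fastforce
    have diff: "(\<Sum>j\<in>{1..K}. avg n (\<lambda>i. \<bar>a j i - g j i\<bar>)) \<le> \<Delta> / 8"
    proof -
      have "(\<Sum>j\<in>{1..K}. avg n (\<lambda>i. \<bar>a j i - g j i\<bar>)) \<le> (\<Sum>j\<in>{1..K}. 2 * \<eta>)"
        by (intro sum_mono) (use S' in \<open>simp add: a_def g_def\<close>)
      also have "\<dots> = \<Delta> / 8" using K by (simp add: \<eta>_def)
      finally show ?thesis .
    qed
    have d1: "\<bar>avg n (\<lambda>i. \<Prod>j\<in>{1..K}. a j i) - avg n (\<lambda>i. \<Prod>j\<in>{1..K}. g j i)\<bar> \<le> \<Delta> / 8"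
    proof -
      have "\<bar>avg n (\<lambda>i. \<Prod>j\<in>{1..K}. a j i) - avg n (\<lambda>i. \<Prod>j\<in>{1..K}. g j i)\<bar>
         \<le> avg n (\<lambda>i. \<bar>(\<Prod>j\<in>{1..K}. a j i) - (\<Prod>j\<in>{1..K}. g j i)\<bar>)"
        unfolding avg_diff[symmetric] by (rule avg_abs_le)
      also have "\<dots> \<le> avg n (\<lambda>i. \<Sum>j\<in>{1..K}. \<bar>a j i - g j i\<bar>)"
        by (intro avg_mono abs_prod_diff_le a01 g01)
      finally show ?thesis using diff by (simp add: avg_sum)
    qed
    have d2: "\<bar>(\<Prod>j\<in>{1..K}. avg n (a j)) - (\<Prod>j\<in>{1..K}. avg n (g j))\<bar> \<le> \<Delta> / 8"
    proof -
      have "\<bar>(\<Prod>j\<in>{1..K}. avg n (a j)) - (\<Prod>j\<in>{1..K}. avg n (g j))\<bar> \<le> (\<Sum>j\<in>{1..K}. \<bar>avg n (a j) - avg n (g j)\<bar>)"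
        by (intro abs_prod_diff_le avg01 a01 g01)
      also have "\<dots> \<le> (\<Sum>j\<in>{1..K}. avg n (\<lambda>i. \<bar>a j i - g j i\<bar>))"
        unfolding avg_diff[symmetric] by (intro sum_mono avg_abs_le)
      finally show ?thesis using diff by simp
    qed
    have d3: "\<bar>avg n (\<lambda>i. \<Prod>j\<in>{1..K}. g j i) - (\<Prod>j\<in>{1..K}. avg n (g j))\<bar> < \<Delta> / 4"
    proof -
      let ?P = "\<Pi>\<^sub>E j\<in>{1..K}. S j"
      have finS: "finite (S j)" if "j \<in> {1..K}" for j using S[OF that] finite_grid by (rule finite_subset)
      have PQ: "?P \<subseteq> Q" unfolding Q_def using S by (intro PiE_mono) auto
      have e1: "avg n (\<lambda>i. \<Prod>j\<in>{1..K}. g j i) = (\<Sum>q\<in>?P. avg n (\<lambda>i. \<Prod>j\<in>{1..K}. bump (d j) (k j) (q j) (r i j)))"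
        unfolding g_def using finS by (subst prod_sum_PiE) (auto simp: avg_sum)
      have e2: "(\<Prod>j\<in>{1..K}. avg n (g j)) = (\<Sum>q\<in>?P. \<Prod>j\<in>{1..K}. avg n (\<lambda>i. bump (d j) (k j) (q j) (r i j)))"
        unfolding g_def avg_sum using finS by (subst prod_sum_PiE) auto
      have "\<bar>avg n (\<lambda>i. \<Prod>j\<in>{1..K}. g j i) - (\<Prod>j\<in>{1..K}. avg n (g j))\<bar> \<le> (\<Sum>q\<in>?P. \<kappa>)"
        unfolding e1 e2 sum_subtractf[symmetric]
      proof (intro order_trans[OF sum_abs] sum_mono less_imp_le)
        fix q assume q: "q \<in> ?P"
        have le: "?\<epsilon> \<le> E q" using q PQ finQ by (intro Min_le) auto
        show "\<bar>avg n (\<lambda>i. \<Prod>j\<in>{1..K}. bump (d j) (k j) (q j) (r i j))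
            - (\<Prod>j\<in>{1..K}. avg n (\<lambda>i. bump (d j) (k j) (q j) (r i j)))\<bar> < \<kappa>"
        proof (rule E[THEN spec, THEN conjunct2, THEN spec, THEN mp, OF n1, THEN spec[of _ r], THEN mp], intro conjI ballI allI impI)
          fix j assume j: "j \<in> {1..K-1}"
          show "block_dCov2 K d n r j < E q"
            using rank_dCov2_le_RdCov2[OF n1 j, of d h x] small le
            unfolding r_def rank_dist_def[abs_def] rank_dist_plus_def[abs_def] by linarith
        qed (rule r01)
      qed
      also have "\<dots> = real (card ?P) * \<kappa>" by simp
      also have "\<dots> \<le> real (card Q) * \<kappa>" using \<kappa> card_mono[OF finQ PQ] by (intro mult_right_mono) auto
      also have "\<dots> < \<Delta> / 4" using \<Delta> by (simp add: \<kappa>_def field_simps)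
      finally show ?thesis .
    qed
    have "(\<Prod>j\<in>{1..K}. a j i) = of_bool (\<forall>j\<in>{1..K}. \<forall>c\<in>C j. x i j c \<le> b j c)" for i
      unfolding a_def by (auto simp: prod_zero_iff)
    then have "\<Delta> / 2 \<le> \<bar>avg n (\<lambda>i. \<Prod>j\<in>{1..K}. a j i) - (\<Prod>j\<in>{1..K}. avg n (a j))\<bar>"
      using gap by (simp add: a_def[abs_def])
    then show False using d1 d2 d3 by linarith
  qed
  have "?\<epsilon> > 0" using E finQ by (subst Min_gr_iff) auto
  moreover have "1 \<le> ?N" by (intro Max_ge) auto
  ultimately show ?thesis using main unfolding \<eta>_def by blast
qed

section \<open>Measurability and frequencies\<close>

text \<open>The set of minimisers is a measurable map into the finite power set of the permutations,
  and on that discrete space every selection is measurable, in particular the one made by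
  \<open>SOME\<close>.\<close>

lemma opt_perm_measurable:
  fixes Z :: "'a \<Rightarrow> nat \<Rightarrow> rvec"
  assumes Z[measurable]: "\<And>i c. i \<in> {1..n} \<Longrightarrow> c < m \<Longrightarrow> (\<lambda>\<omega>. Z \<omega> i c) \<in> borel_measurable M"
  shows "(\<lambda>\<omega>. opt_perm m n g (Z \<omega>)) \<in> measurable M (count_space UNIV)"
proof -
  let ?P = "{\<sigma>. \<sigma> permutes {1..n}}"
  let ?f = "\<lambda>\<omega> \<sigma>. \<Sum>i=1..n. (dist_Rn m (Z \<omega> i) (g (\<sigma> i)))\<^sup>2"
  let ?A = "\<lambda>\<omega>. {\<sigma> \<in> ?P. \<forall>\<tau>\<in>?P. \<not> ?f \<omega> \<tau> < ?f \<omega> \<sigma>}"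
  have f[measurable]: "(\<lambda>\<omega>. ?f \<omega> \<sigma>) \<in> borel_measurable M" for \<sigma>
    unfolding dist_Rn_square
    by (intro borel_measurable_sum borel_measurable_power borel_measurable_diff Z borel_measurable_const) auto
  have "?A \<in> measurable M (count_space (Pow ?P))"
    unfolding measurable_count_space_eq2[OF finite_Pow_iff[THEN iffD2, OF finite_perms]]
  proof (intro conjI ballI)
    show "?A \<in> space M \<rightarrow> Pow ?P" by auto
    fix W assume W: "W \<in> Pow ?P"
    have "?A -` {W} \<inter> space M = {\<omega> \<in> space M. \<forall>\<sigma>\<in>?P. (\<sigma> \<in> W) = (\<forall>\<tau>\<in>?P. \<not> ?f \<omega> \<tau> < ?f \<omega> \<sigma>)}"
      using W by blast
    also have "\<dots> \<in> sets M"
    proof (rule sets.sets_Collect_finite_All'[OF _ finite_perms perms_nonempty])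
      fix \<sigma> assume "\<sigma> \<in> ?P"
      have m: "{\<omega> \<in> space M. \<forall>\<tau>\<in>?P. \<not> ?f \<omega> \<tau> < ?f \<omega> \<sigma>} \<in> sets M"
        by (rule sets.sets_Collect_finite_All'[OF _ finite_perms perms_nonempty]) measurable
      show "{\<omega> \<in> space M. (\<sigma> \<in> W) = (\<forall>\<tau>\<in>?P. \<not> ?f \<omega> \<tau> < ?f \<omega> \<sigma>)} \<in> sets M"
      proof (cases "\<sigma> \<in> W")
        case True
        then show ?thesis using m by simp
      next
        case False
        then have "{\<omega> \<in> space M. (\<sigma> \<in> W) = (\<forall>\<tau>\<in>?P. \<not> ?f \<omega> \<tau> < ?f \<omega> \<sigma>)}
            = space M - {\<omega> \<in> space M. \<forall>\<tau>\<in>?P. \<not> ?f \<omega> \<tau> < ?f \<omega> \<sigma>}" by blast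
        then show ?thesis using m by simp
      qed
    qed
    finally show "?A -` {W} \<inter> space M \<in> sets M" .
  qed
  moreover have "(\<lambda>W. SOME \<sigma>. \<sigma> \<in> W) \<in> measurable (count_space (Pow ?P)) (count_space UNIV)"
    by simp
  ultimately have "(\<lambda>\<omega>. SOME \<sigma>. \<sigma> \<in> ?A \<omega>) \<in> measurable M (count_space UNIV)"
    by (rule measurable_compose)
  moreover have "opt_perm m n g (Z \<omega>) = (SOME \<sigma>. \<sigma> \<in> ?A \<omega>)" for \<omega>
    unfolding opt_perm_def arg_min_on_def arg_min_def is_arg_min_def by (rule arg_cong[of _ _ Eps]) auto
  ultimately show ?thesis by simp
qed

lemma component_measurable:
  assumes "j \<in> {1..K}" and "c < d j"
  shows "(\<lambda>x. x j c) \<in> borel_measurable (block_space K d)"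
proof -
  have "(\<lambda>x. x j) \<in> measurable (block_space K d) (lborel_Rn (d j))"
    unfolding block_space_def using assms(1) by (rule measurable_component_singleton)
  moreover have "(\<lambda>y. y c) \<in> borel_measurable (lborel_Rn (d j))"
    unfolding lborel_Rn_def using measurable_component_singleton[of c "{..<d j}" "\<lambda>_. lborel"] assms(2) by simp
  ultimately show ?thesis by (rule measurable_compose)
qed

lemma RdCov2_measurable:
  assumes X: "\<And>i. i \<in> {1..n} \<Longrightarrow> X i \<in> measurable M (block_space K d)"
  shows "(\<lambda>\<omega>. RdCov2 K d h n (\<lambda>i. X i \<omega>)) \<in> borel_measurable M"
proof -
  have e[measurable]: "(\<lambda>\<omega>. emp_rank d h n (\<lambda>i. X i \<omega>) j i c) \<in> borel_measurable M" if "j \<in> {1..K}" for j i c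
  proof -
    have "(\<lambda>\<omega>. opt_perm (d j) n (h n j) (\<lambda>i. X i \<omega> j)) \<in> measurable M (count_space UNIV)"
      by (rule opt_perm_measurable) (rule measurable_compose[OF X component_measurable[OF that]])
    then show ?thesis unfolding emp_rank_def
      by (rule measurable_compose[where g = "\<lambda>\<sigma>. h n j (\<sigma> i) c"]) simp
  qed
  have a: "(\<lambda>\<omega>. rank_dist d h n (\<lambda>i. X i \<omega>) j k l) \<in> borel_measurable M" if "j \<in> {1..K-1}" for j k l
    unfolding rank_dist_def dist_Rn_def L2_set_def
    by (intro borel_measurable_sqrt borel_measurable_sum borel_measurable_power borel_measurable_diff e
        borel_measurable_sqrt[THEN measurable_compose[rotated]]) (use that in auto)
  have b: "(\<lambda>\<omega>. rank_dist_plus K d h n (\<lambda>i. X i \<omega>) j k l) \<in> borel_measurable M" for j k l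
    unfolding rank_dist_plus_def L2_set_def
    by (intro borel_measurable_sqrt[THEN measurable_compose[rotated]] borel_measurable_sum borel_measurable_power)
       (auto intro!: borel_measurable_diff e)
  show ?thesis
    unfolding RdCov2_def dCov2_def
    by (intro borel_measurable_sum borel_measurable_diff borel_measurable_add borel_measurable_times
        borel_measurable_const a b)
qed

section \<open>Empirical frequencies and orthants\<close>

text \<open>Hoeffding's inequality for indicators gives the explicit bound 2 exp(-2 \<eta>^2
  n).\<close>

lemma weak_law_frequencies:
  assumes iid: "iid_from K d M {1..} X \<mu>" and E: "E \<in> sets (block_space K d)" and \<eta>: "\<eta> > 0"
  shows "(\<lambda>n. measure M {\<omega> \<in> space M. \<eta> \<le> \<bar>avg n (\<lambda>i. of_bool (X i \<omega> \<in> E)) - measure \<mu> E\<bar>}) \<longlonglongrightarrow> 0"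
proof -
  interpret prob_space M using iid by (simp add: iid_from_def)
  have indep: "indep_vars (\<lambda>_. block_space K d) X {1..}" and dist: "\<And>i. i \<ge> 1 \<Longrightarrow> distr M (block_space K d) (X i) = \<mu>"
    using iid by (auto simp: iid_from_def)
  have X: "X i \<in> measurable M (block_space K d)" if "i \<ge> 1" for i
    using indep that by (auto simp: indep_vars_def)
  have sets_\<mu>: "sets \<mu> = sets (block_space K d)" using dist[of 1] sets_distr[of M "block_space K d" "X 1"] by simp
  have ind: "(\<lambda>x. of_bool (x \<in> E) :: real) \<in> borel_measurable (block_space K d)"
  proof -
    have "(\<lambda>x. of_bool (x \<in> E) :: real) = indicator E" by (auto simp: fun_eq_iff indicator_def)
    then show ?thesis using borel_measurable_indicator[OF E] by simp
  qed
  have bound: "prob {\<omega> \<in> space M. \<eta> \<le> \<bar>avg n (\<lambda>i. of_bool (X i \<omega> \<in> E)) - measure \<mu> E\<bar>} \<le> 2 * exp (- (2 * \<eta>\<^sup>2) * real n)"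
    if n: "n \<ge> 1" for n
  proof -
    let ?Y = "\<lambda>i \<omega>. of_bool (X i \<omega> \<in> E) :: real"
    have ex: "expectation (?Y i) = measure \<mu> E" if "i \<in> {1..n}" for i
    proof -
      have "expectation (?Y i) = (\<integral>x. of_bool (x \<in> E) \<partial>distr M (block_space K d) (X i))"
        using that by (intro integral_distr[symmetric] X ind) auto
      also have "\<dots> = (\<integral>x. indicator E x \<partial>\<mu>)"
        using that by (simp only: dist atLeastAtMost_iff) (simp add: indicator_def of_bool_def)
      also have "\<dots> = measure \<mu> E"
        using sets.Int_space_eq2[of E \<mu>] E by (simp add: sets_\<mu>)
      finally show ?thesis .
    qed
    interpret H: Hoeffding_ineq M "{1..n}" ?Y "\<lambda>_. 0" "\<lambda>_. 1" "\<Sum>i\<in>{1..n}. expectation (?Y i)"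
    proof unfold_locales
      have "indep_vars (\<lambda>_. block_space K d) X {1..n}" using indep by (rule indep_vars_subset) auto
      then show "indep_vars (\<lambda>_. borel) ?Y {1..n}" by (rule indep_vars_compose2) (rule ind)
    qed auto
    have "prob {\<omega> \<in> space M. real n * \<eta> \<le> \<bar>(\<Sum>i=1..n. ?Y i \<omega>) - (\<Sum>i\<in>{1..n}. expectation (?Y i))\<bar>}
        \<le> 2 * exp (- 2 * (real n * \<eta>)\<^sup>2 / (\<Sum>i\<in>{1..n}. (1 - 0)\<^sup>2))"
      by (rule H.Hoeffding_ineq_abs_ge) (use n \<eta> in auto)
    also have "(\<Sum>i\<in>{1..n}. expectation (?Y i)) = real n * measure \<mu> E" by (simp add: ex)
    also have "{\<omega> \<in> space M. real n * \<eta> \<le> \<bar>(\<Sum>i=1..n. ?Y i \<omega>) - real n * measure \<mu> E\<bar>}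
       = {\<omega> \<in> space M. \<eta> \<le> \<bar>avg n (\<lambda>i. ?Y i \<omega>) - measure \<mu> E\<bar>}"
    proof (intro Collect_cong conj_cong refl)
      fix \<omega>
      have "(\<Sum>i=1..n. ?Y i \<omega>) - real n * measure \<mu> E = real n * (avg n (\<lambda>i. ?Y i \<omega>) - measure \<mu> E)"
        using n by (simp add: avg_def field_simps)
      then show "(real n * \<eta> \<le> \<bar>(\<Sum>i=1..n. ?Y i \<omega>) - real n * measure \<mu> E\<bar>) = (\<eta> \<le> \<bar>avg n (\<lambda>i. ?Y i \<omega>) - measure \<mu> E\<bar>)"
        using n by (simp add: abs_mult)
    qed
    also have "- 2 * (real n * \<eta>)\<^sup>2 / (\<Sum>i\<in>{1..n}. (1 - 0)\<^sup>2) = - (2 * \<eta>\<^sup>2) * real n"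
      using n by (simp add: power2_eq_square)
    finally show ?thesis .
  qed
  have "(\<lambda>n. 2 * exp (- (2 * \<eta>\<^sup>2) * real n)) \<longlonglongrightarrow> 2 * 0"
  proof (intro tendsto_mult_left)
    have "filterlim (\<lambda>n. (2 * \<eta>\<^sup>2) * real n) at_top sequentially"
      by (rule filterlim_tendsto_pos_mult_at_top[OF tendsto_const _ filterlim_real_sequentially]) (use \<eta> in simp)
    then have "filterlim (\<lambda>n. - (2 * \<eta>\<^sup>2) * real n) at_bot sequentially"
      by (simp add: filterlim_uminus_at_top)
    then show "(\<lambda>n. exp (- (2 * \<eta>\<^sup>2) * real n)) \<longlonglongrightarrow> 0"
      by (rule filterlim_compose[OF exp_at_bot])
  qed
  then have lim: "(\<lambda>n. 2 * exp (- (2 * \<eta>\<^sup>2) * real n)) \<longlonglongrightarrow> 0" by simp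
  show ?thesis
    by (rule tendsto_sandwich[OF _ _ tendsto_const lim])
       (use bound in \<open>auto simp: eventually_sequentially intro!: exI[of _ 1]\<close>)
qed

text \<open>\<open>C\<close> lists the constrained coordinates. Unbounded directions are encoded by
  omission, so that the whole space (\<open>C = {}\<close>) belongs to the family without infinite
  thresholds.\<close>

definition orthant :: "nat \<Rightarrow> (nat \<Rightarrow> nat) \<Rightarrow> nat \<Rightarrow> nat set \<Rightarrow> (nat \<Rightarrow> real) \<Rightarrow> blocks set" where
  "orthant K d j C b = {x \<in> space (block_space K d). \<forall>c\<in>C. x j c \<le> b c}"

lemma orthant_sets:
  assumes "j \<in> {1..K}" "C \<subseteq> {..<d j}"
  shows "orthant K d j C b \<in> sets (block_space K d)"
proof (cases "C = {}")
  case False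
  have "finite C" using assms(2) by (rule finite_subset) simp
  moreover have "{x \<in> space (block_space K d). x j c \<le> b c} \<in> sets (block_space K d)" if "c \<in> C" for c
    using component_measurable[OF assms(1), of c] that assms(2) unfolding borel_measurable_iff_le by blast
  ultimately show ?thesis unfolding orthant_def using False by (intro sets.sets_Collect_finite_All') auto
qed (simp add: orthant_def)

text \<open>If all orthant probabilities factored, the blocks would be independent, since the
  orthants of one block form an intersection-stable generator of its sigma-algebra; the law would
  then be the product of its marginals.\<close>

lemma not_H0_orthants:
  assumes "prob_space \<mu>" and sets_\<mu>: "sets \<mu> = sets (block_space K d)" and K: "K \<ge> 1" and H: "\<not> H0 K d \<mu>"
  obtains C b where "\<And>j. j \<in> {1..K} \<Longrightarrow> C j \<subseteq> {..<d j}"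
    and "measure \<mu> (\<Inter>j\<in>{1..K}. orthant K d j (C j) (b j)) \<noteq> (\<Prod>j\<in>{1..K}. measure \<mu> (orthant K d j (C j) (b j)))"
proof (rule ccontr)
  assume "\<not> thesis"
  with that have factor: "measure \<mu> (\<Inter>j\<in>{1..K}. orthant K d j (C j) (b j)) = (\<Prod>j\<in>{1..K}. measure \<mu> (orthant K d j (C j) (b j)))"
    if "\<And>j. j \<in> {1..K} \<Longrightarrow> C j \<subseteq> {..<d j}" for C b using that by blast
  interpret prob_space \<mu> by fact
  have sp: "space \<mu> = space (block_space K d)" using sets_\<mu> by (rule sets_eq_imp_space_eq)
  let ?F = "\<lambda>j. {orthant K d j C b | C b. C \<subseteq> {..<d j}}"
  have ev: "?F j \<subseteq> events" if "j \<in> {1..K}" for j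
    using orthant_sets[OF that] by (auto simp: sets_\<mu>)
  have "indep_sets ?F {1..K}"
  proof (subst indep_sets_finite)
    \<comment> \<open>As each family contains the whole space, factorisation over the full index set
      also covers the smaller ones.\<close>
    show "space \<mu> \<in> ?F j" for j
      by (auto simp: sp orthant_def intro!: exI[of _ "{}"])
    show "\<forall>A\<in>Pi {1..K} ?F. prob (\<Inter>j\<in>{1..K}. A j) = (\<Prod>j\<in>{1..K}. prob (A j))"
    proof
      fix A assume A: "A \<in> Pi {1..K} ?F"
      have "\<forall>j\<in>{1..K}. \<exists>p. A j = orthant K d j (fst p) (snd p) \<and> fst p \<subseteq> {..<d j}"
        using A by (fastforce simp: Pi_iff)
      from bchoice[OF this] obtain p where p: "\<And>j. j \<in> {1..K} \<Longrightarrow> A j = orthant K d j (fst (p j)) (snd (p j)) \<and> fst (p j) \<subseteq> {..<d j}" by blast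
      then have e1: "(\<Inter>j\<in>{1..K}. A j) = (\<Inter>j\<in>{1..K}. orthant K d j (fst (p j)) (snd (p j)))"
        by (intro INF_cong) auto
      have e2: "(\<Prod>j\<in>{1..K}. prob (A j)) = (\<Prod>j\<in>{1..K}. prob (orthant K d j (fst (p j)) (snd (p j))))"
        using p by (intro prod.cong) auto
      show "prob (\<Inter>j\<in>{1..K}. A j) = (\<Prod>j\<in>{1..K}. prob (A j))"
        unfolding e1 e2 using p by (intro factor) auto
    qed
  qed (use K ev in auto)
  moreover have "Int_stable (?F j)" for j
  proof (rule Int_stableI)
    fix A B assume "A \<in> ?F j" "B \<in> ?F j"
    then obtain C b C' b' where AB: "A = orthant K d j C b" "B = orthant K d j C' b'" "C \<subseteq> {..<d j}" "C' \<subseteq> {..<d j}" by auto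
    have "A \<inter> B = orthant K d j (C \<union> C') (\<lambda>c. if c \<in> C \<inter> C' then min (b c) (b' c) else if c \<in> C then b c else b' c)"
      unfolding AB orthant_def by (auto split: if_splits)
    then show "A \<inter> B \<in> ?F j" using AB by blast
  qed
  ultimately have ind: "indep_sets (\<lambda>j. sigma_sets (space \<mu>) (?F j)) {1..K}"
    by (rule indep_sets_sigma)
  have rv: "(\<lambda>x. x j) \<in> measurable \<mu> (lborel_Rn (d j))" if "j \<in> {1..K}" for j
    unfolding measurable_cong_sets[OF sets_\<mu> refl] block_space_def by (rule measurable_component_singleton[OF that])
  have "indep_vars (\<lambda>j. lborel_Rn (d j)) (\<lambda>j x. x j) {1..K}"
    unfolding indep_vars_def2
  proof (intro conjI ballI rv)
    show "indep_sets (\<lambda>j. {(\<lambda>x. x j) -` A \<inter> space \<mu> | A. A \<in> sets (lborel_Rn (d j))}) {1..K}"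
    proof (rule indep_sets_mono_sets[OF ind])
      fix j assume j: "j \<in> {1..K}"
      let ?S = "sigma (space \<mu>) (?F j)"
      have sub: "?F j \<subseteq> Pow (space \<mu>)" using ev[OF j] sets.space_closed by blast
      have "(\<lambda>x. x j) \<in> measurable ?S (lborel_Rn (d j))"
        unfolding lborel_Rn_def
      proof (rule measurable_PiM_single')
        fix c assume c: "c \<in> {..<d j}"
        have "(\<lambda>x. x j c) \<in> borel_measurable ?S"
          unfolding borel_measurable_iff_le
        proof
          fix a
          have "{x \<in> space ?S. x j c \<le> a} = orthant K d j {c} (\<lambda>_. a)"
            unfolding space_measure_of[OF sub] unfolding sp orthant_def by simp
          then show "{x \<in> space ?S. x j c \<le> a} \<in> sets ?S"
            using c sub by (auto simp: sets_measure_of intro!: sigma_sets.Basic)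
        qed
        then show "(\<lambda>x. x j c) \<in> measurable ?S lborel" by simp
      next
        show "(\<lambda>x i. x j i) \<in> space ?S \<rightarrow> {..<d j} \<rightarrow>\<^sub>E space lborel"
          using measurable_space[OF rv[OF j]] sub by (auto simp: lborel_Rn_def space_PiM)
      qed
      from measurable_sets[OF this] show "{(\<lambda>x. x j) -` A \<inter> space \<mu> | A. A \<in> sets (lborel_Rn (d j))} \<subseteq> sigma_sets (space \<mu>) (?F j)"
        using sub by (auto simp: sets_measure_of)
    qed
  qed
  then have "distr \<mu> (\<Pi>\<^sub>M j\<in>{1..K}. lborel_Rn (d j)) (\<lambda>x. \<lambda>j\<in>{1..K}. x j) = (\<Pi>\<^sub>M j\<in>{1..K}. distr \<mu> (lborel_Rn (d j)) (\<lambda>x. x j))"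
    using K rv by (subst (asm) indep_vars_iff_distr_eq_PiM') auto
  \<comment> \<open>Points of \<open>block_space\<close> are extensional on \<open>{1..K}\<close>,
    so the restriction is the identity.\<close>
  moreover have "distr \<mu> (\<Pi>\<^sub>M j\<in>{1..K}. lborel_Rn (d j)) (\<lambda>x. \<lambda>j\<in>{1..K}. x j) = \<mu>"
  proof -
    have "distr \<mu> (block_space K d) (\<lambda>x. \<lambda>j\<in>{1..K}. x j) = distr \<mu> \<mu> (\<lambda>x. x)"
    proof (rule distr_cong)
      fix x assume "x \<in> space \<mu>"
      then show "(\<lambda>j\<in>{1..K}. x j) = x" by (auto simp: sp block_space_def space_PiM PiE_iff)
    qed (simp_all add: sets_\<mu>)
    then show ?thesis by (simp add: block_space_def distr_id)
  qed
  ultimately show False using H by (simp add: H0_def marginal_def)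
qed

text \<open>Continuity from above, summed over finitely many coordinates. It serves for the tails
  beyond \<open>n\<close> and for the thin strips above the thresholds.\<close>

lemma vanishing_coordinate_sets:
  assumes "prob_space \<mu>" and sets_\<mu>: "sets \<mu> = sets (block_space K d)"
    and S: "\<And>n j c. S n j c \<in> sets borel" and dec: "\<And>j c. decseq (\<lambda>n. S n j c)"
    and empty: "\<And>j c. (\<Inter>n. S n j c) = {}" and \<theta>: "\<theta> > 0"
  obtains n where "{x \<in> space (block_space K d). \<exists>j\<in>{1..K}. \<exists>c<d j. x j c \<in> S n j c} \<in> sets (block_space K d)"
    and "measure \<mu> {x \<in> space (block_space K d). \<exists>j\<in>{1..K}. \<exists>c<d j. x j c \<in> S n j c} < \<theta>"
proof -
  interpret prob_space \<mu> by fact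
  let ?B = "block_space K d"
  have sp: "space \<mu> = space ?B" using sets_\<mu> by (rule sets_eq_imp_space_eq)
  define I where "I = (SIGMA j:{1..K}. {..<d j})"
  have finI: "finite I" by (auto simp: I_def)
  define A where "A n p = {x \<in> space ?B. x (fst p) (snd p) \<in> S n (fst p) (snd p)}" for n p
  have mA: "A n p \<in> events" if "p \<in> I" for n p
  proof -
    have "(\<lambda>x. x (fst p) (snd p)) -` S n (fst p) (snd p) \<inter> space ?B \<in> sets ?B"
      by (rule measurable_sets[OF component_measurable S]) (use that in \<open>auto simp: I_def\<close>)
    moreover have "(\<lambda>x. x (fst p) (snd p)) -` S n (fst p) (snd p) \<inter> space ?B = A n p" by (auto simp: A_def)
    ultimately show ?thesis by (simp add: sets_\<mu>)
  qed
  have U: "{x \<in> space ?B. \<exists>j\<in>{1..K}. \<exists>c<d j. x j c \<in> S n j c} = (\<Union>p\<in>I. A n p)" for n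
    by (force simp: A_def I_def)
  have "(\<lambda>n. prob (A n p)) \<longlonglongrightarrow> 0" if p: "p \<in> I" for p
  proof -
    have "(\<lambda>n. prob (A n p)) \<longlonglongrightarrow> prob (\<Inter>n. A n p)"
    proof (rule finite_Lim_measure_decseq)
      show "range (\<lambda>n. A n p) \<subseteq> events" using mA[OF p] by auto
      show "decseq (\<lambda>n. A n p)" using dec unfolding decseq_def A_def by blast
    qed
    moreover have "(\<Inter>n. A n p) = {}"
      using empty[of "fst p" "snd p"] unfolding A_def by blast
    ultimately show ?thesis by simp
  qed
  then have "(\<lambda>n. \<Sum>p\<in>I. prob (A n p)) \<longlonglongrightarrow> (\<Sum>p\<in>I. 0)" by (intro tendsto_sum)
  then have "\<forall>\<^sub>F n in sequentially. (\<Sum>p\<in>I. prob (A n p)) < \<theta>" using \<theta> by (auto dest: order_tendstoD)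
  then obtain n where n: "(\<Sum>p\<in>I. prob (A n p)) < \<theta>" by (auto simp: eventually_sequentially)
  have "prob (\<Union>p\<in>I. A n p) \<le> (\<Sum>p\<in>I. prob (A n p))"
    by (rule finite_measure_subadditive_finite[OF finI]) (use mA in auto)
  with n have "prob (\<Union>p\<in>I. A n p) < \<theta>" by linarith
  moreover have "(\<Union>p\<in>I. A n p) \<in> events" using mA finI by auto
  ultimately show ?thesis using that[of n] unfolding U by (simp add: sets_\<mu>)
qed

lemma avg_of_bool_mono:
  "(\<And>i. i \<in> {1..n} \<Longrightarrow> P i \<Longrightarrow> Q i) \<Longrightarrow> avg n (\<lambda>i. of_bool (P i)) \<le> avg n (\<lambda>i. of_bool (Q i))"
  by (intro avg_mono) auto

text \<open>The conditions of \<open>RdCov2_bounded_below\<close> follow once the frequencies of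
  finitely many events are within \<theta> of their probabilities, and this happens with probability
  tending to 1.\<close>

lemma RdCov2_bounded_below_in_probability:
  fixes K :: nat and d :: "nat \<Rightarrow> nat" and h :: "nat \<Rightarrow> nat \<Rightarrow> nat \<Rightarrow> rvec"
  assumes K: "K \<ge> 1" and d: "\<And>j. j \<in> {1..K} \<Longrightarrow> d j \<ge> 1"
    and h: "\<And>n j. n \<ge> 1 \<Longrightarrow> j \<in> {1..K} \<Longrightarrow> h n j ` {1..n} \<subseteq> unit_cube (d j)"
    and weak: "\<And>j. j \<in> {1..K} \<Longrightarrow> weak_conv_Rn (d j) (\<lambda>n. empirical_distr (d j) n (h n j)) (unif_cube (d j))"
    and iid: "iid_from K d M {1..} X \<mu>" and H: "\<not> H0 K d \<mu>"
  shows "\<exists>\<epsilon>>0. (\<lambda>n. measure M {\<omega> \<in> space M. \<epsilon> \<le> RdCov2 K d h n (\<lambda>i. X i \<omega>)}) \<longlonglongrightarrow> 1"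
proof -
  let ?B = "block_space K d"
  interpret prob_space M using iid by (simp add: iid_from_def)
  have X: "X i \<in> measurable M ?B" if "i \<ge> 1" for i
    using iid that by (auto simp: iid_from_def indep_vars_def)
  have dist: "distr M ?B (X 1) = \<mu>" using iid by (auto simp: iid_from_def)
  have p\<mu>: "prob_space \<mu>" unfolding dist[symmetric] using X by (intro prob_space_distr) auto
  have sets_\<mu>: "sets \<mu> = sets ?B" unfolding dist[symmetric] by simp
  interpret \<mu>: prob_space \<mu> by (rule p\<mu>)
  obtain C b where C: "\<And>j. j \<in> {1..K} \<Longrightarrow> C j \<subseteq> {..<d j}"
    and gap: "measure \<mu> (\<Inter>j\<in>{1..K}. orthant K d j (C j) (b j)) \<noteq> (\<Prod>j\<in>{1..K}. measure \<mu> (orthant K d j (C j) (b j)))"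
    using not_H0_orthants[OF p\<mu> sets_\<mu> K H] by blast
  let ?E = "\<lambda>j. orthant K d j (C j) (b j)" and ?Eall = "\<Inter>j\<in>{1..K}. orthant K d j (C j) (b j)"
  define \<Delta> where "\<Delta> = \<bar>measure \<mu> ?Eall - (\<Prod>j\<in>{1..K}. measure \<mu> (?E j))\<bar>"
  have \<Delta>: "\<Delta> > 0" using gap by (simp add: \<Delta>_def)
  define D where "D = (\<Sum>j=1..K. d j)"
  \<comment> \<open>In each block at most \<open>1 + D\<close> exceptional frequencies are added,
    each at most 2\<theta>, and 2\<theta>(1 + D) is the permitted \<Delta>/(16K).\<close>
  define \<theta> where "\<theta> = \<Delta> / (32 * real K * (1 + real D))"
  have \<theta>: "\<theta> > 0" using \<Delta> K by (simp add: \<theta>_def add_pos_nonneg)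
  obtain n1 where n1: "{x \<in> space ?B. \<exists>j\<in>{1..K}. \<exists>c<d j. x j c \<in> {t. real n1 < \<bar>t\<bar>}} \<in> sets ?B"
    "measure \<mu> {x \<in> space ?B. \<exists>j\<in>{1..K}. \<exists>c<d j. x j c \<in> {t. real n1 < \<bar>t\<bar>}} < \<theta>"
  proof (rule vanishing_coordinate_sets[OF p\<mu> sets_\<mu> _ _ _ \<theta>, where S = "\<lambda>n j c. {t. real n < \<bar>t\<bar>}"])
    show "decseq (\<lambda>n. {t::real. real n < \<bar>t\<bar>})" for j c :: nat by (auto simp: decseq_def)
    show "(\<Inter>n. {t::real. real n < \<bar>t\<bar>}) = {}" for j c :: nat
    proof -
      have "\<exists>n. \<not> real n < \<bar>t\<bar>" for t :: real
        using reals_Archimedean2[of "\<bar>t\<bar>"] by (meson less_asym)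
      then show ?thesis by auto
    qed
    show "{t::real. real n < \<bar>t\<bar>} \<in> sets borel" for n and j c :: nat by measurable
  qed (rule that)
  \<comment> \<open>The strips are open at the threshold, so they shrink to the empty set even if
    the face itself carries mass.\<close>
  let ?S = "\<lambda>n j c. if c \<in> C j then {b j c <..< b j c + 1 / (real n + 1)} else {}"
  obtain n2 where n2: "{x \<in> space ?B. \<exists>j\<in>{1..K}. \<exists>c<d j. x j c \<in> ?S n2 j c} \<in> sets ?B"
    "measure \<mu> {x \<in> space ?B. \<exists>j\<in>{1..K}. \<exists>c<d j. x j c \<in> ?S n2 j c} < \<theta>"
  proof (rule vanishing_coordinate_sets[OF p\<mu> sets_\<mu> _ _ _ \<theta>, where S = ?S])
    show "decseq (\<lambda>n. ?S n j c)" for j c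
    proof -
      have "1 / (real n + 1) \<le> 1 / (real m + 1)" if "m \<le> n" for m n using that by (simp add: frac_le)
      then show ?thesis unfolding decseq_def by (fastforce split: if_splits)
    qed
    show "(\<Inter>n. ?S n j c) = {}" for j c
    proof (rule ccontr)
      assume "(\<Inter>n. ?S n j c) \<noteq> {}"
      then obtain t where t: "\<And>n. t \<in> ?S n j c" by blast
      then have c: "c \<in> C j" by (metis empty_iff)
      have "0 < t - b j c" using t[of 0] c by simp
      then obtain n where "inverse (real (Suc n)) < t - b j c" using reals_Archimedean by blast
      then show False using t[of n] c by (simp add: inverse_eq_divide add.commute)
    qed
    show "?S n j c \<in> sets borel" for n j c by simp
  qed (rule that)
  let ?M = "real n1" and ?\<delta> = "1 / (real n2 + 1)"
  let ?Big = "{x \<in> space ?B. \<exists>j\<in>{1..K}. \<exists>c<d j. x j c \<in> {t. real n1 < \<bar>t\<bar>}}"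
  let ?Str = "{x \<in> space ?B. \<exists>j\<in>{1..K}. \<exists>c<d j. x j c \<in> ?S n2 j c}"
  let ?Low = "\<lambda>\<epsilon> N. \<forall>n\<ge>N. \<forall>x.
     (\<forall>j\<in>{1..K}. avg n (\<lambda>i. of_bool (\<exists>c<d j. ?M < \<bar>x i j c\<bar>))
        + (\<Sum>c\<in>C j. avg n (\<lambda>i. of_bool (b j c < x i j c \<and> x i j c < b j c + ?\<delta>))) \<le> \<Delta> / (16 * real K)) \<and>
     \<Delta> / 2 \<le> \<bar>avg n (\<lambda>i. of_bool (\<forall>j\<in>{1..K}. \<forall>c\<in>C j. x i j c \<le> b j c))
        - (\<Prod>j\<in>{1..K}. avg n (\<lambda>i. of_bool (\<forall>c\<in>C j. x i j c \<le> b j c)))\<bar> \<longrightarrow>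
     \<epsilon> \<le> RdCov2 K d h n x"
  have "\<exists>\<epsilon>>0. \<exists>N\<ge>1. ?Low \<epsilon> N"
    by (rule RdCov2_bounded_below, rule K, erule d, erule (1) h, erule weak, erule C, simp, simp, rule \<Delta>)
  then obtain \<epsilon> N where \<epsilon>: "\<epsilon> > 0" and N: "N \<ge> 1" and low: "?Low \<epsilon> N" by blast
  define \<E> where "\<E> = {?Eall, ?Big, ?Str} \<union> ?E ` {1..K}"
  have fin\<E>: "finite \<E>" by (simp add: \<E>_def)
  have E: "?E j \<in> sets ?B" if "j \<in> {1..K}" for j by (rule orthant_sets[OF that]) (rule C[OF that])
  have s\<E>: "A \<in> sets ?B" if "A \<in> \<E>" for A
  proof -
    have "?Eall \<in> sets ?B" using K by (intro sets.finite_INT E) auto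
    then show ?thesis using that n1(1) n2(1) E unfolding \<E>_def
      by (elim UnE insertE emptyE imageE) (simp_all only:)
  qed
  define bad where "bad n A = {\<omega> \<in> space M. \<theta> \<le> \<bar>avg n (\<lambda>i. of_bool (X i \<omega> \<in> A)) - measure \<mu> A\<bar>}" for n A
  have mbad: "bad n A \<in> events" if "A \<in> \<E>" for n A
  proof -
    have "(\<lambda>\<omega>. of_bool (X i \<omega> \<in> A) :: real) \<in> borel_measurable M" if "i \<in> {1..n}" for i
    proof -
      have "(\<lambda>\<omega>. of_bool (X i \<omega> \<in> A) :: real) = (\<lambda>\<omega>. indicator A (X i \<omega>))" by (auto simp: indicator_def)
      moreover have "(\<lambda>\<omega>. indicator A (X i \<omega>) :: real) \<in> borel_measurable M"
        using that by (intro measurable_compose[OF X borel_measurable_indicator[OF s\<E>[OF \<open>A \<in> \<E>\<close>]]]) auto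
      ultimately show ?thesis by simp
    qed
    then have [measurable]: "(\<lambda>\<omega>. avg n (\<lambda>i. of_bool (X i \<omega> \<in> A))) \<in> borel_measurable M"
      unfolding avg_def by (intro borel_measurable_divide borel_measurable_sum borel_measurable_const)
    show ?thesis unfolding bad_def by measurable
  qed
  have good: "\<epsilon> \<le> RdCov2 K d h n (\<lambda>i. X i \<omega>)"
    if n: "n \<ge> N" and \<omega>: "\<omega> \<in> space M" and nb: "\<And>A. A \<in> \<E> \<Longrightarrow> \<omega> \<notin> bad n A" for n \<omega>
  proof (rule low[THEN spec, THEN mp, OF n, THEN spec, THEN mp], intro conjI ballI)
    have near: "\<bar>avg n (\<lambda>i. of_bool (X i \<omega> \<in> A)) - measure \<mu> A\<bar> < \<theta>" if "A \<in> \<E>" for A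
      using nb[OF that] \<omega> by (auto simp: bad_def)
    have spX: "X i \<omega> \<in> space ?B" if "i \<in> {1..n}" for i
      using measurable_space[OF X \<omega>] that by auto
    have n1': "n \<ge> 1" using n N by linarith
    have big: "avg n (\<lambda>i. of_bool (X i \<omega> \<in> ?Big)) \<le> 2 * \<theta>"
      using near[of ?Big] n1(2) by (auto simp: \<E>_def abs_less_iff)
    have str: "avg n (\<lambda>i. of_bool (X i \<omega> \<in> ?Str)) \<le> 2 * \<theta>"
      using near[of ?Str] n2(2) by (auto simp: \<E>_def abs_less_iff)
    fix j assume j: "j \<in> {1..K}"
    have cC: "card (C j) \<le> D"
    proof -
      have "card (C j) \<le> d j" using card_mono[OF _ C[OF j]] by simp
      also have "d j \<le> D" unfolding D_def using j by (intro member_le_sum) auto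
      finally show ?thesis .
    qed
    have "avg n (\<lambda>i. of_bool (\<exists>c<d j. ?M < \<bar>X i \<omega> j c\<bar>)) \<le> avg n (\<lambda>i. of_bool (X i \<omega> \<in> ?Big))"
      by (rule avg_of_bool_mono) (use spX j in auto)
    moreover have "avg n (\<lambda>i. of_bool (b j c < X i \<omega> j c \<and> X i \<omega> j c < b j c + ?\<delta>)) \<le> 2 * \<theta>" if c: "c \<in> C j" for c
    proof (rule order_trans[OF avg_of_bool_mono str])
      fix i assume i: "i \<in> {1..n}" and s: "b j c < X i \<omega> j c \<and> X i \<omega> j c < b j c + ?\<delta>"
      have "X i \<omega> j c \<in> ?S n2 j c" using s c by simp
      moreover have "c < d j" using c C[OF j] by auto
      ultimately show "X i \<omega> \<in> ?Str" using spX[OF i] j by blast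
    qed
    then have "(\<Sum>c\<in>C j. avg n (\<lambda>i. of_bool (b j c < X i \<omega> j c \<and> X i \<omega> j c < b j c + ?\<delta>))) \<le> real (card (C j)) * (2 * \<theta>)"
      by (rule sum_bounded_above)
    moreover have "real (card (C j)) * (2 * \<theta>) \<le> real D * (2 * \<theta>)" using cC \<theta> by (intro mult_right_mono) auto
    moreover have "2 * \<theta> + real D * (2 * \<theta>) = \<Delta> / (16 * real K)"
    proof -
      have "2 * \<theta> + real D * (2 * \<theta>) = (1 + real D) * (2 * \<theta>)" by (simp add: algebra_simps)
      also have "\<dots> = \<Delta> / (16 * real K)" unfolding \<theta>_def using K by (simp add: divide_simps add_pos_nonneg)
      finally show ?thesis .
    qed
    ultimately show "avg n (\<lambda>i. of_bool (\<exists>c<d j. ?M < \<bar>X i \<omega> j c\<bar>))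
        + (\<Sum>c\<in>C j. avg n (\<lambda>i. of_bool (b j c < X i \<omega> j c \<and> X i \<omega> j c < b j c + ?\<delta>))) \<le> \<Delta> / (16 * real K)"
      using big by linarith
  next
    have near: "\<bar>avg n (\<lambda>i. of_bool (X i \<omega> \<in> A)) - measure \<mu> A\<bar> < \<theta>" if "A \<in> \<E>" for A
      using nb[OF that] \<omega> by (auto simp: bad_def)
    have spX: "X i \<omega> \<in> space ?B" if "i \<in> {1..n}" for i
      using measurable_space[OF X \<omega>] that by auto
    have e0: "avg n (\<lambda>i. of_bool (\<forall>j\<in>{1..K}. \<forall>c\<in>C j. X i \<omega> j c \<le> b j c)) = avg n (\<lambda>i. of_bool (X i \<omega> \<in> ?Eall))"
      by (rule avg_cong) (use spX K in \<open>auto simp: orthant_def\<close>)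
    have ej: "avg n (\<lambda>i. of_bool (\<forall>c\<in>C j. X i \<omega> j c \<le> b j c)) = avg n (\<lambda>i. of_bool (X i \<omega> \<in> ?E j))" for j
      by (rule avg_cong) (use spX in \<open>auto simp: orthant_def\<close>)
    have a01: "avg n (\<lambda>i. of_bool (P i)) \<in> {0..1}" for P
      using avg_nonneg[of n "\<lambda>i. of_bool (P i)"] abs_avg_bound[of n "\<lambda>i. of_bool (P i)" 1] by fastforce
    have "\<bar>(\<Prod>j\<in>{1..K}. avg n (\<lambda>i. of_bool (X i \<omega> \<in> ?E j))) - (\<Prod>j\<in>{1..K}. measure \<mu> (?E j))\<bar>
        \<le> (\<Sum>j\<in>{1..K}. \<bar>avg n (\<lambda>i. of_bool (X i \<omega> \<in> ?E j)) - measure \<mu> (?E j)\<bar>)"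
      by (rule abs_prod_diff_le[OF a01]) auto
    also have "\<dots> \<le> (\<Sum>j\<in>{1..K}. \<theta>)" by (intro sum_mono less_imp_le near) (auto simp: \<E>_def)
    also have "\<dots> = real K * \<theta>" by simp
    finally have p: "\<bar>(\<Prod>j\<in>{1..K}. avg n (\<lambda>i. of_bool (X i \<omega> \<in> ?E j))) - (\<Prod>j\<in>{1..K}. measure \<mu> (?E j))\<bar> \<le> real K * \<theta>" .
    have q: "\<bar>avg n (\<lambda>i. of_bool (X i \<omega> \<in> ?Eall)) - measure \<mu> ?Eall\<bar> < \<theta>" by (rule near) (simp add: \<E>_def)
    \<comment> \<open>The joint frequency is off by \<theta> and the product by \<open>K\<close>
      times \<theta>, so at least half of the true gap \<Delta> survives in the sample.\<close>
    have "\<theta> + real K * \<theta> \<le> \<Delta> / 2"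
    proof -
      have "\<theta> \<le> \<Delta> / (32 * real K)" unfolding \<theta>_def using \<Delta> K by (intro divide_left_mono) auto
      then have "real K * \<theta> \<le> real K * (\<Delta> / (32 * real K))" by (intro mult_left_mono) auto
      also have "\<dots> = \<Delta> / 32" using K by simp
      finally have 1: "real K * \<theta> \<le> \<Delta> / 32" .
      have "1 * \<theta> \<le> real K * \<theta>" using K \<theta> by (intro mult_right_mono) auto
      then show ?thesis using 1 \<Delta> by linarith
    qed
    then show "\<Delta> / 2 \<le> \<bar>avg n (\<lambda>i. of_bool (\<forall>j\<in>{1..K}. \<forall>c\<in>C j. X i \<omega> j c \<le> b j c))
        - (\<Prod>j\<in>{1..K}. avg n (\<lambda>i. of_bool (\<forall>c\<in>C j. X i \<omega> j c \<le> b j c)))\<bar>"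
      unfolding e0 ej using p q \<Delta>_def by linarith
  qed
  have lb: "1 - (\<Sum>A\<in>\<E>. prob (bad n A)) \<le> prob {\<omega> \<in> space M. \<epsilon> \<le> RdCov2 K d h n (\<lambda>i. X i \<omega>)}" if n: "n \<ge> N" for n
  proof -
    have [measurable]: "(\<lambda>\<omega>. RdCov2 K d h n (\<lambda>i. X i \<omega>)) \<in> borel_measurable M"
      by (rule RdCov2_measurable) (rule X, simp)
    have "prob (\<Union>A\<in>\<E>. bad n A) \<le> (\<Sum>A\<in>\<E>. prob (bad n A))"
      by (rule finite_measure_subadditive_finite[OF fin\<E>]) (use mbad in auto)
    moreover have "prob (space M - (\<Union>A\<in>\<E>. bad n A)) = 1 - prob (\<Union>A\<in>\<E>. bad n A)"
      by (rule prob_compl) (use mbad fin\<E> in auto)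
    moreover have "prob (space M - (\<Union>A\<in>\<E>. bad n A)) \<le> prob {\<omega> \<in> space M. \<epsilon> \<le> RdCov2 K d h n (\<lambda>i. X i \<omega>)}"
    proof (rule finite_measure_mono)
      show "space M - (\<Union>A\<in>\<E>. bad n A) \<subseteq> {\<omega> \<in> space M. \<epsilon> \<le> RdCov2 K d h n (\<lambda>i. X i \<omega>)}"
        using good[OF n] by blast
    qed measurable
    ultimately show ?thesis by linarith
  qed
  have "(\<lambda>n. 1 - (\<Sum>A\<in>\<E>. prob (bad n A))) \<longlonglongrightarrow> 1 - (\<Sum>A\<in>\<E>. 0)"
    unfolding bad_def by (intro tendsto_diff tendsto_const tendsto_sum weak_law_frequencies[OF iid s\<E> \<theta>])
  then have lim: "(\<lambda>n. 1 - (\<Sum>A\<in>\<E>. prob (bad n A))) \<longlonglongrightarrow> 1" by simp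
  have "(\<lambda>n. prob {\<omega> \<in> space M. \<epsilon> \<le> RdCov2 K d h n (\<lambda>i. X i \<omega>)}) \<longlonglongrightarrow> 1"
    by (rule tendsto_sandwich[OF _ _ lim tendsto_const])
       (use lb in \<open>auto simp: eventually_sequentially intro!: exI[of _ N]\<close>)
  with \<epsilon> show ?thesis by blast
qed

section \<open>The law of the optimal permutations under the null hypothesis\<close>

text \<open>Fubini with coordinate \<open>p\<close> integrated first: all sections are null, so the
  indicator has integral 0.\<close>

lemma (in product_sigma_finite) PiM_null_by_section:
  assumes I: "finite I" and p: "p \<in> I" and S: "S \<in> sets (PiM I M)"
    and sec: "\<And>x. x \<in> space (PiM (I - {p}) M) \<Longrightarrow> emeasure (M p) {y \<in> space (M p). x(p := y) \<in> S} = 0"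
  shows "S \<in> null_sets (PiM I M)"
proof (rule null_setsI[OF _ S])
  have e: "insert p (I - {p}) = I" using p by auto
  have "emeasure (PiM I M) S = (\<integral>\<^sup>+x. indicator S x \<partial>PiM (insert p (I - {p})) M)" unfolding e using S by simp
  also have "\<dots> = (\<integral>\<^sup>+x. (\<integral>\<^sup>+y. indicator S (x(p := y)) \<partial>M p) \<partial>PiM (I - {p}) M)"
    by (rule product_nn_integral_insert) (simp add: I, simp, unfold e, rule borel_measurable_indicator[OF S])
  also have "\<dots> = (\<integral>\<^sup>+x. 0 \<partial>PiM (I - {p}) M)"
  proof (rule nn_integral_cong)
    fix x assume x: "x \<in> space (PiM (I - {p}) M)"
    have m: "(\<lambda>y. x(p := y)) \<in> measurable (M p) (PiM I M)"
      using measurable_component_update[OF x, of p, unfolded e] by simp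
    have s: "{y \<in> space (M p). x(p := y) \<in> S} \<in> sets (M p)"
      using measurable_sets[OF m S] by (simp add: vimage_def Int_def conj_commute)
    have "(\<integral>\<^sup>+y. indicator S (x(p := y)) \<partial>M p) = (\<integral>\<^sup>+y. indicator {y \<in> space (M p). x(p := y) \<in> S} y \<partial>M p)"
      by (intro nn_integral_cong) (auto simp: indicator_def)
    also have "\<dots> = 0" using s sec[OF x] by simp
    finally show "(\<integral>\<^sup>+y. indicator S (x(p := y)) \<partial>M p) = 0" .
  qed
  finally show "emeasure (PiM I M) S = 0" by simp
qed

text \<open>With the other coordinates fixed, the non-zero coefficient leaves at most one value at
  \<open>c0\<close>.\<close>

lemma hyperplane_null:
  assumes c0: "c0 < m" and \<alpha>: "\<alpha> c0 \<noteq> 0"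
  shows "{y \<in> space (lborel_Rn m). (\<Sum>c<m. \<alpha> c * y c) = \<gamma>} \<in> null_sets (lborel_Rn m)"
  unfolding lborel_Rn_def
proof -
  interpret product_sigma_finite "\<lambda>_::nat. lborel :: real measure" ..
  let ?S = "{y \<in> space (\<Pi>\<^sub>M c\<in>{..<m}. lborel). (\<Sum>c<m. \<alpha> c * y c) = \<gamma>}"
  show "?S \<in> null_sets (\<Pi>\<^sub>M c\<in>{..<m}. lborel)"
  proof (rule PiM_null_by_section[of _ c0])
    have [measurable]: "(\<lambda>y. y c) \<in> borel_measurable (\<Pi>\<^sub>M c\<in>{..<m}. lborel :: real measure)" if "c \<in> {..<m}" for c
      using measurable_component_singleton[OF that, of "\<lambda>_. lborel :: real measure"] by simp
    show "?S \<in> sets (\<Pi>\<^sub>M c\<in>{..<m}. lborel)" by measurable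
    fix x :: rvec
    have "(\<Sum>c<m. \<alpha> c * (x(c0 := t)) c) = \<alpha> c0 * t + (\<Sum>c\<in>{..<m} - {c0}. \<alpha> c * x c)" for t
      using c0 by (subst sum.remove[of _ c0]) auto
    then have "{t \<in> space lborel. x(c0 := t) \<in> ?S} \<subseteq> {(\<gamma> - (\<Sum>c\<in>{..<m} - {c0}. \<alpha> c * x c)) / \<alpha> c0}"
      using \<alpha> by (auto simp: field_simps)
    then have "countable {t \<in> space lborel. x(c0 := t) \<in> ?S}" by (rule countable_subset) simp
    then show "emeasure lborel {t \<in> space lborel. x(c0 := t) \<in> ?S} = 0"
      by (rule emeasure_lborel_countable)
  qed (use c0 in auto)
qed

section \<open>Uniqueness and equivariance of optimal assignments\<close>

definition assignment_cost :: "nat \<Rightarrow> nat \<Rightarrow> (nat \<Rightarrow> rvec) \<Rightarrow> (nat \<Rightarrow> rvec) \<Rightarrow> (nat \<Rightarrow> nat) \<Rightarrow> real" where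
  "assignment_cost m n g z \<sigma> = (\<Sum>i=1..n. (dist_Rn m (z i) (g (\<sigma> i)))\<^sup>2)"

lemma opt_perm_alt: "opt_perm m n g z = arg_min_on (assignment_cost m n g z) {\<sigma>. \<sigma> permutes {1..n}}"
  unfolding opt_perm_def assignment_cost_def[abs_def] ..

lemma opt_perm_cong:
  assumes "\<And>i c. i \<in> {1..n} \<Longrightarrow> c < m \<Longrightarrow> z i c = z' i c"
  shows "opt_perm m n g z = opt_perm m n g z'"
proof -
  have "assignment_cost m n g z = assignment_cost m n g z'"
    unfolding assignment_cost_def[abs_def] dist_Rn_square using assms
    by (intro ext sum.cong refl) auto
  then show ?thesis by (simp add: opt_perm_alt)
qed

text \<open>The squares of the data cancel, so the difference is affine in the data; this is why
  ties lie on hyperplanes.\<close>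

lemma assignment_cost_diff:
  "assignment_cost m n g z \<sigma> - assignment_cost m n g z \<tau>
     = (\<Sum>i=1..n. \<Sum>c<m. 2 * (g (\<tau> i) c - g (\<sigma> i) c) * z i c)
       + (\<Sum>i=1..n. \<Sum>c<m. (g (\<sigma> i) c)\<^sup>2 - (g (\<tau> i) c)\<^sup>2)"
  unfolding assignment_cost_def dist_Rn_square sum_subtractf[symmetric] sum.distrib[symmetric]
  by (intro sum.cong refl) (simp add: power2_eq_square algebra_simps)

lemma assignment_cost_permute:
  assumes \<pi>: "\<pi> permutes {1..n}"
  shows "assignment_cost m n g (\<lambda>i. z (\<pi> i)) \<sigma> = assignment_cost m n g z (\<sigma> \<circ> inv \<pi>)"
proof -
  have "assignment_cost m n g z (\<sigma> \<circ> inv \<pi>) = (\<Sum>i=1..n. (dist_Rn m (z (\<pi> i)) (g ((\<sigma> \<circ> inv \<pi>) (\<pi> i))))\<^sup>2)"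
    unfolding assignment_cost_def
    using sum.permute[OF \<pi>, of "\<lambda>i. (dist_Rn m (z i) (g ((\<sigma> \<circ> inv \<pi>) i)))\<^sup>2"] by (simp add: o_def)
  also have "\<dots> = assignment_cost m n g (\<lambda>i. z (\<pi> i)) \<sigma>"
    unfolding assignment_cost_def using permutes_inverses(2)[OF \<pi>] by simp
  finally show ?thesis by simp
qed

text \<open>Stronger than uniqueness of the minimiser: all costs are distinct. As a condition on
  pairs of permutations it splits into finitely many tie events, each of them null.\<close>

definition opt_unique :: "nat \<Rightarrow> nat \<Rightarrow> (nat \<Rightarrow> rvec) \<Rightarrow> (nat \<Rightarrow> rvec) \<Rightarrow> bool" where
  "opt_unique m n g z \<longleftrightarrow> (\<forall>\<sigma>\<in>{\<sigma>. \<sigma> permutes {1..n}}. \<forall>\<tau>\<in>{\<sigma>. \<sigma> permutes {1..n}}.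
     \<sigma> \<noteq> \<tau> \<longrightarrow> assignment_cost m n g z \<sigma> \<noteq> assignment_cost m n g z \<tau>)"

text \<open>Relabelling the data transports the costs, so each of the two optimal assignments is at
  most as expensive as the other after transport. Equal costs mean equal permutations by
  \<open>opt_unique\<close>.\<close>

lemma opt_perm_equivariant:
  assumes \<pi>: "\<pi> permutes {1..n}" and u: "opt_unique m n g z"
  shows "opt_perm m n g (\<lambda>i. z (\<pi> i)) = opt_perm m n g z \<circ> \<pi>"
proof -
  let ?\<sigma> = "opt_perm m n g (\<lambda>i. z (\<pi> i))" and ?\<tau> = "opt_perm m n g z"
  have \<sigma>\<pi>: "?\<sigma> \<circ> inv \<pi> permutes {1..n}" and \<tau>\<pi>: "?\<tau> \<circ> \<pi> permutes {1..n}"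
    by (rule permutes_compose[OF permutes_inv[OF \<pi>] opt_perm_permutes],
        rule permutes_compose[OF \<pi> opt_perm_permutes])
  have "assignment_cost m n g (\<lambda>i. z (\<pi> i)) ?\<sigma> \<le> assignment_cost m n g (\<lambda>i. z (\<pi> i)) (?\<tau> \<circ> \<pi>)"
    using opt_perm_minimal[OF \<tau>\<pi>, of m "\<lambda>i. z (\<pi> i)" g] by (simp add: assignment_cost_def)
  then have "assignment_cost m n g z (?\<sigma> \<circ> inv \<pi>) \<le> assignment_cost m n g z ?\<tau>"
    using permutes_inv_o(1)[OF \<pi>] by (simp add: assignment_cost_permute[OF \<pi>] comp_assoc)
  moreover have "assignment_cost m n g z ?\<tau> \<le> assignment_cost m n g z (?\<sigma> \<circ> inv \<pi>)"
    using opt_perm_minimal[OF \<sigma>\<pi>, of m z g] by (simp add: assignment_cost_def)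
  ultimately have "?\<sigma> \<circ> inv \<pi> = ?\<tau>"
    using u \<sigma>\<pi> opt_perm_permutes[of m n g z] unfolding opt_unique_def by force
  then show ?thesis using permutes_inv_o(2)[OF \<pi>] by (metis comp_assoc comp_id)
qed

definition perm_tuples :: "nat \<Rightarrow> nat \<Rightarrow> (nat \<Rightarrow> nat \<Rightarrow> nat) set" where
  "perm_tuples K n = {1..K} \<rightarrow>\<^sub>E {\<sigma>. \<sigma> permutes {1..n}}"

lemma finite_perm_tuples: "finite (perm_tuples K n)"
  unfolding perm_tuples_def by (intro finite_PiE finite_perms) auto

lemma perm_tuples_nonempty: "perm_tuples K n \<noteq> {}"
  unfolding perm_tuples_def using perms_nonempty[of n] by (simp add: PiE_eq_empty_iff)

text \<open>The restriction to \<open>{1..K}\<close> makes the tuple extensional, hence an element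
  of the finite set \<open>perm_tuples K n\<close>.\<close>

definition opt_tuple :: "nat \<Rightarrow> (nat \<Rightarrow> nat) \<Rightarrow> (nat \<Rightarrow> nat \<Rightarrow> nat \<Rightarrow> rvec) \<Rightarrow> nat \<Rightarrow> (nat \<Rightarrow> blocks) \<Rightarrow> nat \<Rightarrow> nat \<Rightarrow> nat" where
  "opt_tuple K d h n x = (\<lambda>j\<in>{1..K}. opt_perm (d j) n (h n j) (\<lambda>i. x i j))"

lemma opt_tuple_eq_iff:
  assumes "\<tau> \<in> perm_tuples K n"
  shows "opt_tuple K d h n x = \<tau> \<longleftrightarrow> (\<forall>j\<in>{1..K}. opt_perm (d j) n (h n j) (\<lambda>i. x i j) = \<tau> j)"
proof
  assume eq: "\<forall>j\<in>{1..K}. opt_perm (d j) n (h n j) (\<lambda>i. x i j) = \<tau> j"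
  show "opt_tuple K d h n x = \<tau>"
  proof (intro extensionalityI[of _ "{1..K}" \<tau>])
    show "opt_tuple K d h n x \<in> extensional {1..K}" unfolding opt_tuple_def by (rule restrict_extensional)
    show "\<tau> \<in> extensional {1..K}" using assms unfolding perm_tuples_def by (simp add: PiE_def)
  qed (use eq in \<open>simp add: opt_tuple_def\<close>)
qed (auto simp: opt_tuple_def)

lemma opt_tuple_in: "opt_tuple K d h n x \<in> perm_tuples K n"
  unfolding opt_tuple_def perm_tuples_def using opt_perm_permutes by auto

section \<open>The uniform law of the optimal tuple\<close>

text \<open>Under the null hypothesis all \<open>n * K\<close> blocks are independent, so the sample
  is a point of one product space over the pairs \<open>(i, j)\<close>, and permuting within a block
  is a reindexing of that product.\<close>

locale null_sample = product_sigma_finite "\<lambda>p::nat \<times> nat. \<nu> (snd p)"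
  for \<nu> :: "nat \<Rightarrow> rvec measure" +
  fixes K n :: nat and d :: "nat \<Rightarrow> nat" and h :: "nat \<Rightarrow> nat \<Rightarrow> nat \<Rightarrow> rvec"
  assumes prob_\<nu>: "\<And>j. prob_space (\<nu> j)"
    and sets_\<nu>: "\<And>j. j \<in> {1..K} \<Longrightarrow> sets (\<nu> j) = sets (lborel_Rn (d j))"
    and ac: "\<And>j. j \<in> {1..K} \<Longrightarrow> absolutely_continuous (lborel_Rn (d j)) (\<nu> j)"
    and inj: "\<And>j. j \<in> {1..K} \<Longrightarrow> inj_on (h n j) {1..n}"
    and cube: "\<And>j. j \<in> {1..K} \<Longrightarrow> h n j ` {1..n} \<subseteq> unit_cube (d j)"
begin

abbreviation "cells \<equiv> {1..n} \<times> {1..K}"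
abbreviation "Q \<equiv> \<Pi>\<^sub>M p\<in>cells. \<nu> (snd p)"
abbreviation "tuple y \<equiv> opt_tuple K d h n (\<lambda>i j. y (i, j))"

lemma prob_Q: "prob_space Q"
  by (intro prob_space_PiM prob_\<nu>)

lemma coordinate_measurable:
  assumes "i \<in> {1..n}" "j \<in> {1..K}" "c < d j"
  shows "(\<lambda>y. y (i, j) c) \<in> borel_measurable Q"
proof -
  have "(\<lambda>y. y (i, j)) \<in> measurable Q (\<nu> j)"
    using measurable_component_singleton[of "(i, j)" cells "\<lambda>p. \<nu> (snd p)"] assms by simp
  moreover have "(\<lambda>y. y c) \<in> borel_measurable (\<nu> j)"
    unfolding measurable_cong_sets[OF sets_\<nu>[OF assms(2)] refl] lborel_Rn_def
    using measurable_component_singleton[of c "{..<d j}" "\<lambda>_. lborel"] assms(3) by simp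
  ultimately show ?thesis by (rule measurable_compose)
qed

text \<open>Permutations that differ at \<open>i0\<close> send it to distinct reference points, so
  the cost difference has a non-zero coefficient in cell \<open>(i0, j)\<close>. With all other
  cells fixed, a tie confines this cell to a hyperplane, which is null by absolute
  continuity.\<close>

lemma AE_opt_unique:
  assumes j: "j \<in> {1..K}"
  shows "AE y in Q. opt_unique (d j) n (h n j) (\<lambda>i. y (i, j))"
proof -
  let ?c = "\<lambda>y. assignment_cost (d j) n (h n j) (\<lambda>i. y (i, j))"
  have "AE y in Q. ?c y \<sigma> \<noteq> ?c y \<tau>" if \<sigma>: "\<sigma> permutes {1..n}" and \<tau>: "\<tau> permutes {1..n}" and ne: "\<sigma> \<noteq> \<tau>" for \<sigma> \<tau>
  proof -
    obtain i0 where i0: "\<sigma> i0 \<noteq> \<tau> i0" using ne by auto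
    then have i0n: "i0 \<in> {1..n}" using \<sigma> \<tau> by (metis permutes_not_in)
    then have "\<sigma> i0 \<in> {1..n}" "\<tau> i0 \<in> {1..n}" using permutes_in_image[OF \<sigma>] permutes_in_image[OF \<tau>] by auto
    then have "h n j (\<sigma> i0) \<noteq> h n j (\<tau> i0)" "h n j (\<sigma> i0) \<in> unit_cube (d j)" "h n j (\<tau> i0) \<in> unit_cube (d j)"
      using inj[OF j] cube[OF j] i0 by (auto dest: inj_onD)
    \<comment> \<open>Points of the cube are extensional, so distinct ones differ in a coordinate
      below \<open>d j\<close>.\<close>
    then obtain c0 where c0: "c0 < d j" "h n j (\<sigma> i0) c0 \<noteq> h n j (\<tau> i0) c0"
      unfolding unit_cube_def by (metis PiE_ext lessThan_iff)
    let ?S = "{y \<in> space Q. ?c y \<sigma> - ?c y \<tau> = 0}"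
    define \<alpha> where "\<alpha> i c = 2 * (h n j (\<tau> i) c - h n j (\<sigma> i) c)" for i c
    define \<beta> where "\<beta> = (\<Sum>i=1..n. \<Sum>c<d j. (h n j (\<sigma> i) c)\<^sup>2 - (h n j (\<tau> i) c)\<^sup>2)"
    have diff: "?c y \<sigma> - ?c y \<tau> = (\<Sum>i=1..n. \<Sum>c<d j. \<alpha> i c * y (i, j) c) + \<beta>" for y
      unfolding assignment_cost_diff \<alpha>_def \<beta>_def ..
    have "?S \<in> null_sets Q"
    proof (rule PiM_null_by_section[of _ "(i0, j)"])
      have [measurable]: "(\<lambda>y. ?c y \<sigma> - ?c y \<tau>) \<in> borel_measurable Q"
        unfolding diff using j
        by (intro borel_measurable_add borel_measurable_sum borel_measurable_times borel_measurable_const coordinate_measurable) auto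
      show "?S \<in> sets Q" by measurable
      fix x
      let ?r = "(\<Sum>i\<in>{1..n} - {i0}. \<Sum>c<d j. \<alpha> i c * x (i, j) c) + \<beta>"
      have split: "(\<Sum>i=1..n. \<Sum>c<d j. \<alpha> i c * (x((i0, j) := y)) (i, j) c) + \<beta> = (\<Sum>c<d j. \<alpha> i0 c * y c) + ?r" for y
        using i0n by (subst sum.remove[of _ i0]) auto
      let ?N = "{y \<in> space (lborel_Rn (d j)). (\<Sum>c<d j. \<alpha> i0 c * y c) = - ?r}"
      have "?N \<in> null_sets (lborel_Rn (d j))"
        by (rule hyperplane_null[OF c0(1)]) (use c0 in \<open>simp add: \<alpha>_def\<close>)
      then have null: "?N \<in> null_sets (\<nu> j)" using ac[OF j] unfolding absolutely_continuous_def by blast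
      have "{y \<in> space (\<nu> j). x((i0, j) := y) \<in> ?S} \<subseteq> ?N"
      proof
        fix y assume y: "y \<in> {y \<in> space (\<nu> j). x((i0, j) := y) \<in> ?S}"
        then have "(\<Sum>i=1..n. \<Sum>c<d j. \<alpha> i c * (x((i0, j) := y)) (i, j) c) + \<beta> = 0"
          unfolding diff by blast
        then have "(\<Sum>c<d j. \<alpha> i0 c * y c) = - ?r" unfolding split by linarith
        then show "y \<in> ?N" using y sets_eq_imp_space_eq[OF sets_\<nu>[OF j]] by blast
      qed
      then have "emeasure (\<nu> j) {y \<in> space (\<nu> j). x((i0, j) := y) \<in> ?S} \<le> emeasure (\<nu> j) ?N"
        using null by (intro emeasure_mono) auto
      then show "emeasure (\<nu> (snd (i0, j))) {y \<in> space (\<nu> (snd (i0, j))). x((i0, j) := y) \<in> ?S} = 0"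
        using null by (simp add: null_setsD1)
    qed (use i0n j in auto)
    then show ?thesis by (rule AE_I') auto
  qed
  then have "AE y in Q. \<forall>\<sigma>\<in>{\<sigma>. \<sigma> permutes {1..n}}. \<forall>\<tau>\<in>{\<sigma>. \<sigma> permutes {1..n}}. \<sigma> \<noteq> \<tau> \<longrightarrow> ?c y \<sigma> \<noteq> ?c y \<tau>"
    by (intro AE_finite_allI finite_perms) (cases, auto)
  then show ?thesis unfolding opt_unique_def .
qed

lemma tuple_measurable: "tuple \<in> measurable Q (count_space UNIV)"
proof -
  have "tuple \<in> measurable Q (count_space (perm_tuples K n))"
    unfolding measurable_count_space_eq2[OF finite_perm_tuples]
  proof (intro conjI ballI)
    show "tuple \<in> space Q \<rightarrow> perm_tuples K n" using opt_tuple_in by auto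
    fix \<tau> assume \<tau>: "\<tau> \<in> perm_tuples K n"
    have "tuple -` {\<tau>} \<inter> space Q = {y \<in> space Q. \<forall>j\<in>{1..K}. opt_perm (d j) n (h n j) (\<lambda>i. y (i, j)) = \<tau> j}"
      by (simp add: vimage_def Int_def opt_tuple_eq_iff[OF \<tau>] conj_commute)
    also have "\<dots> \<in> sets Q"
    proof (rule sets.sets_Collect_finite_All)
      fix j assume j: "j \<in> {1..K}"
      have "(\<lambda>y. opt_perm (d j) n (h n j) (\<lambda>i. y (i, j))) \<in> measurable Q (count_space UNIV)"
        by (rule opt_perm_measurable) (rule coordinate_measurable[OF _ j])
      then show "{y \<in> space Q. opt_perm (d j) n (h n j) (\<lambda>i. y (i, j)) = \<tau> j} \<in> sets Q"
        using measurable_sets[of _ Q "count_space UNIV" "{\<tau> j}"] by (simp add: vimage_def Int_def conj_commute)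
    qed simp
    finally show "tuple -` {\<tau>} \<inter> space Q \<in> sets Q" .
  qed
  moreover have "(\<lambda>\<tau>. \<tau>) \<in> measurable (count_space (perm_tuples K n)) (count_space UNIV)" by simp
  ultimately show ?thesis by (rule measurable_compose)
qed

text \<open>Cells move only within a block, where all of them carry the same law.\<close>

lemma distr_permuted:
  assumes \<pi>: "\<And>j. j \<in> {1..K} \<Longrightarrow> \<pi> j permutes {1..n}"
  defines "\<Phi> \<equiv> \<lambda>y. \<lambda>p\<in>cells. y (\<pi> (snd p) (fst p), snd p)"
  shows "distr Q Q \<Phi> = Q" and "\<Phi> \<in> measurable Q Q"
proof -
  let ?f = "\<lambda>p. (\<pi> (snd p) (fst p), snd p)"
  have in_cells: "?f p \<in> cells" if "p \<in> cells" for p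
    using that permutes_in_image[OF \<pi>] by (auto simp: mem_Times_iff)
  have inj: "inj_on ?f cells"
    using permutes_inj[OF \<pi>] by (auto simp: inj_on_def dest: injD)
  have "distr Q (\<Pi>\<^sub>M p\<in>cells. \<nu> (snd (?f p))) (\<lambda>\<omega>. \<lambda>p\<in>cells. \<omega> (?f p)) = (\<Pi>\<^sub>M p\<in>cells. \<nu> (snd (?f p)))"
    by (rule distr_PiM_reindex[of cells "\<lambda>p. \<nu> (snd p)"]) (use prob_\<nu> inj in_cells in auto)
  then show "distr Q Q \<Phi> = Q" by (simp add: \<Phi>_def)
  show "\<Phi> \<in> measurable Q Q"
    unfolding \<Phi>_def
  proof (rule measurable_restrict)
    fix p assume "p \<in> cells"
    then show "(\<lambda>y. y (?f p)) \<in> measurable Q (\<nu> (snd p))"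
      using measurable_component_singleton[OF in_cells, of p "\<lambda>p. \<nu> (snd p)"] by simp
  qed
qed

text \<open>Permuting block \<open>j\<close> by \<open>\<tau> j\<close> preserves the law and
  composes the optimal permutation with \<open>\<tau> j\<close>; almost surely the result is
  \<open>\<tau> j\<close> exactly when the original was the identity.\<close>

lemma measure_tuple_eq:
  assumes \<tau>: "\<tau> \<in> perm_tuples K n"
  shows "measure Q {y \<in> space Q. tuple y = \<tau>} = measure Q {y \<in> space Q. tuple y = (\<lambda>j\<in>{1..K}. id)}"
proof -
  interpret Q: prob_space Q by (rule prob_Q)
  have perm: "\<tau> j permutes {1..n}" if "j \<in> {1..K}" for j using \<tau> that by (auto simp: perm_tuples_def PiE_iff)
  let ?\<Phi> = "\<lambda>y. \<lambda>p\<in>cells. y (\<tau> (snd p) (fst p), snd p)"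
  have \<Phi>: "distr Q Q ?\<Phi> = Q" "?\<Phi> \<in> measurable Q Q"
    by (rule distr_permuted(1), rule perm, assumption) (rule distr_permuted(2), rule perm)
  have ev: "{y \<in> space Q. tuple y = \<sigma>} \<in> sets Q" for \<sigma>
    using measurable_sets[OF tuple_measurable, of "{\<sigma>}"] by (simp add: vimage_def Int_def conj_commute)
  have "measure Q {y \<in> space Q. tuple y = \<tau>} = measure (distr Q Q ?\<Phi>) {y \<in> space Q. tuple y = \<tau>}"
    by (simp only: \<Phi>(1))
  also have "\<dots> = measure Q (?\<Phi> -` {y \<in> space Q. tuple y = \<tau>} \<inter> space Q)"
    by (rule measure_distr[OF \<Phi>(2) ev])
  also have "\<dots> = measure Q {y \<in> space Q. tuple y = (\<lambda>j\<in>{1..K}. id)}"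
  proof (rule Q.finite_measure_eq_AE)
    have "AE y in Q. \<forall>j\<in>{1..K}. opt_unique (d j) n (h n j) (\<lambda>i. y (i, j))"
      by (intro AE_finite_allI AE_opt_unique) auto
    then show "AE y in Q. (y \<in> ?\<Phi> -` {y \<in> space Q. tuple y = \<tau>} \<inter> space Q) = (y \<in> {y \<in> space Q. tuple y = (\<lambda>j\<in>{1..K}. id)})"
    proof (rule AE_mp, intro AE_I2 impI)
      fix y assume y: "y \<in> space Q" and u: "\<forall>j\<in>{1..K}. opt_unique (d j) n (h n j) (\<lambda>i. y (i, j))"
      let ?o = "\<lambda>j. opt_perm (d j) n (h n j) (\<lambda>i. y (i, j))"
      have eq: "opt_perm (d j) n (h n j) (\<lambda>i. ?\<Phi> y (i, j)) = ?o j \<circ> \<tau> j" if j: "j \<in> {1..K}" for j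
      proof -
        have "opt_perm (d j) n (h n j) (\<lambda>i. ?\<Phi> y (i, j)) = opt_perm (d j) n (h n j) (\<lambda>i. y (\<tau> j i, j))"
          by (rule opt_perm_cong) (use j in auto)
        also have "\<dots> = ?o j \<circ> \<tau> j"
          using opt_perm_equivariant[OF perm[OF j], of "d j" "h n j" "\<lambda>i. y (i, j)"] u j by auto
        finally show ?thesis .
      qed
      have cancel: "(?o j \<circ> \<tau> j = \<tau> j) = (?o j = id)" if j: "j \<in> {1..K}" for j
        using permutes_surj[OF perm[OF j]] by (auto simp: fun_eq_iff) (metis surjD)
      have "(tuple (?\<Phi> y) = \<tau>) = (\<forall>j\<in>{1..K}. opt_perm (d j) n (h n j) (\<lambda>i. ?\<Phi> y (i, j)) = \<tau> j)"
        by (rule opt_tuple_eq_iff[OF \<tau>])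
      also have "\<dots> = (\<forall>j\<in>{1..K}. ?o j = id)" using eq cancel by auto
      also have "\<dots> = (tuple y = (\<lambda>j\<in>{1..K}. id))"
        by (subst opt_tuple_eq_iff) (simp_all add: perm_tuples_def permutes_id[unfolded id_def[symmetric]])
      finally show "(y \<in> ?\<Phi> -` {y \<in> space Q. tuple y = \<tau>} \<inter> space Q) = (y \<in> {y \<in> space Q. tuple y = (\<lambda>j\<in>{1..K}. id)})"
        using y measurable_space[OF \<Phi>(2) y] by auto
    qed
  qed (use measurable_sets[OF \<Phi>(2) ev] ev in auto)
  finally show ?thesis .
qed

lemma measure_tuple_uniform:
  "measure Q {y \<in> space Q. G (tuple y)} = card {\<tau> \<in> perm_tuples K n. G \<tau>} / card (perm_tuples K n)"
proof -
  interpret Q: prob_space Q by (rule prob_Q)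
  define p where "p = measure Q {y \<in> space Q. tuple y = (\<lambda>j\<in>{1..K}. id)}"
  have ev: "{y \<in> space Q. tuple y = \<sigma>} \<in> sets Q" for \<sigma>
    using measurable_sets[OF tuple_measurable, of "{\<sigma>}"] by (simp add: vimage_def Int_def conj_commute)
  have gen: "measure Q {y \<in> space Q. G (tuple y)} = card {\<tau> \<in> perm_tuples K n. G \<tau>} * p" for G
  proof -
    let ?U = "\<Union>\<tau>\<in>{\<tau> \<in> perm_tuples K n. G \<tau>}. {y \<in> space Q. tuple y = \<tau>}"
    have "{y \<in> space Q. G (tuple y)} = ?U"
      using opt_tuple_in by auto
    then have "measure Q {y \<in> space Q. G (tuple y)} = measure Q ?U" by (rule arg_cong)
    also have "measure Q ?U = (\<Sum>\<tau>\<in>{\<tau> \<in> perm_tuples K n. G \<tau>}. measure Q {y \<in> space Q. tuple y = \<tau>})"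
    proof (rule Q.finite_measure_finite_Union)
      show "finite {\<tau> \<in> perm_tuples K n. G \<tau>}" using finite_perm_tuples by (rule finite_subset[rotated]) blast
      show "(\<lambda>\<tau>. {y \<in> space Q. tuple y = \<tau>}) ` {\<tau> \<in> perm_tuples K n. G \<tau>} \<subseteq> sets Q" using ev by blast
      show "disjoint_family_on (\<lambda>\<tau>. {y \<in> space Q. tuple y = \<tau>}) {\<tau> \<in> perm_tuples K n. G \<tau>}"
        unfolding disjoint_family_on_def by blast
    qed
    also have "\<dots> = (\<Sum>\<tau>\<in>{\<tau> \<in> perm_tuples K n. G \<tau>}. p)"
    proof (rule sum.cong[OF refl])
      fix \<tau> assume "\<tau> \<in> {\<tau> \<in> perm_tuples K n. G \<tau>}"
      then have "\<tau> \<in> perm_tuples K n" by blast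
      then show "measure Q {y \<in> space Q. tuple y = \<tau>} = p" unfolding p_def by (rule measure_tuple_eq)
    qed
    finally show ?thesis by simp
  qed
  have "1 = card (perm_tuples K n) * p" using gen[of "\<lambda>_. True"] Q.prob_space by simp
  then have "p = 1 / card (perm_tuples K n)"
    using finite_perm_tuples perm_tuples_nonempty by (simp add: field_simps card_eq_0_iff)
  then show ?thesis using gen[of G] by simp
qed

end

text \<open>The rearranged sample has the product law of \<open>null_sample\<close>: observations
  are independent by the sampling assumption, and blocks of one observation by \<open>H0\<close>.
  Both enter through the probabilities of measurable boxes.\<close>

lemma opt_tuple_uniform:
  assumes iid: "iid_from K d M I X \<mu>" and I: "{1..n} \<subseteq> I" and n: "n \<ge> 1"
    and ac: "ac_marginals K d \<mu>" and H: "H0 K d \<mu>"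
    and inj: "\<And>j. j \<in> {1..K} \<Longrightarrow> inj_on (h n j) {1..n}"
    and cube: "\<And>j. j \<in> {1..K} \<Longrightarrow> h n j ` {1..n} \<subseteq> unit_cube (d j)"
  shows "measure M {\<omega> \<in> space M. G (opt_tuple K d h n (\<lambda>i. X i \<omega>))}
    = card {\<tau> \<in> perm_tuples K n. G \<tau>} / card (perm_tuples K n)"
proof -
  interpret prob_space M using iid by (simp add: iid_from_def)
  let ?B = "block_space K d"
  have indep: "indep_vars (\<lambda>_. ?B) X {1..n}"
    using iid I by (auto simp: iid_from_def intro: indep_vars_subset)
  have X: "X i \<in> measurable M ?B" if "i \<in> {1..n}" for i
    using indep that by (auto simp: indep_vars_def)
  have dist: "distr M ?B (X i) = \<mu>" if "i \<in> {1..n}" for i using iid I that by (auto simp: iid_from_def)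
  have "1 \<in> {1..n}" using n by simp
  then have sets_\<mu>: "sets \<mu> = sets ?B" and p\<mu>: "prob_space \<mu>"
    unfolding dist[OF \<open>1 \<in> {1..n}\<close>, symmetric] by (auto intro!: prob_space_distr X)
  have comp\<mu>: "(\<lambda>x. x j) \<in> measurable ?B (lborel_Rn (d j))" if "j \<in> {1..K}" for j
    unfolding block_space_def by (rule measurable_component_singleton[OF that])
  \<comment> \<open>The locale wants a probability measure at every index; a point mass fills the
    indices outside \<open>{1..K}\<close>.\<close>
  define \<nu> where "\<nu> j = (if j \<in> {1..K} then marginal d \<mu> j else return (count_space UNIV) undefined)" for j
  have p\<nu>: "prob_space (\<nu> j)" for j
  proof (cases "j \<in> {1..K}")
    case True
    have "(\<lambda>x. x j) \<in> measurable \<mu> (lborel_Rn (d j))"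
      unfolding measurable_cong_sets[OF sets_\<mu> refl] by (rule comp\<mu>[OF True])
    then show ?thesis using True p\<mu> by (simp add: \<nu>_def marginal_def prob_space.prob_space_distr)
  next
    case False
    then show ?thesis by (auto simp: \<nu>_def intro!: prob_space_return)
  qed
  have sets_\<nu>: "sets (\<nu> j) = sets (lborel_Rn (d j))" if "j \<in> {1..K}" for j
    using that by (simp add: \<nu>_def marginal_def)
  interpret null_sample \<nu> K n d h
  proof (intro null_sample.intro product_sigma_finite.intro null_sample_axioms.intro p\<nu>
      prob_space_imp_sigma_finite)
    show "absolutely_continuous (lborel_Rn (d j)) (\<nu> j)" if "j \<in> {1..K}" for j
      using ac that by (simp add: \<nu>_def ac_marginals_def)
  qed (use sets_\<nu> inj cube in auto)
  define V where "V \<omega> = (\<lambda>p\<in>cells. X (fst p) \<omega> (snd p))" for \<omega>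
  have V: "V \<in> measurable M Q"
    unfolding V_def
  proof (rule measurable_restrict)
    fix p assume p: "p \<in> cells"
    then have "(\<lambda>\<omega>. X (fst p) \<omega> (snd p)) \<in> measurable M (lborel_Rn (d (snd p)))"
      by (intro measurable_compose[OF X comp\<mu>]) auto
    then show "(\<lambda>\<omega>. X (fst p) \<omega> (snd p)) \<in> measurable M (\<nu> (snd p))"
      using p sets_\<nu>[of "snd p"] by (simp add: mem_Times_iff cong: measurable_cong_sets)
  qed
  have "distr M Q V = Q"
  proof (rule PiM_eqI)
    fix A assume A: "\<And>p. p \<in> cells \<Longrightarrow> A p \<in> sets (\<nu> (snd p))"
    let ?A = "\<lambda>i. Pi\<^sub>E {1..K} (\<lambda>j. A (i, j))"
    have A': "A (i, j) \<in> sets (lborel_Rn (d j))" if "i \<in> {1..n}" "j \<in> {1..K}" for i j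
      using A[of "(i, j)"] that by (simp add: sets_\<nu>)
    have sA: "?A i \<in> sets ?B" if "i \<in> {1..n}" for i
      unfolding block_space_def using A'[OF that] by (intro sets_PiM_I_finite) auto
    have pre: "V -` Pi\<^sub>E cells A \<inter> space M = (\<Inter>i\<in>{1..n}. X i -` ?A i \<inter> space M)"
    proof (intro set_eqI iffI)
      fix \<omega> assume \<omega>: "\<omega> \<in> V -` Pi\<^sub>E cells A \<inter> space M"
      have "X i \<omega> \<in> ?A i" if i: "i \<in> {1..n}" for i
      proof (rule PiE_I)
        fix j assume "j \<in> {1..K}"
        with i \<omega> have "V \<omega> (i, j) \<in> A (i, j)" by (auto dest!: PiE_mem)
        then show "X i \<omega> j \<in> A (i, j)" using i \<open>j \<in> {1..K}\<close> by (simp add: V_def)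
      next
        fix j assume "j \<notin> {1..K}"
        moreover have "X i \<omega> \<in> space ?B" using measurable_space[OF X[OF i]] \<omega> by auto
        ultimately show "X i \<omega> j = undefined" unfolding block_space_def space_PiM by (auto dest: PiE_arb)
      qed
      then show "\<omega> \<in> (\<Inter>i\<in>{1..n}. X i -` ?A i \<inter> space M)" using \<omega> by blast
    next
      fix \<omega> assume \<omega>: "\<omega> \<in> (\<Inter>i\<in>{1..n}. X i -` ?A i \<inter> space M)"
      have "V \<omega> \<in> Pi\<^sub>E cells A"
        unfolding V_def
      proof (rule restrict_PiE_iff[THEN iffD2], rule ballI)
        fix p assume "p \<in> cells"
        then show "X (fst p) \<omega> (snd p) \<in> A p"
          using \<omega> PiE_mem[of "X (fst p) \<omega>" "{1..K}" "\<lambda>j. A (fst p, j)" "snd p"] by (auto simp: mem_Times_iff)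
      qed
      moreover have "\<omega> \<in> space M" using \<omega> \<open>1 \<in> {1..n}\<close> by blast
      ultimately show "\<omega> \<in> V -` Pi\<^sub>E cells A \<inter> space M" by blast
    qed
    have row: "emeasure M (X i -` ?A i \<inter> space M) = (\<Prod>j\<in>{1..K}. emeasure (\<nu> j) (A (i, j)))" if i: "i \<in> {1..n}" for i
    proof -
      interpret N: product_sigma_finite \<nu>
        by (intro product_sigma_finite.intro prob_space_imp_sigma_finite p\<nu>)
      have \<mu>: "\<mu> = Pi\<^sub>M {1..K} \<nu>"
      proof -
        have "Pi\<^sub>M {1..K} \<nu> = Pi\<^sub>M {1..K} (marginal d \<mu>)" by (rule PiM_cong) (simp_all add: \<nu>_def)
        then show ?thesis using H unfolding H0_def by simp
      qed
      have "emeasure M (X i -` ?A i \<inter> space M) = emeasure (distr M ?B (X i)) (?A i)"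
        by (rule emeasure_distr[symmetric, OF X[OF i] sA[OF i]])
      also have "\<dots> = emeasure (Pi\<^sub>M {1..K} \<nu>) (?A i)" unfolding dist[OF i] using \<mu> by simp
      also have "\<dots> = (\<Prod>j\<in>{1..K}. emeasure (\<nu> j) (A (i, j)))"
        using A'[OF i] by (intro N.emeasure_PiM) (auto simp: sets_\<nu>)
      finally show ?thesis .
    qed
    have sPi: "Pi\<^sub>E cells A \<in> sets Q" using A by (intro sets_PiM_I_finite) auto
    have "emeasure (distr M Q V) (Pi\<^sub>E cells A) = emeasure M (\<Inter>i\<in>{1..n}. X i -` ?A i \<inter> space M)"
      unfolding pre[symmetric] by (rule emeasure_distr[OF V sPi])
    also have "\<dots> = ennreal (prob (\<Inter>i\<in>{1..n}. X i -` ?A i \<inter> space M))" by (rule emeasure_eq_measure)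
    also have "prob (\<Inter>i\<in>{1..n}. X i -` ?A i \<inter> space M) = (\<Prod>i\<in>{1..n}. prob (X i -` ?A i \<inter> space M))"
      by (rule indep_varsD_finite[OF indep]) (use n sA in auto)
    also have "ennreal \<dots> = (\<Prod>i\<in>{1..n}. emeasure M (X i -` ?A i \<inter> space M))"
      by (simp add: emeasure_eq_measure prod_ennreal)
    also have "\<dots> = (\<Prod>i\<in>{1..n}. \<Prod>j\<in>{1..K}. emeasure (\<nu> j) (A (i, j)))"
      by (rule prod.cong[OF refl row])
    also have "\<dots> = (\<Prod>p\<in>cells. emeasure (\<nu> (snd p)) (A p))"
      by (subst prod.cartesian_product) (simp add: case_prod_beta)
    finally show "emeasure (distr M Q V) (Pi\<^sub>E cells A) = (\<Prod>p\<in>cells. emeasure (\<nu> (snd p)) (A p))" .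
  qed simp_all
  have ev: "{y \<in> space Q. G (tuple y)} \<in> sets Q"
    using measurable_sets[OF tuple_measurable, of "Collect G"] by (simp add: vimage_def Int_def conj_commute)
  have tV: "tuple (V \<omega>) = opt_tuple K d h n (\<lambda>i. X i \<omega>)" for \<omega>
    unfolding opt_tuple_def
  proof (rule restrict_ext)
    fix j assume "j \<in> {1..K}"
    then show "opt_perm (d j) n (h n j) (\<lambda>i. V \<omega> (i, j)) = opt_perm (d j) n (h n j) (\<lambda>i. X i \<omega> j)"
      by (intro opt_perm_cong) (simp add: V_def)
  qed
  have "measure M {\<omega> \<in> space M. G (opt_tuple K d h n (\<lambda>i. X i \<omega>))} = measure M (V -` {y \<in> space Q. G (tuple y)} \<inter> space M)"
  proof (rule arg_cong[of _ _ prob])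
    show "{\<omega> \<in> space M. G (opt_tuple K d h n (\<lambda>i. X i \<omega>))} = V -` {y \<in> space Q. G (tuple y)} \<inter> space M"
      using measurable_space[OF V] unfolding tV[symmetric] by blast
  qed
  also have "\<dots> = measure (distr M Q V) {y \<in> space Q. G (tuple y)}"
    by (rule measure_distr[symmetric, OF V ev])
  also have "\<dots> = card {\<tau> \<in> perm_tuples K n. G \<tau>} / card (perm_tuples K n)"
    unfolding \<open>distr M Q V = Q\<close> by (rule measure_tuple_uniform)
  finally show ?thesis .
qed

section \<open>Averaging the statistic over permutations\<close>

text \<open>The data enter the statistic only through the assignments, so its null law is that of
  this function at a uniform tuple.\<close>

definition tuple_stat :: "nat \<Rightarrow> (nat \<Rightarrow> nat) \<Rightarrow> (nat \<Rightarrow> nat \<Rightarrow> nat \<Rightarrow> rvec) \<Rightarrow> nat \<Rightarrow> (nat \<Rightarrow> nat \<Rightarrow> nat) \<Rightarrow> real" where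
  "tuple_stat K d h n \<tau> = (\<Sum>j=1..K-1. dCov2 n
     (\<lambda>k l. dist_Rn (d j) (h n j (\<tau> j k)) (h n j (\<tau> j l)))
     (\<lambda>k l. L2_set (\<lambda>(m, c). h n m (\<tau> m k) c - h n m (\<tau> m l) c) (SIGMA m:{j+1..K}. {..<d m})))"

lemma RdCov2_eq_tuple_stat: "RdCov2 K d h n x = tuple_stat K d h n (opt_tuple K d h n x)"
  unfolding RdCov2_def tuple_stat_def
proof (intro sum.cong refl dCov2_cong)
  fix j k l assume j': "j \<in> {1..K-1}"
  then have j: "j \<in> {1..K}" by auto
  show "rank_dist d h n x j k l
      = dist_Rn (d j) (h n j (opt_tuple K d h n x j k)) (h n j (opt_tuple K d h n x j l))"
    using j by (simp add: rank_dist_def emp_rank_def opt_tuple_def)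
  show "rank_dist_plus K d h n x j k l = L2_set (\<lambda>(m, c). h n m (opt_tuple K d h n x m k) c
      - h n m (opt_tuple K d h n x m l) c) (SIGMA m:{j+1..K}. {..<d m})"
    unfolding rank_dist_plus_def using j
    by (intro L2_set_cong refl) (auto simp: emp_rank_def opt_tuple_def)
qed

lemma sum_perms_compose:
  assumes "\<rho> permutes {1..n::nat}"
  shows "(\<Sum>\<pi>\<in>{\<pi>. \<pi> permutes {1..n}}. f (\<pi> \<circ> \<rho>)) = (\<Sum>\<pi>\<in>{\<pi>. \<pi> permutes {1..n}}. f \<pi>)"
  by (rule sum.reindex_bij_witness[of _ "\<lambda>\<pi>. \<pi> \<circ> inv \<rho>" "\<lambda>\<pi>. \<pi> \<circ> \<rho>"])
     (use assms in \<open>auto simp: comp_assoc permutes_inv_o permutes_compose permutes_inv\<close>)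

text \<open>Summed over all N permutations, \<open>a (\<pi> k) (\<pi> l)\<close> is 0 on the
  diagonal and a constant \<open>c\<close> off it, with n (n-1) c = N Sa. The three parts of the
  covariance are then n-1, n and -2(n-1) times N Sa Sb / (n^4 (n-1)), and these factors add to
  1.\<close>

lemma sum_dCov2_perms:
  fixes a b :: "nat \<Rightarrow> nat \<Rightarrow> real"
  assumes n: "n \<ge> 2" and a0: "\<And>k. k \<in> {1..n} \<Longrightarrow> a k k = 0" and b0: "\<And>k. k \<in> {1..n} \<Longrightarrow> b k k = 0"
  shows "(\<Sum>\<pi>\<in>{\<pi>. \<pi> permutes {1..n}}. dCov2 n (\<lambda>k l. a (\<pi> k) (\<pi> l)) b)
    = real (card {\<pi>. \<pi> permutes {1..n}}) * ((\<Sum>k=1..n. \<Sum>l=1..n. a k l) * (\<Sum>k=1..n. \<Sum>l=1..n. b k l)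
        / (real n ^ 4 * (real n - 1)))"
proof -
  let ?P = "{\<pi>. \<pi> permutes {1..n}}"
  define Sa where "Sa = (\<Sum>k=1..n. \<Sum>l=1..n. a k l)"
  define Sb where "Sb = (\<Sum>k=1..n. \<Sum>l=1..n. b k l)"
  define m where "m k l = (\<Sum>\<pi>\<in>?P. a (\<pi> k) (\<pi> l))" for k l
  define c where "c = m 1 2"
  define N where "N = real (card ?P)"
  have row: "(\<Sum>l=1..n. a x (\<pi> l)) = (\<Sum>l=1..n. a x l)" if "\<pi> \<in> ?P" for \<pi> x
    using sum.permute[of \<pi> "{1..n}" "a x"] that by (simp add: o_def)
  have total: "(\<Sum>k=1..n. \<Sum>l=1..n. a (\<pi> k) (\<pi> l)) = Sa" if p: "\<pi> \<in> ?P" for \<pi>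
    unfolding row[OF p] Sa_def using sum.permute[of \<pi> "{1..n}" "\<lambda>k. \<Sum>l=1..n. a k l"] p by (simp add: o_def)
  have inv: "m (\<rho> k) (\<rho> l) = m k l" if "\<rho> permutes {1..n}" for \<rho> k l
    unfolding m_def using sum_perms_compose[OF that, of "\<lambda>\<pi>. a (\<pi> k) (\<pi> l)"] by simp
  \<comment> \<open>One transposition takes \<open>k\<close> to \<open>k'\<close>; a second one
    fixes \<open>k'\<close> and takes the image of \<open>l\<close> to \<open>l'\<close>.\<close>
  have const: "m k l = m k' l'"
    if "k \<in> {1..n}" "l \<in> {1..n}" "k' \<in> {1..n}" "l' \<in> {1..n}" "k \<noteq> l" "k' \<noteq> l'" for k l k' l'
  proof -
    let ?t = "Transposition.transpose k k'"
    have t: "?t permutes {1..n}" using that by (intro permutes_swap_id) auto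
    have "m k l = m k' (?t l)" using inv[OF t, of k l] by simp
    have in': "?t l \<in> {1..n}" using permutes_in_image[OF t] that by blast
    have ne: "?t l \<noteq> k'" using that by (auto simp: Transposition.transpose_def)
    let ?s = "Transposition.transpose (?t l) l'"
    have s: "?s permutes {1..n}" using that in' by (intro permutes_swap_id) auto
    have "?s k' = k'" using ne that by (auto simp: Transposition.transpose_def)
    then have "m k' l' = m k' (?t l)" using inv[OF s, of k' "?t l"] by simp
    with \<open>m k l = m k' (?t l)\<close> show ?thesis by simp
  qed
  have mkl: "m k l = (if k = l then 0 else c)" if "k \<in> {1..n}" "l \<in> {1..n}" for k l
  proof (cases "k = l")
    case True
    have "a (\<pi> k) (\<pi> k) = 0" if "\<pi> \<in> ?P" for \<pi>
      using a0 permutes_in_image[of \<pi> "{1..n}" k] that \<open>k \<in> {1..n}\<close> by blast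
    then show ?thesis using True by (simp add: m_def)
  next
    case False
    then show ?thesis using const[of k l 1 2] that n by (simp add: c_def)
  qed
  have rowm: "(\<Sum>l=1..n. m k l) = (real n - 1) * c" if k: "k \<in> {1..n}" for k
  proof -
    have "(\<Sum>l=1..n. m k l) = (\<Sum>l\<in>{1..n} - {k}. m k l)"
      using k mkl[OF k k] by (subst sum.remove[of _ k]) auto
    also have "\<dots> = (\<Sum>l\<in>{1..n} - {k}. c)" using k by (intro sum.cong refl) (simp add: mkl)
    also have "\<dots> = (real n - 1) * c" using k n by (simp add: of_nat_diff)
    finally show ?thesis .
  qed
  have summ: "(\<Sum>k=1..n. \<Sum>l=1..n. m k l) = N * Sa"
  proof -
    have "(\<Sum>k=1..n. \<Sum>l=1..n. m k l) = (\<Sum>\<pi>\<in>?P. \<Sum>k=1..n. \<Sum>l=1..n. a (\<pi> k) (\<pi> l))"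
      unfolding m_def by (subst sum.swap[of _ ?P]) (subst sum.swap[of _ ?P], rule refl)
    then show ?thesis using total by (simp add: N_def)
  qed
  moreover have "(\<Sum>k=1..n. \<Sum>l=1..n. m k l) = (\<Sum>k=1..n. (real n - 1) * c)" by (rule sum.cong[OF refl rowm])
  ultimately have cN: "real n * ((real n - 1) * c) = N * Sa" by simp
  have t2: "(\<Sum>\<pi>\<in>?P. \<Sum>k=1..n. \<Sum>l=1..n. a (\<pi> k) (\<pi> l) * b k l) = c * Sb"
  proof -
    have "(\<Sum>\<pi>\<in>?P. \<Sum>k=1..n. \<Sum>l=1..n. a (\<pi> k) (\<pi> l) * b k l) = (\<Sum>k=1..n. \<Sum>l=1..n. m k l * b k l)"
      unfolding m_def sum_distrib_right by (subst sum.swap) (intro sum.cong refl, rule sum.swap)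
    also have "\<dots> = (\<Sum>k=1..n. \<Sum>l=1..n. c * b k l)"
      by (intro sum.cong refl) (auto simp: mkl b0)
    finally show ?thesis by (simp add: Sb_def sum_distrib_left)
  qed
  have t3: "(\<Sum>\<pi>\<in>?P. \<Sum>k=1..n. \<Sum>l=1..n. \<Sum>i=1..n. a (\<pi> k) (\<pi> l) * b k i) = (real n - 1) * c * Sb"
  proof -
    have "(\<Sum>\<pi>\<in>?P. \<Sum>k=1..n. \<Sum>l=1..n. \<Sum>i=1..n. a (\<pi> k) (\<pi> l) * b k i)
        = (\<Sum>\<pi>\<in>?P. \<Sum>k=1..n. (\<Sum>l=1..n. a (\<pi> k) (\<pi> l)) * (\<Sum>i=1..n. b k i))"
      by (simp add: sum_product)
    also have "\<dots> = (\<Sum>k=1..n. (\<Sum>\<pi>\<in>?P. \<Sum>l=1..n. a (\<pi> k) (\<pi> l)) * (\<Sum>i=1..n. b k i))"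
      by (subst sum.swap) (simp only: sum_distrib_right)
    also have "\<dots> = (\<Sum>k=1..n. (\<Sum>l=1..n. m k l) * (\<Sum>i=1..n. b k i))"
      unfolding m_def by (subst sum.swap) (rule refl)
    also have "\<dots> = (\<Sum>k=1..n. (real n - 1) * c * (\<Sum>i=1..n. b k i))"
      by (intro sum.cong refl) (simp only: rowm)
    finally show ?thesis by (simp add: Sb_def sum_distrib_left)
  qed
  have "(\<Sum>\<pi>\<in>?P. dCov2 n (\<lambda>k l. a (\<pi> k) (\<pi> l)) b)
      = (\<Sum>\<pi>\<in>?P. (1 / real n ^ 2 * (\<Sum>k=1..n. \<Sum>l=1..n. a (\<pi> k) (\<pi> l))) * (1 / real n ^ 2 * Sb))
        + 1 / real n ^ 2 * (\<Sum>\<pi>\<in>?P. \<Sum>k=1..n. \<Sum>l=1..n. a (\<pi> k) (\<pi> l) * b k l)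
        - 2 / real n ^ 3 * (\<Sum>\<pi>\<in>?P. \<Sum>k=1..n. \<Sum>l=1..n. \<Sum>i=1..n. a (\<pi> k) (\<pi> l) * b k i)"
    unfolding dCov2_def Sb_def by (simp only: sum_subtractf sum.distrib sum_distrib_left[symmetric])
  also have "\<dots> = N * (1 / real n ^ 2 * Sa * (1 / real n ^ 2 * Sb)) + 1 / real n ^ 2 * (c * Sb)
        - 2 / real n ^ 3 * ((real n - 1) * c * Sb)"
    unfolding t2 t3 using total by (simp add: N_def)
  also have "\<dots> = N * (Sa * Sb / (real n ^ 4 * (real n - 1)))"
  proof -
    have pos: "real n > 0" "real n - 1 > 0" using n by auto
    have c: "c = N * Sa / (real n * (real n - 1))" using cN pos by (simp add: field_simps)
    have "N * (1 / x ^ 2 * Sa * (1 / x ^ 2 * Sb)) + 1 / x ^ 2 * (N * Sa / (x * (x - 1)) * Sb)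
        - 2 / x ^ 3 * ((x - 1) * (N * Sa / (x * (x - 1))) * Sb) = N * (Sa * Sb / (x ^ 4 * (x - 1)))"
      if "x > 0" "x - 1 > 0" for x :: real
    proof -
      have t1: "N * (1 / x ^ 2 * Sa * (1 / x ^ 2 * Sb)) = N * Sa * Sb * ((x - 1) / (x ^ 4 * (x - 1)))"
        using that by (simp add: power2_eq_square power4_eq_xxxx)
      have t2: "1 / x ^ 2 * (N * Sa / (x * (x - 1)) * Sb) = N * Sa * Sb * (x / (x ^ 4 * (x - 1)))"
        using that by (simp add: power2_eq_square power4_eq_xxxx)
      have t3: "2 / x ^ 3 * ((x - 1) * (N * Sa / (x * (x - 1))) * Sb) = N * Sa * Sb * (2 * (x - 1) / (x ^ 4 * (x - 1)))"
      proof -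
        have 1: "(x - 1) * (N * Sa / (x * (x - 1))) = N * Sa / x" using that by simp
        have 2: "2 * (x - 1) / (x ^ 4 * (x - 1)) = 2 / x ^ 4"
          by (subst nonzero_mult_divide_mult_cancel_right) (use that in auto)
        show ?thesis unfolding 1 2 by (simp add: power3_eq_cube power4_eq_xxxx)
      qed
      have t4: "(x - 1) / (x ^ 4 * (x - 1)) + x / (x ^ 4 * (x - 1)) - 2 * (x - 1) / (x ^ 4 * (x - 1)) = 1 / (x ^ 4 * (x - 1))"
        unfolding add_divide_distrib[symmetric] diff_divide_distrib[symmetric] by (simp add: algebra_simps)
      show ?thesis
        unfolding t1 t2 t3 distrib_left[symmetric] right_diff_distrib[symmetric] t4 by simp
    qed
    from this[OF pos] show ?thesis unfolding c .
  qed
  finally show ?thesis by (simp add: N_def Sa_def Sb_def)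
qed

lemma sum_dCov2_perms_le:
  fixes a b :: "nat \<Rightarrow> nat \<Rightarrow> real"
  assumes n: "n \<ge> 2" and a0: "\<And>k. k \<in> {1..n} \<Longrightarrow> a k k = 0" and b0: "\<And>k. k \<in> {1..n} \<Longrightarrow> b k k = 0"
    and a: "\<And>k l. k \<in> {1..n} \<Longrightarrow> l \<in> {1..n} \<Longrightarrow> a k l \<in> {0..A}"
    and b: "\<And>k l. k \<in> {1..n} \<Longrightarrow> l \<in> {1..n} \<Longrightarrow> b k l \<in> {0..B}"
  shows "(\<Sum>\<pi>\<in>{\<pi>. \<pi> permutes {1..n}}. dCov2 n (\<lambda>k l. a (\<pi> k) (\<pi> l)) b)
    \<le> real (card {\<pi>. \<pi> permutes {1..n}}) * (A * B / (real n - 1))"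
proof -
  have bound: "(\<Sum>k=1..n. \<Sum>l=1..n. f k l) \<in> {0..real n ^ 2 * C}"
    if "\<And>k l. k \<in> {1..n} \<Longrightarrow> l \<in> {1..n} \<Longrightarrow> f k l \<in> {0..C}" for f :: "nat \<Rightarrow> nat \<Rightarrow> real" and C
  proof -
    have "(\<Sum>k=1..n. \<Sum>l=1..n. f k l) \<le> (\<Sum>k=1..n. \<Sum>l=1..n. C)" by (intro sum_mono) (use that in auto)
    moreover have "0 \<le> (\<Sum>k=1..n. \<Sum>l=1..n. f k l)" by (intro sum_nonneg) (use that in auto)
    ultimately show ?thesis by (simp add: power2_eq_square)
  qed
  have "(\<Sum>k=1..n. \<Sum>l=1..n. a k l) * (\<Sum>k=1..n. \<Sum>l=1..n. b k l) \<le> (real n ^ 2 * A) * (real n ^ 2 * B)"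
    using bound[of a A, OF a] bound[of b B, OF b] by (intro mult_mono) auto
  then have "(\<Sum>k=1..n. \<Sum>l=1..n. a k l) * (\<Sum>k=1..n. \<Sum>l=1..n. b k l) / (real n ^ 4 * (real n - 1))
      \<le> (real n ^ 2 * A) * (real n ^ 2 * B) / (real n ^ 4 * (real n - 1))"
    using n by (intro divide_right_mono) auto
  also have "\<dots> = A * B / (real n - 1)" using n by (simp add: power2_eq_square power4_eq_xxxx)
  finally have le: "(\<Sum>k=1..n. \<Sum>l=1..n. a k l) * (\<Sum>k=1..n. \<Sum>l=1..n. b k l) / (real n ^ 4 * (real n - 1))
      \<le> A * B / (real n - 1)" .
  show ?thesis
    by (subst sum_dCov2_perms[OF n], erule a0, erule b0) (intro mult_left_mono le, simp)
qed

lemma sum_perm_tuples_compose: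
  assumes j: "j \<in> {1..K}" and \<pi>: "\<pi> permutes {1..n}"
  shows "(\<Sum>\<tau>\<in>perm_tuples K n. f (\<tau>(j := \<tau> j \<circ> \<pi>))) = (\<Sum>\<tau>\<in>perm_tuples K n. f \<tau>)"
proof -
  have mem: "\<tau>(j := \<tau> j \<circ> \<rho>) \<in> perm_tuples K n" if "\<tau> \<in> perm_tuples K n" "\<rho> permutes {1..n}" for \<tau> \<rho>
  proof -
    have "\<tau> j permutes {1..n}" using that j by (auto simp: perm_tuples_def)
    then have "\<tau> j \<circ> \<rho> permutes {1..n}" by (rule permutes_compose[OF that(2)])
    then show ?thesis using that(1) j unfolding perm_tuples_def by (auto simp: PiE_iff extensional_def)
  qed
  show ?thesis
    by (rule sum.reindex_bij_witness[of _ "\<lambda>\<tau>. \<tau>(j := \<tau> j \<circ> inv \<pi>)" "\<lambda>\<tau>. \<tau>(j := \<tau> j \<circ> \<pi>)"])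
       (use mem \<pi> permutes_inv[OF \<pi>] in \<open>simp_all add: comp_assoc permutes_inv_o\<close>)
qed

text \<open>The crude comparison with the sum of absolute values gives a bound free of the sample
  size.\<close>

lemma L2_set_diff_bound:
  assumes "\<And>p. p \<in> I \<Longrightarrow> u p \<in> {0..1}" "\<And>p. p \<in> I \<Longrightarrow> v p \<in> {0..1}"
  shows "L2_set (\<lambda>p. u p - v p) I \<in> {0..real (card I)}"
proof -
  have "L2_set (\<lambda>p. u p - v p) I \<le> (\<Sum>p\<in>I. \<bar>u p - v p\<bar>)" by (rule L2_set_le_sum_abs)
  also have "\<dots> \<le> (\<Sum>p\<in>I. 1)"
  proof (rule sum_mono)
    fix p assume "p \<in> I"
    then show "\<bar>u p - v p\<bar> \<le> 1" using assms[of p] by auto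
  qed
  finally show ?thesis by (simp add: L2_set_nonneg)
qed

lemma tuple_rank_in_cube:
  assumes cube: "\<And>j. j \<in> {1..K} \<Longrightarrow> h n j ` {1..n} \<subseteq> unit_cube (d j)"
    and "\<tau> \<in> perm_tuples K n" "m \<in> {1..K}" "k \<in> {1..n}" "c < d m"
  shows "h n m (\<tau> m k) c \<in> {0..1}"
proof -
  have "\<tau> m permutes {1..n}" using assms by (auto simp: perm_tuples_def)
  then have "\<tau> m k \<in> {1..n}" using permutes_in_image[of "\<tau> m" "{1..n}" k] assms(4) by blast
  then have "h n m (\<tau> m k) \<in> unit_cube (d m)" using cube[OF assms(3)] by blast
  then show ?thesis unfolding unit_cube_def by (rule PiE_mem) (simp add: assms(5))
qed

text \<open>Composing the \<open>j\<close>-th permutation with \<open>\<pi>\<close> permutes the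
  tuples, so the sum over tuples may be averaged over \<open>\<pi>\<close>. In summand
  \<open>j\<close> only the first kernel changes, as the second involves later blocks alone;
  \<open>sum_dCov2_perms_le\<close> therefore applies with the second kernel held fixed.\<close>

lemma tuple_stat_sum_le:
  assumes n: "n \<ge> 2" and cube: "\<And>j. j \<in> {1..K} \<Longrightarrow> h n j ` {1..n} \<subseteq> unit_cube (d j)"
  shows "(\<Sum>\<tau>\<in>perm_tuples K n. tuple_stat K d h n \<tau>)
    \<le> real (card (perm_tuples K n)) * ((\<Sum>j=1..K-1. real (d j) * real (card (SIGMA m:{j+1..K}. {..<d m}))) / (real n - 1))"
proof -
  let ?P = "{\<pi>. \<pi> permutes {1..n}}" and ?T = "perm_tuples K n"
  let ?J = "\<lambda>j. SIGMA m:{j+1..K}. {..<d m}"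
  define a where "a j \<tau> k l = dist_Rn (d j) (h n j (\<tau> j k)) (h n j (\<tau> j l))" for j and \<tau> :: "nat \<Rightarrow> nat \<Rightarrow> nat" and k l
  define b where "b j \<tau> k l = L2_set (\<lambda>(m, c). h n m (\<tau> m k) c - h n m (\<tau> m l) c) (?J j)" for j and \<tau> :: "nat \<Rightarrow> nat \<Rightarrow> nat" and k l
  have NP: "0 < real (card ?P)" using finite_perms perms_nonempty by (simp add: card_gt_0_iff)
  have one: "(\<Sum>\<tau>\<in>?T. dCov2 n (a j \<tau>) (b j \<tau>)) \<le> real (card ?T) * (real (d j) * real (card (?J j)) / (real n - 1))"
    if j': "j \<in> {1..K-1}" for j
  proof -
    have j: "j \<in> {1..K}" using j' by auto
    let ?c = "real (d j) * real (card (?J j)) / (real n - 1)"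
    have inner: "(\<Sum>\<pi>\<in>?P. dCov2 n (a j (\<tau>(j := \<tau> j \<circ> \<pi>))) (b j (\<tau>(j := \<tau> j \<circ> \<pi>)))) \<le> real (card ?P) * ?c"
      if \<tau>: "\<tau> \<in> ?T" for \<tau>
    proof -
      have r01: "h n m (\<tau> m k) c \<in> {0..1}" if "m \<in> {1..K}" "k \<in> {1..n}" "c < d m" for m k c
        by (rule tuple_rank_in_cube[where d = d and K = K])
           (erule cube, rule \<tau>, rule that(1), rule that(2), rule that(3))
      have b_eq: "b j (\<tau>(j := \<tau> j \<circ> \<pi>)) = b j \<tau>" for \<pi>
        unfolding b_def by (intro ext L2_set_cong refl) auto
      have a_eq: "a j (\<tau>(j := \<tau> j \<circ> \<pi>)) = (\<lambda>k l. a j \<tau> (\<pi> k) (\<pi> l))" for \<pi>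
        unfolding a_def by simp
      show ?thesis
        unfolding b_eq a_eq
      proof (rule sum_dCov2_perms_le[OF n])
        fix k l assume k: "k \<in> {1..n}" and l: "l \<in> {1..n}"
        have "L2_set (\<lambda>c. h n j (\<tau> j k) c - h n j (\<tau> j l) c) {..<d j} \<in> {0..real (card {..<d j})}"
          by (rule L2_set_diff_bound) (use r01[OF j] k l in auto)
        then show "a j \<tau> k l \<in> {0..real (d j)}" by (simp add: a_def dist_Rn_def)
        let ?u = "\<lambda>k p. h n (fst p) (\<tau> (fst p) k) (snd p)"
        have r: "?u k p \<in> {0..1}" if "p \<in> ?J j" "k \<in> {1..n}" for p k
          using that by (intro r01) auto
        have "L2_set (\<lambda>p. ?u k p - ?u l p) (?J j) \<in> {0..real (card (?J j))}"
          by (rule L2_set_diff_bound) (use r k l in auto)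
        moreover have "(\<lambda>p. ?u k p - ?u l p) = (\<lambda>(m, c). h n m (\<tau> m k) c - h n m (\<tau> m l) c)" by auto
        ultimately show "b j \<tau> k l \<in> {0..real (card (?J j))}" by (simp add: b_def)
      qed (auto simp: a_def b_def dist_Rn_def L2_set_def case_prod_unfold)
    qed
    have "real (card ?P) * (\<Sum>\<tau>\<in>?T. dCov2 n (a j \<tau>) (b j \<tau>))
        = (\<Sum>\<pi>\<in>?P. \<Sum>\<tau>\<in>?T. dCov2 n (a j (\<tau>(j := \<tau> j \<circ> \<pi>))) (b j (\<tau>(j := \<tau> j \<circ> \<pi>))))"
      using sum_perm_tuples_compose[OF j, where f = "\<lambda>\<tau>. dCov2 n (a j \<tau>) (b j \<tau>)"] by simp
    also have "\<dots> = (\<Sum>\<tau>\<in>?T. \<Sum>\<pi>\<in>?P. dCov2 n (a j (\<tau>(j := \<tau> j \<circ> \<pi>))) (b j (\<tau>(j := \<tau> j \<circ> \<pi>))))"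
      by (rule sum.swap)
    also have "\<dots> \<le> (\<Sum>\<tau>\<in>?T. real (card ?P) * ?c)" by (rule sum_mono[OF inner])
    also have "\<dots> = real (card ?P) * (real (card ?T) * ?c)" by simp
    finally show ?thesis using NP by (simp only: mult_le_cancel_left_pos)
  qed
  have "(\<Sum>\<tau>\<in>?T. tuple_stat K d h n \<tau>) = (\<Sum>j=1..K-1. \<Sum>\<tau>\<in>?T. dCov2 n (a j \<tau>) (b j \<tau>))"
    unfolding tuple_stat_def a_def b_def by (rule sum.swap)
  also have "\<dots> \<le> (\<Sum>j=1..K-1. real (card ?T) * (real (d j) * real (card (?J j)) / (real n - 1)))"
    by (rule sum_mono[OF one])
  also have "\<dots> = real (card ?T) * ((\<Sum>j=1..K-1. real (d j) * real (card (?J j))) / (real n - 1))"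
    by (simp only: sum_distrib_left sum_divide_distrib)
  finally show ?thesis .
qed

lemma tuple_stat_nonneg:
  assumes "n \<ge> 1"
  shows "0 \<le> tuple_stat K d h n \<tau>"
  unfolding tuple_stat_def
proof (rule sum_nonneg)
  fix j
  have "0 \<le> dCov2 n (\<lambda>k l. L2_set (\<lambda>c. h n j (\<tau> j k) c - h n j (\<tau> j l) c) {..<d j})
     (\<lambda>k l. L2_set (\<lambda>p. h n (fst p) (\<tau> (fst p) k) (snd p) - h n (fst p) (\<tau> (fst p) l) (snd p))
        (SIGMA m:{j+1..K}. {..<d m}))"
    by (rule dCov2_dist_nonneg[OF assms]) auto
  then show "0 \<le> dCov2 n (\<lambda>k l. dist_Rn (d j) (h n j (\<tau> j k)) (h n j (\<tau> j l)))
     (\<lambda>k l. L2_set (\<lambda>(m, c). h n m (\<tau> m k) c - h n m (\<tau> m l) c) (SIGMA m:{j+1..K}. {..<d m}))"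
    by (simp add: dist_Rn_def case_prod_unfold)
qed

text \<open>Markov's inequality by counting: the tuple is uniform, and
  \<open>tuple_stat_sum_le\<close> bounds the mean of the non-negative statistic by a constant over
  n - 1.\<close>

lemma RdCov2_vanishes_under_H0:
  assumes iid: "iid_from K d M {1..} X \<mu>" and ac: "ac_marginals K d \<mu>" and H: "H0 K d \<mu>"
    and inj: "\<And>n j. n \<ge> 1 \<Longrightarrow> j \<in> {1..K} \<Longrightarrow> inj_on (h n j) {1..n}"
    and cube: "\<And>n j. n \<ge> 1 \<Longrightarrow> j \<in> {1..K} \<Longrightarrow> h n j ` {1..n} \<subseteq> unit_cube (d j)"
    and \<epsilon>: "\<epsilon> > 0"
  shows "(\<lambda>n. measure M {\<omega> \<in> space M. \<epsilon> \<le> RdCov2 K d h n (\<lambda>i. X i \<omega>)}) \<longlonglongrightarrow> 0"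
proof -
  define C where "C = (\<Sum>j=1..K-1. real (d j) * real (card (SIGMA m:{j+1..K}. {..<d m})))"
  have bound: "measure M {\<omega> \<in> space M. \<epsilon> \<le> RdCov2 K d h n (\<lambda>i. X i \<omega>)} \<le> C / \<epsilon> / (real n - 1)"
    if n: "n \<ge> 2" for n
  proof -
    let ?T = "perm_tuples K n" and ?G = "\<lambda>\<tau>. \<epsilon> \<le> tuple_stat K d h n \<tau>"
    have n1: "n \<ge> 1" using n by simp
    have T: "0 < real (card ?T)" using finite_perm_tuples perm_tuples_nonempty by (simp add: card_gt_0_iff)
    have eq: "measure M {\<omega> \<in> space M. \<epsilon> \<le> RdCov2 K d h n (\<lambda>i. X i \<omega>)} = card {\<tau> \<in> ?T. ?G \<tau>} / card ?T"
      unfolding RdCov2_eq_tuple_stat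
      by (rule opt_tuple_uniform[OF iid _ n1 ac H, where G = ?G]) (use n1 inj cube in auto)
    have "real (card {\<tau> \<in> ?T. ?G \<tau>}) * \<epsilon> = (\<Sum>\<tau>\<in>{\<tau> \<in> ?T. ?G \<tau>}. \<epsilon>)" by simp
    also have "\<dots> \<le> (\<Sum>\<tau>\<in>{\<tau> \<in> ?T. ?G \<tau>}. tuple_stat K d h n \<tau>)" by (rule sum_mono) simp
    also have "\<dots> \<le> (\<Sum>\<tau>\<in>?T. tuple_stat K d h n \<tau>)"
      by (rule sum_mono2[OF finite_perm_tuples]) (auto simp: tuple_stat_nonneg[OF n1])
    also have "\<dots> \<le> real (card ?T) * (C / (real n - 1))"
      unfolding C_def by (rule tuple_stat_sum_le[OF n]) (rule cube[OF n1])
    finally have "real (card {\<tau> \<in> ?T. ?G \<tau>}) / real (card ?T) * \<epsilon> \<le> C / (real n - 1)"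
      using T by (simp add: divide_le_eq mult.commute)
    then have "real (card {\<tau> \<in> ?T. ?G \<tau>}) / real (card ?T) \<le> C / (real n - 1) / \<epsilon>"
      by (subst pos_le_divide_eq[OF \<epsilon>])
    then show ?thesis unfolding eq by (simp add: mult.commute)
  qed
  have "(\<lambda>n. C / \<epsilon> / (real n - 1)) \<longlonglongrightarrow> 0"
  proof (rule tendsto_divide_0[OF tendsto_const], rule filterlim_at_top_imp_at_infinity)
    show "filterlim (\<lambda>n. real n - 1) at_top sequentially"
      using filterlim_tendsto_add_at_top[OF tendsto_const[of "-1::real"] filterlim_real_sequentially] by simp
  qed
  then show ?thesis
    by (rule tendsto_sandwich[OF _ _ tendsto_const, rotated -1])
       (use bound in \<open>auto simp: eventually_sequentially intro!: exI[of _ 2]\<close>)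
qed

section \<open>Distribution-freeness and consistency\<close>

text \<open>The right-hand side mentions neither the sample nor \<kappa>, which is
  distribution-freeness.\<close>

lemma emeasure_distr_RdCov2:
  assumes L: "iid_from K d L {1..n} Z \<kappa>" "ac_marginals K d \<kappa>" "H0 K d \<kappa>" and n: "n \<ge> 1"
    and inj: "\<And>j. j \<in> {1..K} \<Longrightarrow> inj_on (h n j) {1..n}"
    and cube: "\<And>j. j \<in> {1..K} \<Longrightarrow> h n j ` {1..n} \<subseteq> unit_cube (d j)"
    and A: "A \<in> sets borel"
  shows "emeasure (distr L borel (\<lambda>\<omega>. RdCov2 K d h n (\<lambda>i. Z i \<omega>))) A
      = ennreal (card {\<tau> \<in> perm_tuples K n. tuple_stat K d h n \<tau> \<in> A} / card (perm_tuples K n))"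
proof -
  interpret prob_space L using L by (simp add: iid_from_def)
  have "Z i \<in> measurable L (block_space K d)" if "i \<in> {1..n}" for i
    using L that by (auto simp: iid_from_def indep_vars_def)
  then have m: "(\<lambda>\<omega>. RdCov2 K d h n (\<lambda>i. Z i \<omega>)) \<in> borel_measurable L" by (rule RdCov2_measurable)
  have u: "measure L {\<omega> \<in> space L. tuple_stat K d h n (opt_tuple K d h n (\<lambda>i. Z i \<omega>)) \<in> A}
      = card {\<tau> \<in> perm_tuples K n. tuple_stat K d h n \<tau> \<in> A} / card (perm_tuples K n)"
    by (rule opt_tuple_uniform[OF L(1) order_refl n L(2,3), where G = "\<lambda>\<tau>. tuple_stat K d h n \<tau> \<in> A"])
       (erule inj, erule cube)
  have "emeasure (distr L borel (\<lambda>\<omega>. RdCov2 K d h n (\<lambda>i. Z i \<omega>))) A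
      = emeasure L ((\<lambda>\<omega>. RdCov2 K d h n (\<lambda>i. Z i \<omega>)) -` A \<inter> space L)"
    by (rule emeasure_distr[OF m A])
  also have "(\<lambda>\<omega>. RdCov2 K d h n (\<lambda>i. Z i \<omega>)) -` A \<inter> space L
      = {\<omega> \<in> space L. tuple_stat K d h n (opt_tuple K d h n (\<lambda>i. Z i \<omega>)) \<in> A}"
    unfolding RdCov2_eq_tuple_stat by blast
  finally show ?thesis
    unfolding emeasure_eq_measure u .
qed

text \<open>A negative threshold is exceeded with probability 1, more than \<alpha>. So the set of
  admissible thresholds is bounded below, and \<open>Inf\<close> is at most each of its
  members.\<close>

lemma crit_value_le:
  assumes "prob_space N" and T: "\<And>\<omega>. \<omega> \<in> space N \<Longrightarrow> 0 \<le> T \<omega>" and \<alpha>: "\<alpha> < 1"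
    and c: "measure N {\<omega> \<in> space N. c \<le> T \<omega>} \<le> \<alpha>"
  shows "crit_value \<alpha> N T \<le> c"
  unfolding crit_value_def
proof (rule cInf_lower)
  interpret prob_space N by fact
  show "c \<in> {c. measure N {\<omega> \<in> space N. c \<le> T \<omega>} \<le> \<alpha>}" using c by simp
  show "bdd_below {c. measure N {\<omega> \<in> space N. c \<le> T \<omega>} \<le> \<alpha>}"
  proof (rule bdd_belowI[of _ 0])
    fix c' assume c': "c' \<in> {c. measure N {\<omega> \<in> space N. c \<le> T \<omega>} \<le> \<alpha>}"
    show "0 \<le> c'"
    proof (rule ccontr)
      assume "\<not> 0 \<le> c'"
      then have "{\<omega> \<in> space N. c' \<le> T \<omega>} = space N" using T by (auto intro: order_trans[of c' 0])
      then show False using c' \<alpha> prob_space by simp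
    qed
  qed
qed

theorem propositionD1:
  fixes K :: nat and d :: "nat \<Rightarrow> nat" and h :: "nat \<Rightarrow> nat \<Rightarrow> nat \<Rightarrow> rvec"
  assumes "K \<ge> 2"
    and "\<And>j. j \<in> {1..K} \<Longrightarrow> d j \<ge> 1"
    and "\<And>n j. n \<ge> 1 \<Longrightarrow> j \<in> {1..K} \<Longrightarrow> inj_on (h n j) {1..n}"
    and "\<And>n j. n \<ge> 1 \<Longrightarrow> j \<in> {1..K} \<Longrightarrow> h n j ` {1..n} \<subseteq> unit_cube (d j)"
  shows
    "(\<forall>n\<ge>1. \<forall>(M :: 'a measure) X \<mu> (M' :: 'b measure) X' \<mu>'.
        iid_from K d M {1..n} X \<mu> \<and> ac_marginals K d \<mu> \<and> H0 K d \<mu> \<and>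
        iid_from K d M' {1..n} X' \<mu>' \<and> ac_marginals K d \<mu>' \<and> H0 K d \<mu>' \<longrightarrow>
        distr M borel (\<lambda>\<omega>. RdCov2 K d h n (\<lambda>i. X i \<omega>)) =
        distr M' borel (\<lambda>\<omega>. RdCov2 K d h n (\<lambda>i. X' i \<omega>)))
     \<and>
     ((\<forall>j\<in>{1..K}. weak_conv_Rn (d j) (\<lambda>n. empirical_distr (d j) n (h n j)) (unif_cube (d j))) \<longrightarrow>
      (\<forall>\<alpha> (N :: 'b measure) Y \<nu> (M :: 'a measure) X \<mu>.
        0 < \<alpha> \<and> \<alpha> < 1 \<and>
        iid_from K d N {1..} Y \<nu> \<and> ac_marginals K d \<nu> \<and> H0 K d \<nu> \<and>
        iid_from K d M {1..} X \<mu> \<and> ac_marginals K d \<mu> \<and> \<not> H0 K d \<mu> \<longrightarrow>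
        (\<lambda>n. measure M {\<omega> \<in> space M.
                real n * RdCov2 K d h n (\<lambda>i. X i \<omega>)
                \<ge> crit_value \<alpha> N (\<lambda>\<omega>'. real n * RdCov2 K d h n (\<lambda>i. Y i \<omega>'))})
          \<longlonglongrightarrow> 1))"
proof (intro conjI allI impI; (elim conjE)?)
  fix n :: nat and M :: "'a measure" and X \<mu> and M' :: "'b measure" and X' \<mu>'
  assume n: "n \<ge> 1"
    and M: "iid_from K d M {1..n} X \<mu>" "ac_marginals K d \<mu>" "H0 K d \<mu>"
    and M': "iid_from K d M' {1..n} X' \<mu>'" "ac_marginals K d \<mu>'" "H0 K d \<mu>'"
  show "distr M borel (\<lambda>\<omega>. RdCov2 K d h n (\<lambda>i. X i \<omega>)) = distr M' borel (\<lambda>\<omega>. RdCov2 K d h n (\<lambda>i. X' i \<omega>))"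
  proof (rule measure_eqI)
    fix A assume "A \<in> sets (distr M borel (\<lambda>\<omega>. RdCov2 K d h n (\<lambda>i. X i \<omega>)))"
    then have A: "A \<in> sets borel" by simp
    show "emeasure (distr M borel (\<lambda>\<omega>. RdCov2 K d h n (\<lambda>i. X i \<omega>))) A
        = emeasure (distr M' borel (\<lambda>\<omega>. RdCov2 K d h n (\<lambda>i. X' i \<omega>))) A"
      \<comment> \<open>Both laws are rewritten to the same count over
        \<open>perm_tuples\<close>.\<close>
      by (subst emeasure_distr_RdCov2[OF M n _ _ A, where h = h], erule assms(3)[OF n], erule assms(4)[OF n],
          subst emeasure_distr_RdCov2[OF M' n _ _ A, where h = h], erule assms(3)[OF n], erule assms(4)[OF n], rule refl)
  qed simp
next
  fix \<alpha> :: real and N :: "'b measure" and Y \<nu> and M :: "'a measure" and X \<mu>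
  assume weak: "\<forall>j\<in>{1..K}. weak_conv_Rn (d j) (\<lambda>n. empirical_distr (d j) n (h n j)) (unif_cube (d j))"
    and \<alpha>: "0 < \<alpha>" "\<alpha> < 1"
    and N: "iid_from K d N {1..} Y \<nu>" "ac_marginals K d \<nu>" "H0 K d \<nu>"
    and M: "iid_from K d M {1..} X \<mu>" "ac_marginals K d \<mu>" "\<not> H0 K d \<mu>"
  have K1: "K \<ge> 1" using assms(1) by simp
  have "\<exists>\<epsilon>>0. (\<lambda>n. measure M {\<omega> \<in> space M. \<epsilon> \<le> RdCov2 K d h n (\<lambda>i. X i \<omega>)}) \<longlonglongrightarrow> 1"
    by (rule RdCov2_bounded_below_in_probability[OF K1 _ _ _ M(1,3)])
       (erule assms(2), erule (1) assms(4), erule bspec[OF weak])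
  then obtain \<epsilon> where \<epsilon>: "\<epsilon> > 0"
    and lim: "(\<lambda>n. measure M {\<omega> \<in> space M. \<epsilon> \<le> RdCov2 K d h n (\<lambda>i. X i \<omega>)}) \<longlonglongrightarrow> 1" by blast
  interpret M: prob_space M using M by (simp add: iid_from_def)
  have pN: "prob_space N" using N by (simp add: iid_from_def)
  let ?c = "\<lambda>n. crit_value \<alpha> N (\<lambda>\<omega>'. real n * RdCov2 K d h n (\<lambda>i. Y i \<omega>'))"
  have "(\<lambda>n. measure N {\<omega> \<in> space N. \<epsilon> \<le> RdCov2 K d h n (\<lambda>i. Y i \<omega>)}) \<longlonglongrightarrow> 0"
    by (rule RdCov2_vanishes_under_H0[OF N _ _ \<epsilon>]) (erule (1) assms(3), erule (1) assms(4))
  \<comment> \<open>Hence \<open>n * \<epsilon>\<close> is eventually an admissible threshold and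
    bounds the critical value, while under the alternative the scaled statistic reaches it with
    probability tending to 1.\<close>
  then have "\<forall>\<^sub>F n in sequentially. measure N {\<omega> \<in> space N. \<epsilon> \<le> RdCov2 K d h n (\<lambda>i. Y i \<omega>)} < \<alpha>"
    using \<alpha> by (auto dest: order_tendstoD)
  then have ev: "\<forall>\<^sub>F n in sequentially. measure M {\<omega> \<in> space M. \<epsilon> \<le> RdCov2 K d h n (\<lambda>i. X i \<omega>)}
      \<le> measure M {\<omega> \<in> space M. real n * RdCov2 K d h n (\<lambda>i. X i \<omega>) \<ge> ?c n}"
    using eventually_ge_at_top[of 1]
  proof eventually_elim
    case (elim n)
    have Xm: "X i \<in> measurable M (block_space K d)" if "i \<in> {1..n}" for i
      using M(1) that by (auto simp: iid_from_def M.indep_vars_def)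
    have [measurable]: "(\<lambda>\<omega>. RdCov2 K d h n (\<lambda>i. X i \<omega>)) \<in> borel_measurable M"
      by (rule RdCov2_measurable[OF Xm])
    have "?c n \<le> real n * \<epsilon>"
    proof (rule crit_value_le[OF pN _ \<alpha>(2)])
      show "0 \<le> real n * RdCov2 K d h n (\<lambda>i. Y i \<omega>)" for \<omega>
        using elim by (intro mult_nonneg_nonneg RdCov2_nonneg) auto
      show "measure N {\<omega> \<in> space N. real n * \<epsilon> \<le> real n * RdCov2 K d h n (\<lambda>i. Y i \<omega>)} \<le> \<alpha>"
        using elim by simp
    qed
    moreover have "real n * \<epsilon> \<le> real n * y" if "\<epsilon> \<le> y" for y using that by (intro mult_left_mono) auto
    ultimately have "{\<omega> \<in> space M. \<epsilon> \<le> RdCov2 K d h n (\<lambda>i. X i \<omega>)}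
        \<subseteq> {\<omega> \<in> space M. real n * RdCov2 K d h n (\<lambda>i. X i \<omega>) \<ge> ?c n}" by (blast intro: order_trans)
    then show ?case by (rule M.finite_measure_mono) measurable
  qed
  show "(\<lambda>n. measure M {\<omega> \<in> space M. real n * RdCov2 K d h n (\<lambda>i. X i \<omega>) \<ge> ?c n}) \<longlonglongrightarrow> 1"
    by (rule tendsto_sandwich[OF ev _ lim tendsto_const]) (simp add: M.prob_le_1)
qed

end
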